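(* (In NBG class theory with the Axiom of Choice.) Let $M$ be an inner model and let $j_0, j_1 : V \to M$ be elementary embeddings from the universe of sets into $M$. Then $j_0(\alpha) = j_1(\alpha)$ for every ordinal $\alpha$.
   Context: The background theory is second-order (class) set theory NBG with the Axiom of Choice; the elementary embeddings are arbitrary classes, not assumed to be first-order definable. An inner model is a transitive proper class that is a model of ZFC. Elementarity is with respect to the language $\{\in\}$ (for embeddings $V\to M$ with $M$ an inner model, $\Sigma_1$-elementarity suffices for $\Sigma_n$-elementarity for each $n$). *)

theory Defs
  imports Main
begin

text \<open>
  A model of class theory is presented in the usual two-sorted way. The sets are the elements of
  a type \<open>'v\<close>, related by an arbitrary (not necessarily well-founded from the outside) binary
  relation \<open>E\<close>, where \<open>E x y\<close> reads ``\<open>x\<close> is an element of \<open>y\<close>''. Classes are identified with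
  their extensions, so the second sort is a family \<open>Cls :: 'v set set\<close>, which need not contain
  every subset of \<open>'v\<close> (Henkin semantics). Extensionality for classes is thereby built in.
\<close>

subsection \<open>Formulas\<close>

text \<open>
  All quantifiers range over sets. \<open>InCls i k\<close> says that the value of the \<open>i\<close>-th set variable
  belongs to the \<open>k\<close>-th class parameter; it is used only for class comprehension.
\<close>

datatype fm =
    Mem nat nat
  | Eq nat nat
  | InCls nat nat
  | Neg fm
  | And fm fm
  | All nat fm

text \<open>The formulas of the language \<open>{\<in>}\<close> of set theory.\<close>

primrec set_fm :: "fm \<Rightarrow> bool" where
  "set_fm (Mem i k) = True"
| "set_fm (Eq i k) = True"
| "set_fm (InCls i k) = False"
| "set_fm (Neg p) = set_fm p"
| "set_fm (And p q) = (set_fm p \<and> set_fm q)"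
| "set_fm (All i p) = set_fm p"

primrec sat :: "'v set \<Rightarrow> ('v \<Rightarrow> 'v \<Rightarrow> bool) \<Rightarrow> (nat \<Rightarrow> 'v set) \<Rightarrow> fm \<Rightarrow> (nat \<Rightarrow> 'v) \<Rightarrow> bool" where
  "sat D E C (Mem i k) s = E (s i) (s k)"
| "sat D E C (Eq i k) s = (s i = s k)"
| "sat D E C (InCls i k) s = (s i \<in> C k)"
| "sat D E C (Neg p) s = (\<not> sat D E C p s)"
| "sat D E C (And p q) s = (sat D E C p s \<and> sat D E C q s)"
| "sat D E C (All i p) s = (\<forall>x\<in>D. sat D E C p (s(i := x)))"

text \<open>On formulas without \<open>InCls\<close> the class assignment is irrelevant.\<close>

definition set_sat :: "'v set \<Rightarrow> ('v \<Rightarrow> 'v \<Rightarrow> bool) \<Rightarrow> fm \<Rightarrow> (nat \<Rightarrow> 'v) \<Rightarrow> bool" where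
  "set_sat D E p s \<longleftrightarrow> sat D E (\<lambda>_. {}) p s"

subsection \<open>Axioms of set theory, relativized to a domain \<open>D\<close>\<close>

definition extensionality_ax :: "'v set \<Rightarrow> ('v \<Rightarrow> 'v \<Rightarrow> bool) \<Rightarrow> bool" where
  "extensionality_ax D E \<longleftrightarrow>
     (\<forall>x\<in>D. \<forall>y\<in>D. (\<forall>z\<in>D. E z x \<longleftrightarrow> E z y) \<longrightarrow> x = y)"

definition foundation_ax :: "'v set \<Rightarrow> ('v \<Rightarrow> 'v \<Rightarrow> bool) \<Rightarrow> bool" where
  "foundation_ax D E \<longleftrightarrow>
     (\<forall>x\<in>D. (\<exists>y\<in>D. E y x) \<longrightarrow> (\<exists>y\<in>D. E y x \<and> \<not> (\<exists>z\<in>D. E z x \<and> E z y)))"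

definition pairing_ax :: "'v set \<Rightarrow> ('v \<Rightarrow> 'v \<Rightarrow> bool) \<Rightarrow> bool" where
  "pairing_ax D E \<longleftrightarrow>
     (\<forall>x\<in>D. \<forall>y\<in>D. \<exists>a\<in>D. \<forall>z\<in>D. E z a \<longleftrightarrow> z = x \<or> z = y)"

definition union_ax :: "'v set \<Rightarrow> ('v \<Rightarrow> 'v \<Rightarrow> bool) \<Rightarrow> bool" where
  "union_ax D E \<longleftrightarrow>
     (\<forall>a\<in>D. \<exists>u\<in>D. \<forall>z\<in>D. E z u \<longleftrightarrow> (\<exists>x\<in>D. E x a \<and> E z x))"

definition powerset_ax :: "'v set \<Rightarrow> ('v \<Rightarrow> 'v \<Rightarrow> bool) \<Rightarrow> bool" where
  "powerset_ax D E \<longleftrightarrow>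
     (\<forall>a\<in>D. \<exists>p\<in>D. \<forall>x\<in>D. E x p \<longleftrightarrow> (\<forall>z\<in>D. E z x \<longrightarrow> E z a))"

definition infinity_ax :: "'v set \<Rightarrow> ('v \<Rightarrow> 'v \<Rightarrow> bool) \<Rightarrow> bool" where
  "infinity_ax D E \<longleftrightarrow>
     (\<exists>a\<in>D. (\<exists>z\<in>D. E z a \<and> (\<forall>w\<in>D. \<not> E w z)) \<and>
             (\<forall>x\<in>D. E x a \<longrightarrow> (\<exists>y\<in>D. E y a \<and> (\<forall>w\<in>D. E w y \<longleftrightarrow> E w x \<or> w = x))))"

text \<open>Every set of nonempty, pairwise disjoint sets has a transversal.\<close>

definition choice_ax :: "'v set \<Rightarrow> ('v \<Rightarrow> 'v \<Rightarrow> bool) \<Rightarrow> bool" where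
  "choice_ax D E \<longleftrightarrow>
     (\<forall>a\<in>D. (\<forall>x\<in>D. E x a \<longrightarrow> (\<exists>y\<in>D. E y x)) \<and>
             (\<forall>x\<in>D. \<forall>y\<in>D. E x a \<and> E y a \<and> x \<noteq> y \<longrightarrow> \<not> (\<exists>z\<in>D. E z x \<and> E z y)) \<longrightarrow>
             (\<exists>c\<in>D. \<forall>x\<in>D. E x a \<longrightarrow> (\<exists>!y. y \<in> D \<and> E y x \<and> E y c)))"

text \<open>
  In the two schemata, variable \<open>0\<close> (and \<open>1\<close> for replacement) is the distinguished one and the
  remaining values of the assignment \<open>s\<close> are the parameters.
\<close>

definition separation_schema :: "'v set \<Rightarrow> ('v \<Rightarrow> 'v \<Rightarrow> bool) \<Rightarrow> bool" where
  "separation_schema D E \<longleftrightarrow>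
     (\<forall>p s. set_fm p \<and> range s \<subseteq> D \<longrightarrow>
        (\<forall>a\<in>D. \<exists>b\<in>D. \<forall>x\<in>D. E x b \<longleftrightarrow> E x a \<and> set_sat D E p (s(0 := x))))"

definition replacement_schema :: "'v set \<Rightarrow> ('v \<Rightarrow> 'v \<Rightarrow> bool) \<Rightarrow> bool" where
  "replacement_schema D E \<longleftrightarrow>
     (\<forall>p s. set_fm p \<and> range s \<subseteq> D \<longrightarrow>
        (\<forall>a\<in>D.
           (\<forall>x\<in>D. E x a \<longrightarrow> (\<exists>!y. y \<in> D \<and> set_sat D E p (s(0 := x, 1 := y)))) \<longrightarrow>
           (\<exists>b\<in>D. \<forall>y\<in>D. E y b \<longleftrightarrow> (\<exists>x\<in>D. E x a \<and> set_sat D E p (s(0 := x, 1 := y))))))"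

definition models_ZFC :: "'v set \<Rightarrow> ('v \<Rightarrow> 'v \<Rightarrow> bool) \<Rightarrow> bool" where
  "models_ZFC D E \<longleftrightarrow>
     extensionality_ax D E \<and> foundation_ax D E \<and> pairing_ax D E \<and> union_ax D E \<and>
     powerset_ax D E \<and> infinity_ax D E \<and> separation_schema D E \<and> replacement_schema D E \<and>
     choice_ax D E"

subsection \<open>NBG with the Axiom of Choice\<close>

definition is_upair :: "('v \<Rightarrow> 'v \<Rightarrow> bool) \<Rightarrow> 'v \<Rightarrow> 'v \<Rightarrow> 'v \<Rightarrow> bool" where
  "is_upair E z x y \<longleftrightarrow> (\<forall>w. E w z \<longleftrightarrow> w = x \<or> w = y)"

text \<open>\<open>p\<close> is the Kuratowski pair \<open>{{x}, {x, y}}\<close>.\<close>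

definition is_pair :: "('v \<Rightarrow> 'v \<Rightarrow> bool) \<Rightarrow> 'v \<Rightarrow> 'v \<Rightarrow> 'v \<Rightarrow> bool" where
  "is_pair E p x y \<longleftrightarrow> (\<forall>z. E z p \<longleftrightarrow> is_upair E z x x \<or> is_upair E z x y)"

definition app_rel :: "('v \<Rightarrow> 'v \<Rightarrow> bool) \<Rightarrow> 'v set \<Rightarrow> 'v \<Rightarrow> 'v \<Rightarrow> bool" where
  "app_rel E F x y \<longleftrightarrow> (\<exists>p\<in>F. is_pair E p x y)"

text \<open>
  Class comprehension is the predicative one: set and class parameters are allowed, but only sets
  are quantified. Choice is assumed for sets only; no global choice class is required.
\<close>

locale NBG_AC =
  fixes E :: "'v \<Rightarrow> 'v \<Rightarrow> bool" and Cls :: "'v set set"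
  assumes extensionality: "extensionality_ax UNIV E"
    and set_is_class: "{y. E y x} \<in> Cls"
    and comprehension: "(\<And>k. C k \<in> Cls) \<Longrightarrow> {x. sat UNIV E C p (s(0 := x))} \<in> Cls"
    and foundation: "X \<in> Cls \<Longrightarrow> X \<noteq> {} \<Longrightarrow> \<exists>x\<in>X. \<forall>y\<in>X. \<not> E y x"
    and pairing: "pairing_ax UNIV E"
    and union: "union_ax UNIV E"
    and powerset: "powerset_ax UNIV E"
    and infinity: "infinity_ax UNIV E"
    and replacement: "F \<in> Cls \<Longrightarrow> (\<And>x y z. app_rel E F x y \<Longrightarrow> app_rel E F x z \<Longrightarrow> y = z) \<Longrightarrow>
          \<exists>b. \<forall>y. E y b \<longleftrightarrow> (\<exists>x. E x a \<and> app_rel E F x y)"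
    and choice: "choice_ax UNIV E"

subsection \<open>Ordinals, inner models, elementary embeddings\<close>

text \<open>A transitive set strictly well-ordered by \<open>\<in>\<close>.\<close>

definition ordinal :: "('v \<Rightarrow> 'v \<Rightarrow> bool) \<Rightarrow> 'v \<Rightarrow> bool" where
  "ordinal E a \<longleftrightarrow>
     (\<forall>x y. E x a \<and> E y x \<longrightarrow> E y a) \<and>
     (\<forall>x. E x a \<longrightarrow> \<not> E x x) \<and>
     (\<forall>x y z. E x a \<and> E y a \<and> E z a \<and> E x y \<and> E y z \<longrightarrow> E x z) \<and>
     (\<forall>x y. E x a \<and> E y a \<longrightarrow> E x y \<or> x = y \<or> E y x) \<and>
     (\<forall>b. (\<exists>x. E x b) \<and> (\<forall>x. E x b \<longrightarrow> E x a) \<longrightarrow>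
        (\<exists>x. E x b \<and> (\<forall>y. E y b \<longrightarrow> x = y \<or> E x y)))"

definition proper_class :: "('v \<Rightarrow> 'v \<Rightarrow> bool) \<Rightarrow> 'v set set \<Rightarrow> 'v set \<Rightarrow> bool" where
  "proper_class E Cls X \<longleftrightarrow> X \<in> Cls \<and> \<not> (\<exists>a. X = {x. E x a})"

definition inner_model :: "('v \<Rightarrow> 'v \<Rightarrow> bool) \<Rightarrow> 'v set set \<Rightarrow> 'v set \<Rightarrow> bool" where
  "inner_model E Cls M \<longleftrightarrow>
     proper_class E Cls M \<and> (\<forall>x\<in>M. \<forall>y. E y x \<longrightarrow> y \<in> M) \<and> models_ZFC M E"

text \<open>
  A class function is a HOL function whose graph, coded with Kuratowski pairs, is one of the
  classes of the model; it need not be definable. Elementarity is the schema over all formulas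
  of \<open>{\<in>}\<close>.
\<close>

definition class_function :: "('v \<Rightarrow> 'v \<Rightarrow> bool) \<Rightarrow> 'v set set \<Rightarrow> ('v \<Rightarrow> 'v) \<Rightarrow> bool" where
  "class_function E Cls j \<longleftrightarrow> {p. \<exists>x. is_pair E p x (j x)} \<in> Cls"

definition elementary_embedding ::
    "('v \<Rightarrow> 'v \<Rightarrow> bool) \<Rightarrow> 'v set set \<Rightarrow> 'v set \<Rightarrow> ('v \<Rightarrow> 'v) \<Rightarrow> bool" where
  "elementary_embedding E Cls M j \<longleftrightarrow>
     class_function E Cls j \<and> range j \<subseteq> M \<and>
     (\<forall>p s. set_fm p \<longrightarrow> (set_sat UNIV E p s \<longleftrightarrow> set_sat M E p (j \<circ> s)))"

end

theory Submission
  imports Defs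
begin

text \<open>
  Write \<open>H G\<close> for the set of ordinals that are images of the set \<open>G\<close>, and \<open>V\<^sup>B\<^sub>i\<close> for the power set
  hierarchy that starts with \<open>B\<close>. For limits \<open>i\<close> the ordinals \<open>H V\<^sup>B\<^sub>i\<close> are regular by choice, strictly
  increasing in \<open>i\<close>, and fixed by an embedding \<open>j\<close> with \<open>j i = i\<close> and \<open>j B \<subseteq> B\<close>.

  Let \<open>\<alpha>\<close> be least with \<open>j \<alpha> \<noteq> k \<alpha>\<close>. Then \<open>j\<close> and \<open>k\<close> disagree at the regular ordinal
  \<open>\<tau> = H V\<^sub>\<alpha>\<close>, hence, cofinalities being unique in \<open>M\<close>, at every ordinal of cofinality \<open>\<tau>\<close>.
  Take a common fixed point \<open>\<gamma> > \<alpha>\<close>, let \<open>\<theta> = H V\<^sub>\<gamma>\<close> and \<open>B = Pow \<theta>\<close>, and let \<open>a\<close> enumerate the ordinals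
  at which \<open>j\<close> and \<open>k\<close> agree. For every \<open>i < \<theta>\<close> of cofinality \<open>\<tau>\<close> they disagree at
  \<open>T\<^sub>i = H V\<^sup>B\<^sub>i\<close>, and so at the ordinal \<open>X\<^sub>i = sup a[T\<^sub>i]\<close> of cofinality \<open>T\<^sub>i\<close>. On a stationary set of \<open>i\<close> the
  disagreement has a constant direction, say \<open>j X\<^sub>i < k X\<^sub>i\<close>.

  Silver's method gives functions \<open>f\<^sub>\<zeta>\<close> in the product of the \<open>T\<^sub>i\<close>, indexed by the fixed ordinal
  \<open>\<delta> = H V\<^sup>B\<^sub>\<theta>\<close>, that eventually dominate every function in this product on an unbounded set of \<open>i\<close>. Thus
  the functions \<open>a \<circ> f\<^sub>\<zeta>\<close>, whose values are points of agreement, dominate the product of the \<open>X\<^sub>i\<close>. Transfer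
  this to \<open>M\<close> by \<open>k\<close> and apply it to the function \<open>j X\<close>: at large common fixed arguments,
  \<open>j X\<^sub>i < k (a (f\<^sub>\<zeta> i)) = j (a (f\<^sub>\<zeta> i)) < j X\<^sub>i\<close>.
\<close>

section \<open>Definability\<close>

definition cons_env :: "'v \<Rightarrow> (nat \<Rightarrow> 'v) \<Rightarrow> nat \<Rightarrow> 'v" (infixr "##" 65) where
  "x ## s = (\<lambda>n. case n of 0 \<Rightarrow> x | Suc m \<Rightarrow> s m)"

lemma cons_env_simps [simp]: "(x ## s) 0 = x" "(x ## s) (Suc n) = s n"
  by (simp_all add: cons_env_def)

section \<open>Renaming of variables and of class parameters\<close>

primrec ren :: "(nat \<Rightarrow> nat) \<Rightarrow> fm \<Rightarrow> fm" where
  "ren r (Mem i k) = Mem (r i) (r k)"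
| "ren r (Eq i k) = Eq (r i) (r k)"
| "ren r (InCls i k) = InCls (r i) k"
| "ren r (Neg p) = Neg (ren r p)"
| "ren r (And p q) = And (ren r p) (ren r q)"
| "ren r (All i p) = All (r i) (ren r p)"

primrec renc :: "(nat \<Rightarrow> nat) \<Rightarrow> fm \<Rightarrow> fm" where
  "renc r (Mem i k) = Mem i k"
| "renc r (Eq i k) = Eq i k"
| "renc r (InCls i k) = InCls i (r k)"
| "renc r (Neg p) = Neg (renc r p)"
| "renc r (And p q) = And (renc r p) (renc r q)"
| "renc r (All i p) = All i (renc r p)"

primrec vbound :: "fm \<Rightarrow> nat" where
  "vbound (Mem i k) = Suc (max i k)"
| "vbound (Eq i k) = Suc (max i k)"
| "vbound (InCls i k) = Suc i"
| "vbound (Neg p) = vbound p"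
| "vbound (And p q) = max (vbound p) (vbound q)"
| "vbound (All i p) = max (Suc i) (vbound p)"

lemma set_fm_ren [simp]: "set_fm (ren r p) = set_fm p"
  by (induction p) auto

lemma sat_ren: "inj r \<Longrightarrow> sat D E C (ren r p) s = sat D E C p (s \<circ> r)"
proof (induction p arbitrary: s)
  case (All i p)
  have "(s(r i := x)) \<circ> r = (s \<circ> r)(i := x)" for x
    using All.prems by (auto simp: fun_eq_iff inj_eq)
  then show ?case by (simp only: ren.simps sat.simps All.IH[OF All.prems])
qed auto

lemma sat_renc: "sat D E C (renc r p) s = sat D E (C \<circ> r) p s"
  by (induction p arbitrary: s) auto

lemma sat_cong: "(\<And>i. i < vbound p \<Longrightarrow> s i = t i) \<Longrightarrow> sat D E C p s = sat D E C p t"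
proof (induction p arbitrary: s t)
  case (All i p)
  have "sat D E C p (s(i := x)) = sat D E C p (t(i := x))" for x
    using All.prems by (intro All.IH) auto
  then show ?case by simp
next
  case (And p q)
  have "sat D E C p s = sat D E C p t" "sat D E C q s = sat D E C q t"
    using And.prems by (auto intro!: And.IH)
  then show ?case by simp
next
  case (Neg p)
  have "sat D E C p s = sat D E C p t"
    using Neg.prems by (auto intro!: Neg.IH)
  then show ?case by simp
qed auto

text \<open>Translates named variables into shifted assignments: \<open>r\<close> sends variable 0
  to \<open>N\<close> and shifts the others down; variables beyond \<open>N\<close> are kept out of
  the way so that \<open>r\<close> is injective. One \<open>q\<close> serves all \<open>D\<close>,
  hence also relativizations.\<close>

lemma quantifier_formula:
  "\<exists>q. set_fm q = set_fm p \<and> (\<forall>(D :: 'v set) E C s. sat D E C q s \<longleftrightarrow> (\<forall>x\<in>D. sat D E C p (x ## s)))"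
proof -
  define N where "N = vbound p"
  define r where "r = (\<lambda>n. case n of 0 \<Rightarrow> N | Suc i \<Rightarrow> if i < N then i else Suc i)"
  have inj: "inj r"
    by (auto simp: inj_on_def r_def split: nat.splits if_splits)
  have "sat D E C (All N (ren r p)) s \<longleftrightarrow> (\<forall>x\<in>D. sat D E C p (x ## s))"
    for D :: "'v set" and E C s
  proof -
    have "sat D E C (ren r p) (s(N := x)) = sat D E C p (x ## s)" for x
      unfolding sat_ren[OF inj]
      by (rule sat_cong) (auto simp: r_def N_def cons_env_def split: nat.split)
    then show ?thesis by simp
  qed
  then show ?thesis
    by (intro exI[of _ "All N (ren r p)"]) simp
qed

section \<open>Definable predicates and terms\<close>

context NBG_AC
begin

text \<open>A quantifier shifts the assignment, so variables behave like de Bruijn indices. \<open>dft\<close> below is the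
  corresponding notion for terms, and \<open>cf\<close>, \<open>cf2\<close> say that a function is a class function.\<close>

definition dfn :: "((nat \<Rightarrow> 'v) \<Rightarrow> bool) \<Rightarrow> bool" where
  "dfn P \<longleftrightarrow> (\<exists>p C. (\<forall>k. C k \<in> Cls) \<and> (\<forall>s. P s \<longleftrightarrow> sat UNIV E C p s))"

lemma dfnI: "(\<And>k. C k \<in> Cls) \<Longrightarrow> (\<And>s. P s \<longleftrightarrow> sat UNIV E C p s) \<Longrightarrow> dfn P"
  unfolding dfn_def by blast

lemma dfn_class: "dfn P \<Longrightarrow> {x. P (x ## s)} \<in> Cls"
proof -
  assume "dfn P"
  then obtain p C where C: "\<And>k. C k \<in> Cls" and p: "\<And>s. P s \<longleftrightarrow> sat UNIV E C p s"
    unfolding dfn_def by blast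
  have "(undefined ## s)(0 := x) = x ## s" for x
    by (auto simp: cons_env_def fun_eq_iff split: nat.split)
  with comprehension[of C p "undefined ## s"] C p show ?thesis by simp
qed

lemma dfn_Mem: "dfn (\<lambda>s. E (s i) (s k))"
  by (rule dfnI[where p = "Mem i k" and C = "\<lambda>_. {y. E y undefined}"]) (auto simp: set_is_class)

lemma dfn_Eq: "dfn (\<lambda>s. s i = s k)"
  by (rule dfnI[where p = "Eq i k" and C = "\<lambda>_. {y. E y undefined}"]) (auto simp: set_is_class)

lemma dfn_InCls: "X \<in> Cls \<Longrightarrow> dfn (\<lambda>s. s i \<in> X)"
  by (rule dfnI[where p = "InCls i 0" and C = "\<lambda>_. X"]) auto

lemma dfn_not: "dfn P \<Longrightarrow> dfn (\<lambda>s. \<not> P s)"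
  unfolding dfn_def by (metis sat.simps(4))

lemma dfn_conj: assumes "dfn P" "dfn Q" shows "dfn (\<lambda>s. P s \<and> Q s)"
proof -
  obtain p C where C: "\<And>k. C k \<in> Cls" and p: "\<And>s. P s \<longleftrightarrow> sat UNIV E C p s"
    using assms(1) unfolding dfn_def by blast
  obtain q B where B: "\<And>k. B k \<in> Cls" and q: "\<And>s. Q s \<longleftrightarrow> sat UNIV E B q s"
    using assms(2) unfolding dfn_def by blast
  \<comment> \<open>Even class parameters serve \<open>p\<close>, odd ones serve
    \<open>q\<close>.\<close>
  define A where "A n = (if even n then C (n div 2) else B (n div 2))" for n
  have "A \<circ> (\<lambda>n. 2 * n) = C" "A \<circ> (\<lambda>n. 2 * n + 1) = B"
    by (auto simp: A_def fun_eq_iff)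
  then show ?thesis
    using C B p q
    by (intro dfnI[where C = A and p = "And (renc (\<lambda>n. 2 * n) p) (renc (\<lambda>n. 2 * n + 1) q)"])
      (auto simp: sat_renc A_def)
qed

lemma dfn_all: assumes "dfn (\<lambda>t. P (t 0) (\<lambda>n. t (Suc n)))" shows "dfn (\<lambda>s. \<forall>x. P x s)"
proof -
  obtain p C where C: "\<And>k. C k \<in> Cls"
    and p: "\<And>s. P (s 0) (\<lambda>n. s (Suc n)) \<longleftrightarrow> sat UNIV E C p s"
    using assms unfolding dfn_def by blast
  obtain q where q: "\<And>D E C s. sat D E C q s \<longleftrightarrow> (\<forall>x\<in>D. sat D E C p (x ## s :: nat \<Rightarrow> 'v))"
    using quantifier_formula[of p, where 'v = 'v] by blast
  have "P x s \<longleftrightarrow> sat UNIV E C p (x ## s)" for x s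
    using p[of "x ## s"] by simp
  with C q show ?thesis
    by (intro dfnI[where C = C and p = q]) auto
qed

lemma dfn_ren: "inj r \<Longrightarrow> dfn P \<Longrightarrow> dfn (\<lambda>s. P (\<lambda>n. s (r n)))"
proof -
  assume r: "inj r" and "dfn P"
  then obtain p C where C: "\<And>k. C k \<in> Cls" and p: "\<And>s. P s \<longleftrightarrow> sat UNIV E C p s"
    unfolding dfn_def by blast
  show ?thesis
    by (rule dfnI[where p = "ren r p" and C = C]) (auto simp: C p sat_ren[OF r] comp_def)
qed

lemma dfn_True: "dfn (\<lambda>_. True)"
  using dfn_Eq[of 0 0] by simp

lemma dfn_False: "dfn (\<lambda>_. False)"
  using dfn_not[OF dfn_True] by simp

lemma dfn_const: "dfn (\<lambda>_. b)"
  by (cases b) (simp_all add: dfn_True dfn_False)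

lemma dfn_disj: "dfn P \<Longrightarrow> dfn Q \<Longrightarrow> dfn (\<lambda>s. P s \<or> Q s)"
  using dfn_not[OF dfn_conj[OF dfn_not dfn_not], of P Q] by simp

lemma dfn_imp: "dfn P \<Longrightarrow> dfn Q \<Longrightarrow> dfn (\<lambda>s. P s \<longrightarrow> Q s)"
  unfolding imp_conv_disj by (intro dfn_disj dfn_not)

lemma dfn_iff: "dfn P \<Longrightarrow> dfn Q \<Longrightarrow> dfn (\<lambda>s. P s \<longleftrightarrow> Q s)"
  unfolding iff_conv_conj_imp by (intro dfn_conj dfn_imp)

lemma dfn_ex: "dfn (\<lambda>t. P (t 0) (\<lambda>n. t (Suc n))) \<Longrightarrow> dfn (\<lambda>s. \<exists>x. P x s)"
  using dfn_not[OF dfn_all[of "\<lambda>x s. \<not> P x s"], OF dfn_not] by simp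

definition dft :: "((nat \<Rightarrow> 'v) \<Rightarrow> 'v) \<Rightarrow> bool" where
  "dft T \<longleftrightarrow> dfn (\<lambda>s. s 0 = T (\<lambda>n. s (Suc n)))"

lemma dft_var: "dft (\<lambda>s. s n)"
  unfolding dft_def by (rule dfn_Eq)

lemma dft_shift: assumes "dft T" shows "dft (\<lambda>s. T (\<lambda>n. s (Suc n)))"
proof -
  define r where "r n = (case n of 0 \<Rightarrow> 0 | Suc m \<Rightarrow> Suc (Suc m))" for n :: nat
  have "inj r"
    by (auto simp: inj_def r_def split: nat.splits)
  from dfn_ren[OF this assms[unfolded dft_def]] show ?thesis
    unfolding dft_def by (simp add: r_def)
qed

lemma dfn_InCls_term: assumes "X \<in> Cls" "dft T" shows "dfn (\<lambda>s. T s \<in> X)"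
proof -
  have "dfn (\<lambda>s. \<exists>x. x = T s \<and> x \<in> X)"
    using assms by (intro dfn_ex dfn_conj dfn_InCls) (simp_all add: dft_def)
  then show ?thesis by simp
qed

lemma dfn_Mem_term: assumes "dft T" "dft U" shows "dfn (\<lambda>s. E (T s) (U s))"
proof -
  have "dfn (\<lambda>s. \<exists>x. x = T s \<and> (\<exists>y. y = U s \<and> E x y))"
    using assms dft_shift[OF assms(2)]
    by (intro dfn_ex dfn_conj dfn_Mem) (simp_all add: dft_def)
  then show ?thesis by simp
qed

lemma dfn_Eq_term: assumes "dft T" "dft U" shows "dfn (\<lambda>s. T s = U s)"
proof -
  have "dfn (\<lambda>s. \<exists>x. x = T s \<and> x = U s)"
    using assms by (intro dfn_ex dfn_conj) (simp_all add: dft_def)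
  then show ?thesis by simp
qed

text \<open>Induction on \<open>p\<close> lets terms replace variables: under a quantifier the old
  terms are shifted and the bound variable becomes a further term.\<close>

lemma dfn_subst_sat: assumes "\<And>k. C k \<in> Cls"
  shows "(\<And>n. dft (T n)) \<Longrightarrow> dfn (\<lambda>s. sat UNIV E C p (\<lambda>n. T n s))"
proof (induction p arbitrary: T)
  case (All i p)
  have "dfn (\<lambda>s. \<forall>x. sat UNIV E C p (\<lambda>n. if n = i then x else T n s))"
  proof (rule dfn_all)
    have "dft (\<lambda>t. if n = i then t 0 else T n (\<lambda>n. t (Suc n)))" for n
      using All.prems dft_shift by (cases "n = i") (simp_all add: dft_var)
    from All.IH[OF this]
    show "dfn (\<lambda>t. sat UNIV E C p (\<lambda>n. if n = i then t 0 else T n (\<lambda>n. t (Suc n))))" .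
  qed
  moreover have "(\<lambda>n. T n s)(i := x) = (\<lambda>n. if n = i then x else T n s)" for x s
    by auto
  ultimately show ?case by simp
qed (use assms in \<open>auto intro!: dfn_Mem_term dfn_Eq_term dfn_InCls_term dfn_not dfn_conj\<close>)

lemma dfn_subst: "dfn P \<Longrightarrow> (\<And>n. dft (T n)) \<Longrightarrow> dfn (\<lambda>s. P (\<lambda>n. T n s))"
  using dfn_subst_sat[of _ T] unfolding dfn_def[of P] by auto

text \<open>With these rules a relation is shown definable once, in variables, and can then be used
  with arbitrary terms.\<close>

lemma dfn_rel1: assumes "dfn (\<lambda>s. R (s 0))" "dft T" shows "dfn (\<lambda>s. R (T s))"
  using dfn_subst[OF assms(1), of "\<lambda>n. T"] assms(2) by simp

lemma dfn_rel2: assumes "dfn (\<lambda>s. R (s 0) (s 1))" and "dft T" "dft U"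
  shows "dfn (\<lambda>s. R (T s) (U s))"
  using dfn_subst[OF assms(1), of "\<lambda>n. if n = 0 then T else U"] assms(2,3) by simp

lemma dfn_rel3: assumes "dfn (\<lambda>s. R (s 0) (s 1) (s 2))" and "dft T" "dft U" "dft V"
  shows "dfn (\<lambda>s. R (T s) (U s) (V s))"
  using dfn_subst[OF assms(1), of "\<lambda>n. if n = 0 then T else if n = 1 then U else V"] assms(2-4)
  by simp

lemma dfn_rel4: assumes "dfn (\<lambda>s. R (s 0) (s 1) (s 2) (s 3))" and "dft T" "dft U" "dft V" "dft W"
  shows "dfn (\<lambda>s. R (T s) (U s) (V s) (W s))"
  using dfn_subst[OF assms(1), of "\<lambda>n. if n = 0 then T else if n = 1 then U else if n = 2 then V else W"]
    assms(2-5)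
  by simp

lemma set_ext: "(\<And>z. E z x \<longleftrightarrow> E z y) \<Longrightarrow> x = y"
  using extensionality unfolding extensionality_ax_def by auto

text \<open>Every set is a class, so \<open>c\<close> can be named by the class parameter of its
  elements and recovered by extensionality.\<close>

lemma dft_const: "dft (\<lambda>_. c)"
proof -
  have "dfn (\<lambda>s. \<forall>y. E y (s 0) \<longleftrightarrow> y \<in> {y. E y c})"
    by (intro dfn_all dfn_iff dfn_Mem dfn_InCls set_is_class)
  moreover have "(\<forall>y. E y x \<longleftrightarrow> y \<in> {y. E y c}) \<longleftrightarrow> x = c" for x
    using set_ext by auto
  ultimately show ?thesis unfolding dft_def by simp
qed

definition cf :: "('v \<Rightarrow> 'v) \<Rightarrow> bool" where "cf F \<longleftrightarrow> dft (\<lambda>s. F (s 0))"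
definition cf2 :: "('v \<Rightarrow> 'v \<Rightarrow> 'v) \<Rightarrow> bool" where "cf2 F \<longleftrightarrow> dft (\<lambda>s. F (s 0) (s 1))"

lemma cfD: assumes "cf F" "dft T" shows "dft (\<lambda>s. F (T s))"
  using assms dfn_rel2[of "\<lambda>x y. x = F y" "\<lambda>s. s 0" "\<lambda>s. T (\<lambda>n. s (Suc n))"] dft_var dft_shift
  unfolding cf_def dft_def by simp

lemma cf2D: assumes "cf2 F" "dft T" "dft U" shows "dft (\<lambda>s. F (T s) (U s))"
  using assms dfn_rel3[of "\<lambda>x y z. x = F y z" "\<lambda>s. s 0" "\<lambda>s. T (\<lambda>n. s (Suc n))"
      "\<lambda>s. U (\<lambda>n. s (Suc n))"] dft_var dft_shift
  unfolding cf2_def dft_def by (simp add: numeral_2_eq_2)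

section \<open>Sets\<close>

named_theorems dfi

lemmas [dfi] = dfn_Mem_term dfn_Eq_term dfn_InCls_term dfn_not dfn_conj dfn_disj dfn_imp dfn_iff
  dfn_all dfn_ex dfn_const dft_var dft_const

lemma dft_subst: assumes "dft T" "\<And>n. dft (U n)" shows "dft (\<lambda>s. T (\<lambda>n. U n s))"
proof -
  define V where "V n = (case n of 0 \<Rightarrow> (\<lambda>s. s 0) | Suc m \<Rightarrow> (\<lambda>s. U m (\<lambda>n. s (Suc n))))" for n
  have "dft (V n)" for n
    using dft_shift[OF assms(2)] by (cases n) (simp_all add: dft_var V_def)
  from dfn_subst[OF assms(1)[unfolded dft_def], of V, OF this] show ?thesis
    unfolding dft_def by (simp add: V_def)
qed

text \<open>Leaves slot 1 free, as is needed when a further variable is placed between index 0 and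
  the parameters.\<close>

lemma dfn_under: assumes "dfn (\<lambda>t. P (t 0) (\<lambda>n. t (Suc n)))"
  shows "dfn (\<lambda>t. P (t 0) (\<lambda>n. t (Suc (Suc n))))"
proof -
  define V where "V n = (case n of 0 \<Rightarrow> (\<lambda>s. s 0 :: 'v) | Suc m \<Rightarrow> (\<lambda>s. s (Suc (Suc m))))" for n
  have "dft (V n)" for n
    by (cases n) (simp_all add: dft_var V_def)
  from dfn_subst[OF assms, of V, OF this] show ?thesis by (simp add: V_def)
qed

lemma dft_under: assumes "dft (\<lambda>t. F (\<lambda>n. t (Suc n)) (t 0))"
  shows "dft (\<lambda>t. F (\<lambda>n. t (Suc (Suc n))) (t 0))"
proof -
  define V where "V n = (case n of 0 \<Rightarrow> (\<lambda>s. s 0 :: 'v) | Suc m \<Rightarrow> (\<lambda>s. s (Suc (Suc m))))" for n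
  have "dft (V n)" for n
    by (cases n) (simp_all add: dft_var V_def)
  from dft_subst[OF assms, of V, OF this] show ?thesis by (simp add: V_def)
qed

definition small :: "'v set \<Rightarrow> bool" where
  "small X \<longleftrightarrow> (\<exists>b. \<forall>z. E z b \<longleftrightarrow> z \<in> X)"

text \<open>\<open>st X\<close> is empty if \<open>X\<close> is not a set; being total, it preserves definability without side conditions.\<close>

definition st :: "'v set \<Rightarrow> 'v" where
  "st X = (if small X then SOME b. \<forall>z. E z b \<longleftrightarrow> z \<in> X else SOME b. \<forall>z. \<not> E z b)"

lemma infinity_set: "\<exists>a. (\<exists>z. E z a \<and> (\<forall>w. \<not> E w z)) \<and> (\<forall>x. E x a \<longrightarrow> (\<exists>y. E y a \<and> (\<forall>w. E w y \<longleftrightarrow> E w x \<or> w = x)))"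
  using infinity unfolding infinity_ax_def by simp

lemma small_empty: "small {}"
  using infinity_set unfolding small_def by auto

lemma st_mem: "small X \<Longrightarrow> E z (st X) \<longleftrightarrow> z \<in> X"
  unfolding st_def small_def by (simp, rule someI2_ex) auto

lemma st_not_small: "\<not> small X \<Longrightarrow> \<not> E z (st X)"
  using someI_ex[of "\<lambda>b. \<forall>z. \<not> E z b"] small_empty unfolding st_def by (simp add: small_def[of "{}"])

lemma st_eq: "(\<And>z. E z b \<longleftrightarrow> z \<in> X) \<Longrightarrow> st X = b"
  by (rule set_ext) (metis small_def st_mem)

lemma dft_st [dfi]: assumes "dfn (\<lambda>t. P (t 0) (\<lambda>n. t (Suc n)))" shows "dft (\<lambda>s. st {z. P z s})"
proof -
  \<comment> \<open>The two disjuncts describe the value according to whether the extension is a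
    set.\<close>
  have "dfn (\<lambda>s. (\<forall>z. E z (s 0) \<longleftrightarrow> P z (\<lambda>n. s (Suc n))) \<or>
      (\<not> (\<exists>b. \<forall>z. E z b \<longleftrightarrow> P z (\<lambda>n. s (Suc n)))) \<and> (\<forall>z. \<not> E z (s 0)))"
    using dfn_under[OF assms] dfn_under[OF dfn_under[OF assms]] by (intro dfi)
  moreover have "b = st {z. Q z} \<longleftrightarrow> (\<forall>z. E z b \<longleftrightarrow> Q z) \<or>
      (\<not> (\<exists>b. \<forall>z. E z b \<longleftrightarrow> Q z)) \<and> (\<forall>z. \<not> E z b)" for b Q
  proof (cases "small {z. Q z}")
    case True
    then show ?thesis
      using st_mem[OF True] st_eq[of b "{z. Q z}"] unfolding small_def by auto
  next
    case False
    then show ?thesis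
      using st_not_small[OF False] set_ext[of b "st {z. Q z}"] unfolding small_def by auto
  qed
  ultimately show ?thesis unfolding dft_def by simp
qed

lemma dfn_is_upair: "dfn (\<lambda>s. is_upair E (s i) (s k) (s l))"
  unfolding is_upair_def by (intro dfi)

lemma dfn_is_pair: "dfn (\<lambda>s. is_pair E (s i) (s k) (s l))"
  unfolding is_pair_def by (intro dfi dfn_is_upair)

lemma is_pair_inj: "is_pair E p x y \<Longrightarrow> is_pair E p u v \<Longrightarrow> x = u \<and> y = v"
proof -
  assume 1: "is_pair E p x y" and 2: "is_pair E p u v"
  have ex: "\<exists>a. is_upair E a x y" for x y
    using pairing unfolding pairing_ax_def is_upair_def by auto
  obtain a b c d where a: "is_upair E a x x" and b: "is_upair E b x y"
    and c: "is_upair E c u u" and d: "is_upair E d u v"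
    using ex by metis
  have "is_upair E a u u \<or> is_upair E a u v" "is_upair E b u u \<or> is_upair E b u v"
    "is_upair E c x x \<or> is_upair E c x y" "is_upair E d x x \<or> is_upair E d x y"
    using 1 2 a b c d unfolding is_pair_def by metis+
  then show ?thesis using a b c d unfolding is_upair_def by metis
qed

text \<open>The replacement axiom speaks of classes of coded pairs; \<open>F\<close> codes
  \<open>R\<close>, which works because pairs exist and determine their components.\<close>

lemma replacement_rel: assumes R: "dfn (\<lambda>s. R (s 0) (s 1))"
  and fn: "\<And>x y z. R x y \<Longrightarrow> R x z \<Longrightarrow> y = z"
  shows "small {y. \<exists>x. E x a \<and> R x y}"
proof -
  define F where "F = {p. \<exists>x y. is_pair E p x y \<and> R x y}"
  have "dfn (\<lambda>t. \<exists>x y. is_pair E (t 0) x y \<and> R x y)"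
    by (intro dfi dfn_is_pair dfn_rel2[OF R])
  from dfn_class[OF this] have F: "F \<in> Cls"
    unfolding F_def by simp
  have ex: "\<exists>a. \<forall>w. E w a \<longleftrightarrow> w = x \<or> w = y" for x y
    using pairing unfolding pairing_ax_def by auto
  have "\<exists>p. is_pair E p x y" for x y
  proof -
    obtain a b where a: "\<forall>w. E w a \<longleftrightarrow> w = x \<or> w = x" and b: "\<forall>w. E w b \<longleftrightarrow> w = x \<or> w = y"
      using ex[of x x] ex[of x y] by auto
    obtain p where p: "\<forall>w. E w p \<longleftrightarrow> w = a \<or> w = b" using ex by blast
    have "z = a \<longleftrightarrow> is_upair E z x x" "z = b \<longleftrightarrow> is_upair E z x y" for z
      unfolding is_upair_def using a b set_ext[of z a] set_ext[of z b] by auto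
    then show ?thesis unfolding is_pair_def using p by auto
  qed
  then have app: "app_rel E F x y \<longleftrightarrow> R x y" for x y
    unfolding app_rel_def F_def using is_pair_inj by blast
  show ?thesis
    using replacement[OF F, of a] fn unfolding app small_def by auto
qed

text \<open>Separation as replacement along the partial identity on \<open>P\<close>.\<close>

lemma small_subset: assumes "dfn (\<lambda>s. P (s 0))" "\<And>z. P z \<Longrightarrow> E z a" shows "small {z. P z}"
proof -
  have "dfn (\<lambda>s. P (s 0) \<and> s 1 = s 0)"
    by (intro dfi assms(1))
  from replacement_rel[of "\<lambda>x y. P x \<and> y = x", OF this, of a] show ?thesis
    using assms(2) by (auto elim!: back_subst[of small])
qed

lemma small_image: assumes "cf F" shows "small {z. \<exists>x. E x a \<and> z = F x}"
  by (rule replacement_rel) (auto intro!: dfi cfD[OF assms])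

lemma small_union: "small {z. \<exists>y. E y a \<and> E z y}"
  using union unfolding union_ax_def small_def by auto

lemma small_bigun: assumes "cf F" shows "small {z. \<exists>x. E x a \<and> E z (F x)}"
proof -
  have "{z. \<exists>x. E x a \<and> E z (F x)} = {z. \<exists>y. E y (st {z. \<exists>x. E x a \<and> z = F x}) \<and> E z y}"
    using st_mem[OF small_image[OF assms]] by auto
  then show ?thesis using small_union by simp
qed

lemma small_upair: "small {z. z = x \<or> z = y}"
  using pairing unfolding pairing_ax_def small_def by auto

lemma small_Un: assumes "small X" "small Y" shows "small {z. z \<in> X \<or> z \<in> Y}"
proof -
  have "{z. z \<in> X \<or> z \<in> Y} = {z. \<exists>y. E y (st {z. z = st X \<or> z = st Y}) \<and> E z y}"
    using st_mem[OF small_upair] st_mem[OF assms(1)] st_mem[OF assms(2)] by auto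
  then show ?thesis using small_union by simp
qed

lemma small_mem: "small {z. E z a}"
  unfolding small_def by auto

lemma small_pow: "small {z. \<forall>w. E w z \<longrightarrow> E w a}"
  using powerset unfolding powerset_ax_def small_def by auto

section \<open>Set operations as total terms\<close>

definition "emp = st {z. False}"
definition "upair x y = st {z. z = x \<or> z = y}"
definition "pr x y = upair (upair x x) (upair x y)"
definition "un a = st {z. \<exists>y. E y a \<and> E z y}"
definition "cup x y = st {z. E z x \<or> E z y}"
definition "succ x = st {z. E z x \<or> z = x}"
definition "pow a = st {z. \<forall>w. E w z \<longrightarrow> E w a}"
definition "lam a F = st {z. \<exists>x. E x a \<and> z = pr x (F x)}"
text \<open>The union of all values of \<open>g\<close> at \<open>x\<close>: this is the value if
  there is exactly one, and empty if there is none.\<close>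

definition "app g x = st {z. \<exists>y. E (pr x y) g \<and> E z y}"
definition "bigun a F = st {z. \<exists>x. E x a \<and> E z (F x)}"
definition "cart a b = st {z. \<exists>x. E x a \<and> (\<exists>y. E y b \<and> z = pr x y)}"

lemma mem_emp [simp]: "\<not> E z emp"
  unfolding emp_def by (subst st_mem) (simp_all add: small_empty)

lemma mem_upair [simp]: "E z (upair x y) \<longleftrightarrow> z = x \<or> z = y"
  unfolding upair_def by (subst st_mem) (simp_all add: small_upair)

lemma mem_un [simp]: "E z (un a) \<longleftrightarrow> (\<exists>y. E y a \<and> E z y)"
  unfolding un_def by (subst st_mem) (simp_all add: small_union)

lemma mem_cup [simp]: "E z (cup x y) \<longleftrightarrow> E z x \<or> E z y"
  unfolding cup_def using small_Un[OF small_mem small_mem] by (subst st_mem) simp_all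

lemma mem_succ [simp]: "E z (succ x) \<longleftrightarrow> E z x \<or> z = x"
  unfolding succ_def using small_Un[OF small_mem[of x] small_upair[of x x]] by (subst st_mem) simp_all

lemma mem_pow [simp]: "E z (pow a) \<longleftrightarrow> (\<forall>w. E w z \<longrightarrow> E w a)"
  unfolding pow_def by (subst st_mem) (simp_all add: small_pow)

lemma pair_iff: "is_pair E p x y \<longleftrightarrow> p = pr x y"
proof -
  have "is_upair E z x y \<longleftrightarrow> z = upair x y" for z x y
    unfolding is_upair_def using set_ext[of z "upair x y"] by auto
  then show ?thesis unfolding is_pair_def pr_def using set_ext[of p "pr x y"] by (auto simp: pr_def)
qed

lemma pr_inj [simp]: "pr x y = pr u v \<longleftrightarrow> x = u \<and> y = v"
  using is_pair_inj pair_iff by metis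

lemma cf2_upair: "cf2 upair"
  unfolding cf2_def upair_def by (intro dfi)
lemmas dft_upair [dfi] = cf2D[OF cf2_upair]

lemma cf2_pr: "cf2 pr"
  unfolding cf2_def pr_def by (intro dfi)
lemmas dft_pr [dfi] = cf2D[OF cf2_pr]

lemma cf2_cup: "cf2 cup"
  unfolding cf2_def cup_def by (intro dfi)
lemmas dft_cup [dfi] = cf2D[OF cf2_cup]

lemma cf_succ: "cf succ"
  unfolding cf_def succ_def by (intro dfi)
lemmas dft_succ [dfi] = cfD[OF cf_succ]

lemma cf_pow: "cf pow"
  unfolding cf_def pow_def by (intro dfi)
lemmas dft_pow [dfi] = cfD[OF cf_pow]

lemma cf2_app: "cf2 app"
  unfolding cf2_def app_def by (intro dfi)
lemmas dft_app [dfi] = cf2D[OF cf2_app]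

lemma dft_lam [dfi]: assumes T: "dft T" and F: "dft (\<lambda>t. F (\<lambda>n. t (Suc n)) (t 0))"
  shows "dft (\<lambda>s. lam (T s) (F s))"
  unfolding lam_def using dft_shift[OF dft_shift[OF T]] dft_under[OF F] by (intro dfi)

lemma dft_bigun [dfi]: assumes T: "dft T" and F: "dft (\<lambda>t. F (\<lambda>n. t (Suc n)) (t 0))"
  shows "dft (\<lambda>s. bigun (T s) (F s))"
  unfolding bigun_def using dft_shift[OF dft_shift[OF T]] dft_under[OF F] by (intro dfi)

lemma cfI [dfi]: "dft (\<lambda>s. F (s 0)) \<Longrightarrow> cf F"
  by (simp add: cf_def)
lemma cf2I [dfi]: "dft (\<lambda>s. F (s 0) (s 1)) \<Longrightarrow> cf2 F"
  by (simp add: cf2_def)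

lemma mem_bigun [simp]: "cf F \<Longrightarrow> E z (bigun a F) \<longleftrightarrow> (\<exists>x. E x a \<and> E z (F x))"
  unfolding bigun_def by (subst st_mem) (simp_all add: small_bigun)

lemma mem_lam: "cf F \<Longrightarrow> E z (lam a F) \<longleftrightarrow> (\<exists>x. E x a \<and> z = pr x (F x))"
proof -
  assume F: "cf F"
  have "cf (\<lambda>x. pr x (F x))"
    by (intro dfi cfD[OF F])
  from small_image[OF this] show ?thesis
    unfolding lam_def by (subst st_mem) simp_all
qed

lemma pr_lam [simp]: "cf F \<Longrightarrow> E (pr x y) (lam a F) \<longleftrightarrow> E x a \<and> y = F x"
  by (auto simp: mem_lam)

lemma small_cart: "small {z. \<exists>x. E x a \<and> (\<exists>y. E y b \<and> z = pr x y)}"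
proof -
  have 1: "small {z. \<exists>y. E y b \<and> z = pr x y}" for x
    by (intro small_image dfi)
  have "cf (\<lambda>x. st {z. \<exists>y. E y b \<and> z = pr x y})"
    by (intro dfi)
  from small_bigun[OF this, of a] show ?thesis
    using st_mem[OF 1] by simp
qed

lemma mem_cart [simp]: "E (pr x y) (cart a b) \<longleftrightarrow> E x a \<and> E y b"
  unfolding cart_def by (subst st_mem[OF small_cart]) auto

lemma mem_cartE: "E z (cart a b) \<Longrightarrow> \<exists>x y. E x a \<and> E y b \<and> z = pr x y"
  unfolding cart_def by (subst (asm) st_mem[OF small_cart]) auto

lemma app_eq: "E (pr x y) g \<Longrightarrow> (\<And>z. E (pr x z) g \<Longrightarrow> z = y) \<Longrightarrow> app g x = y"
  unfolding app_def by (rule st_eq) blast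

lemma app_lam [simp]: "cf F \<Longrightarrow> E x a \<Longrightarrow> app (lam a F) x = F x"
  by (rule app_eq) auto

lemma lam_cong: assumes "\<And>x. E x a \<Longrightarrow> F x = G x" shows "lam a F = lam a G"
  unfolding lam_def using assms by (intro arg_cong[of _ _ st]) auto

lemma bigun_cong: assumes "\<And>x. E x a \<Longrightarrow> F x = G x" shows "bigun a F = bigun a G"
  unfolding bigun_def using assms by (intro arg_cong[of _ _ st]) auto

lemma mem_sep: "dfn (\<lambda>s. P (s 0)) \<Longrightarrow> E z (st {z. E z a \<and> P z}) \<longleftrightarrow> E z a \<and> P z"
proof -
  assume "dfn (\<lambda>s. P (s 0))"
  then have "dfn (\<lambda>s. E (s 0) a \<and> P (s 0))" by (intro dfi)
  from small_subset[OF this, of a] show ?thesis by (subst st_mem) auto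
qed

section \<open>Induction along membership and choice of functions\<close>

lemma mem_induct [consumes 1]: assumes P: "dfn (\<lambda>s. P (s 0))"
  and step: "\<And>x. (\<And>y. E y x \<Longrightarrow> P y) \<Longrightarrow> P x" shows "P x"
proof (rule ccontr)
  assume "\<not> P x"
  have "{x. \<not> P x} \<in> Cls"
    using dfn_class[OF dfn_not[OF P]] by simp
  from foundation[OF this] \<open>\<not> P x\<close> step show False by blast
qed

lemma mem_irrefl [simp]: "\<not> E x x"
  by (rule mem_induct[of "\<lambda>x. \<not> E x x"]) (intro dfi, blast)

lemma mem_asym: "E x y \<Longrightarrow> \<not> E y x"
proof -
  have "\<forall>y. E x y \<longrightarrow> \<not> E y x"
    by (rule mem_induct[of "\<lambda>x. \<forall>y. E x y \<longrightarrow> \<not> E y x"]) (intro dfi, blast)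
  then show "E x y \<Longrightarrow> \<not> E y x" by blast
qed

text \<open>Choice is available for sets only, hence the bound \<open>b\<close>. Tagging the
  possible values at \<open>x\<close> by \<open>x\<close> itself makes the sets \<open>B x\<close>
  pairwise disjoint, so that a transversal \<open>c\<close> is a choice function.\<close>

theorem bounded_choice: assumes R: "dfn (\<lambda>s. R (s 0) (s 1))"
  and ex: "\<And>x. E x a \<Longrightarrow> \<exists>y. E y b \<and> R x y"
  obtains F where "cf F" "\<And>x. E x a \<Longrightarrow> E (F x) b" "\<And>x. E x a \<Longrightarrow> R x (F x)"
proof -
  define B where "B x = st {p. \<exists>y. E y b \<and> p = pr x y \<and> R x y}" for x
  have B: "E p (B x) \<longleftrightarrow> (\<exists>y. E y b \<and> p = pr x y \<and> R x y)" for p x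
  proof -
    have "small {p. \<exists>y. E y b \<and> p = pr x y \<and> R x y}"
    proof (rule small_subset)
      show "dfn (\<lambda>s. \<exists>y. E y b \<and> s 0 = pr x y \<and> R x y)"
        by (intro dfi dfn_rel2[OF R])
      show "\<exists>y. E y b \<and> z = pr x y \<and> R x y \<Longrightarrow> E z (cart (upair x x) b)" for z
        by auto
    qed
    then show ?thesis unfolding B_def by (subst st_mem) auto
  qed
  have cB: "cf B"
    unfolding B_def by (intro dfi dfn_rel2[OF R])
  define A where "A = st {z. \<exists>x. E x a \<and> z = B x}"
  have A: "E z A \<longleftrightarrow> (\<exists>x. E x a \<and> z = B x)" for z
    unfolding A_def by (subst st_mem[OF small_image[OF cB]]) simp
  have 1: "\<And>x. E x A \<Longrightarrow> \<exists>y. E y x"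
    using ex unfolding A by (auto simp: B)
  have 2: "\<And>x y. E x A \<Longrightarrow> E y A \<Longrightarrow> x \<noteq> y \<Longrightarrow> \<not> (\<exists>z. E z x \<and> E z y)"
    unfolding A by (auto simp: B)
  have "\<exists>c. \<forall>x. E x A \<longrightarrow> (\<exists>!y. E y x \<and> E y c)"
  proof -
    have "\<forall>a. (\<forall>x. E x a \<longrightarrow> (\<exists>y. E y x)) \<and>
        (\<forall>x y. E x a \<and> E y a \<and> x \<noteq> y \<longrightarrow> \<not> (\<exists>z. E z x \<and> E z y)) \<longrightarrow>
        (\<exists>c. \<forall>x. E x a \<longrightarrow> (\<exists>!y. E y x \<and> E y c))"
      using choice unfolding choice_ax_def by (simp only: UNIV_I simp_thms ball_UNIV bex_UNIV)
    from spec[OF this, of A] show ?thesis using 1 2 by blast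
  qed
  then obtain c where c: "\<And>x. E x A \<Longrightarrow> \<exists>!y. E y x \<and> E y c"
    by blast
  define F where "F x = st {z. \<exists>y. E (pr x y) c \<and> E (pr x y) (B x) \<and> E z y}" for x
  have "cf F"
    unfolding F_def by (intro dfi cfD[OF cB])
  moreover have "E (F x) b \<and> R x (F x)" if x: "E x a" for x
  proof -
    obtain p where p: "E p (B x)" "E p c" and u: "\<And>q. E q (B x) \<Longrightarrow> E q c \<Longrightarrow> q = p"
      using c[of "B x"] x unfolding A by blast
    from p(1) obtain y where y: "E y b" "p = pr x y" "R x y"
      unfolding B by blast
    have "y' = y" if "E (pr x y') c" "E (pr x y') (B x)" for y'
      using u[OF that(2,1)] y(2) by simp
    then have "F x = y"
      unfolding F_def using p y(2) by (intro st_eq) blast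
    then show ?thesis using y by simp
  qed
  ultimately show thesis using that by blast
qed

lemma cf_class_function: assumes "class_function E Cls j" shows "cf j"
proof -
  have "{p. \<exists>x. p = pr x (j x)} \<in> Cls"
    using assms unfolding class_function_def pair_iff .
  then have "dfn (\<lambda>s. pr (s 1) (s 0) \<in> {p. \<exists>x. p = pr x (j x)})"
    by (intro dfi)
  then show ?thesis unfolding cf_def dft_def by simp
qed

section \<open>Ordinals\<close>

definition "trn x \<longleftrightarrow> (\<forall>y. E y x \<longrightarrow> (\<forall>z. E z y \<longrightarrow> E z x))"
text \<open>By foundation, hereditary transitivity characterizes the ordinals; it is a bounded
  formula and hence absolute for transitive classes.\<close>

definition "Ord x \<longleftrightarrow> trn x \<and> (\<forall>y. E y x \<longrightarrow> trn y)"
definition "Lim x \<longleftrightarrow> Ord x \<and> (\<exists>y. E y x) \<and> (\<forall>y. E y x \<longrightarrow> E (succ y) x)"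

lemma dfn_trn [dfi]: "dft T \<Longrightarrow> dfn (\<lambda>s. trn (T s))"
  by (rule dfn_rel1[of trn]) (unfold trn_def, intro dfi)

lemma dfn_Ord [dfi]: "dft T \<Longrightarrow> dfn (\<lambda>s. Ord (T s))"
  by (rule dfn_rel1[of Ord]) (unfold Ord_def, intro dfi)

lemma dfn_Lim [dfi]: "dft T \<Longrightarrow> dfn (\<lambda>s. Lim (T s))"
  by (rule dfn_rel1[of Lim]) (unfold Lim_def, intro dfi)

lemma ordinal_Ord: "ordinal E a \<Longrightarrow> Ord a"
proof -
  assume a: "ordinal E a"
  note a' = a[unfolded ordinal_def]
  have 1: "E y a" if "E x a" "E y x" for x y
    using conjunct1[OF a'] that by blast
  have 2: "E x z" if "E x y" "E y z" "E z a" for x y z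
    using conjunct1[OF conjunct2[OF conjunct2[OF a']]] that 1 by blast
  show ?thesis
    unfolding Ord_def trn_def
    by (intro conjI allI impI) (erule 1 2; assumption)+
qed

lemma Ord_trans: "E x y \<Longrightarrow> E y z \<Longrightarrow> Ord z \<Longrightarrow> E x z"
  unfolding Ord_def trn_def by blast

lemma Ord_mem: "E y x \<Longrightarrow> Ord x \<Longrightarrow> Ord y"
  unfolding Ord_def trn_def by blast

lemma OrdI: "(\<And>y z. E y x \<Longrightarrow> E z y \<Longrightarrow> E z x) \<Longrightarrow> (\<And>y. E y x \<Longrightarrow> Ord y) \<Longrightarrow> Ord x"
  unfolding Ord_def trn_def by blast

lemma Ord_linear: "Ord x \<Longrightarrow> Ord y \<Longrightarrow> E x y \<or> x = y \<or> E y x"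
proof -
  have "\<forall>y. Ord x \<longrightarrow> Ord y \<longrightarrow> E x y \<or> x = y \<or> E y x" for x
  proof (rule mem_induct[of "\<lambda>x. \<forall>y. Ord x \<longrightarrow> Ord y \<longrightarrow> E x y \<or> x = y \<or> E y x"])
    show "dfn (\<lambda>s. \<forall>y. Ord (s 0) \<longrightarrow> Ord y \<longrightarrow> E (s 0) y \<or> s 0 = y \<or> E y (s 0))"
      by (intro dfi)
    fix x assume IH: "\<And>u. E u x \<Longrightarrow> \<forall>y. Ord u \<longrightarrow> Ord y \<longrightarrow> E u y \<or> u = y \<or> E y u"
    show "\<forall>y. Ord x \<longrightarrow> Ord y \<longrightarrow> E x y \<or> x = y \<or> E y x"
    proof
      fix y
      show "Ord x \<longrightarrow> Ord y \<longrightarrow> E x y \<or> x = y \<or> E y x"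
      proof (rule mem_induct[of "\<lambda>y. Ord x \<longrightarrow> Ord y \<longrightarrow> E x y \<or> x = y \<or> E y x"])
        show "dfn (\<lambda>s. Ord x \<longrightarrow> Ord (s 0) \<longrightarrow> E x (s 0) \<or> x = s 0 \<or> E (s 0) x)"
          by (intro dfi)
        fix y assume IH2: "\<And>v. E v y \<Longrightarrow> Ord x \<longrightarrow> Ord v \<longrightarrow> E x v \<or> x = v \<or> E v x"
        show "Ord x \<longrightarrow> Ord y \<longrightarrow> E x y \<or> x = y \<or> E y x"
        proof (intro impI)
          assume x: "Ord x" and y: "Ord y"
          show "E x y \<or> x = y \<or> E y x"
          proof (rule ccontr)
            assume n: "\<not> ?thesis"
            have "E z x \<longleftrightarrow> E z y" for z
            proof
              assume z: "E z x"
              with IH[OF z] Ord_mem[OF z x] y have "E z y \<or> z = y \<or> E y z" by blast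
              then show "E z y" using n z Ord_trans[OF _ z x] by blast
            next
              assume z: "E z y"
              with IH2[OF z] Ord_mem[OF z y] x have "E x z \<or> x = z \<or> E z x" by blast
              then show "E z x" using n z Ord_trans[OF _ z y] by blast
            qed
            then have "x = y" by (rule set_ext)
            with n show False by blast
          qed
        qed
      qed
    qed
  qed
  then show "Ord x \<Longrightarrow> Ord y \<Longrightarrow> E x y \<or> x = y \<or> E y x" by blast
qed

text \<open>For ordinals, \<open>E y (succ x)\<close> plays the part of y \<le> x
  throughout.\<close>

lemma Ord_not_mem: "Ord x \<Longrightarrow> Ord y \<Longrightarrow> \<not> E x y \<longleftrightarrow> E y (succ x)"
  using Ord_linear[of x y] mem_asym[of x y] by auto

lemma Ord_leI: "Ord x \<Longrightarrow> Ord y \<Longrightarrow> (\<And>z. E z x \<Longrightarrow> E z y) \<Longrightarrow> E x (succ y)"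
  using Ord_linear[of x y] by fastforce

lemma Ord_leD: "E x (succ y) \<Longrightarrow> Ord y \<Longrightarrow> E z x \<Longrightarrow> E z y"
  using Ord_trans by auto

lemma Ord_le_trans: "E x (succ y) \<Longrightarrow> E y z \<Longrightarrow> Ord z \<Longrightarrow> E x z"
  using Ord_trans by auto

lemma Ord_emp [simp]: "Ord emp"
  by (rule OrdI) simp_all

lemma Ord_succ [simp]: "Ord (succ x) \<longleftrightarrow> Ord x"
proof
  show "Ord (succ x) \<Longrightarrow> Ord x" by (rule Ord_mem[of x "succ x"]) simp_all
  show "Ord x \<Longrightarrow> Ord (succ x)" by (rule OrdI) (auto intro: Ord_mem Ord_trans)
qed

lemma succ_mem_succ: "Ord y \<Longrightarrow> E x y \<Longrightarrow> E (succ x) (succ y)"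
proof (rule Ord_leI)
  assume y: "Ord y" and x: "E x y"
  show "Ord (succ x)" "Ord y" using x y Ord_mem by auto
  show "E z y" if "E z (succ x)" for z
    using that x y Ord_trans by auto
qed

lemma Ord_un: "(\<And>x. E x a \<Longrightarrow> Ord x) \<Longrightarrow> Ord (un a)"
  by (rule OrdI) (simp_all, meson Ord_trans, meson Ord_mem)

lemma Ord_bigun: "cf F \<Longrightarrow> (\<And>x. E x a \<Longrightarrow> Ord (F x)) \<Longrightarrow> Ord (bigun a F)"
  by (rule OrdI) (simp_all, meson Ord_trans, meson Ord_mem)

lemma cup_cases: assumes "Ord x" "Ord y" shows "cup x y = x \<or> cup x y = y"
proof -
  have "cup x y = x" if "E y x"
    by (rule set_ext) (use that assms Ord_trans in auto)
  moreover have "cup x y = y" if "E x y"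
    by (rule set_ext) (use that assms Ord_trans in auto)
  moreover have "cup x x = x"
    by (rule set_ext) auto
  ultimately show ?thesis using Ord_linear[OF assms] by auto
qed

lemma Ord_cup: "Ord x \<Longrightarrow> Ord y \<Longrightarrow> Ord (cup x y)"
  using cup_cases by metis

lemma cup_mem: "E x z \<Longrightarrow> E y z \<Longrightarrow> Ord z \<Longrightarrow> E (cup x y) z"
  using cup_cases[of x y] Ord_mem by metis

lemma le_cup: "Ord x \<Longrightarrow> Ord y \<Longrightarrow> E x (succ (cup x y))" "Ord x \<Longrightarrow> Ord y \<Longrightarrow> E y (succ (cup x y))"
  by (rule Ord_leI; simp add: Ord_cup)+

lemma LimD: assumes "Lim x" shows "Ord x" "E emp x" "E y x \<Longrightarrow> E (succ y) x"
proof -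
  show 1: "Ord x" "E y x \<Longrightarrow> E (succ y) x"
    using assms unfolding Lim_def by auto
  obtain y where y: "E y x" using assms unfolding Lim_def by auto
  then have "E emp (succ y)"
    using Ord_mem[OF y 1(1)] by (intro Ord_leI) simp_all
  then show "E emp x" using y 1(1) by (rule Ord_le_trans)
qed

lemma Ord_cases: assumes "Ord x"
  obtains "x = emp" | y where "Ord y" "x = succ y" | "Lim x"
proof -
  have "\<exists>y. Ord y \<and> x = succ y" if "x \<noteq> emp" "\<not> Lim x"
  proof -
    have "\<exists>y. E y x"
      using that(1) set_ext[of x emp] by auto
    with that(2) assms obtain y where y: "E y x" "\<not> E (succ y) x"
      unfolding Lim_def by blast
    have "E (succ y) (succ x)" by (rule succ_mem_succ[OF assms y(1)])
    with y have "x = succ y" by (simp only: mem_succ[of _ x]) simp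
    then show ?thesis using Ord_mem[OF y(1) assms] by blast
  qed
  with that show thesis by blast
qed

lemma Ord_least: assumes P: "dfn (\<lambda>s. P (s 0))" and a: "Ord a" "P a"
  shows "\<exists>x. Ord x \<and> P x \<and> (\<forall>y. E y x \<longrightarrow> \<not> P y)"
proof -
  have "dfn (\<lambda>s. Ord (s 0) \<and> P (s 0))"
    by (intro dfi P)
  from dfn_class[OF this] have "{x. Ord x \<and> P x} \<in> Cls" by simp
  from foundation[OF this] a obtain x where x: "Ord x" "P x" "\<And>y. Ord y \<Longrightarrow> P y \<Longrightarrow> \<not> E y x" by auto
  then show ?thesis using Ord_mem by blast
qed

lemma Ord_induct [consumes 2]: assumes P: "dfn (\<lambda>s. P (s 0))" and a: "Ord a"
  and step: "\<And>x. Ord x \<Longrightarrow> (\<And>y. E y x \<Longrightarrow> P y) \<Longrightarrow> P x" shows "P a"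
  using Ord_least[OF dfn_not[OF P] a] step by blast

text \<open>Least witnesses replace choice wherever the values are ordinals. The union over the only
  candidate keeps \<open>lst\<close> a total definable term.\<close>

definition "lst P = st {z. \<exists>x. (Ord x \<and> P x \<and> (\<forall>y. E y x \<longrightarrow> \<not> P y)) \<and> E z x}"

lemma lst_eq: assumes "Ord x" "P x" "\<And>y. E y x \<Longrightarrow> \<not> P y" shows "lst P = x"
proof -
  have "y = x" if "Ord y" "P y" "\<And>z. E z y \<Longrightarrow> \<not> P z" for y
    using Ord_linear[OF that(1) assms(1)] that assms by blast
  then show ?thesis unfolding lst_def using assms by (intro st_eq) blast
qed

lemma lst: assumes "dfn (\<lambda>s. P (s 0))" "Ord a" "P a"
  shows "Ord (lst P)" "P (lst P)" "E y (lst P) \<Longrightarrow> \<not> P y" "E (lst P) (succ a)"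
proof -
  obtain x where x: "Ord x" "P x" "\<And>y. E y x \<Longrightarrow> \<not> P y"
    using Ord_least[where P = P, OF assms] by blast
  then have "lst P = x" by (rule lst_eq)
  with x show "Ord (lst P)" "P (lst P)" "E y (lst P) \<Longrightarrow> \<not> P y" by auto
  show "E (lst P) (succ a)"
    using x assms(2,3) Ord_not_mem[of a x] unfolding \<open>lst P = x\<close> by blast
qed

lemma dft_lst [dfi]: assumes "dfn (\<lambda>t. P (t 0) (\<lambda>n. t (Suc n)))" shows "dft (\<lambda>s. lst (\<lambda>x. P x s))"
  unfolding lst_def using dfn_under[OF dfn_under[OF assms]] dfn_under[OF assms] by (intro dfi)

section \<open>Recursion\<close>

text \<open>The approximations of the recursion theorem. The clause \<open>g = lam x (app g)\<close>
  forces \<open>g\<close> to be a function with domain \<open>x\<close>, so that there is at most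
  one attempt at each ordinal \<open>x\<close>.\<close>

definition "att Phi x g \<longleftrightarrow> g = lam x (app g) \<and> (\<forall>y. E y x \<longrightarrow> app g y = Phi y (lam y (app g)))"
definition "rec Phi x = st {z. \<exists>g. att Phi x g \<and> E z (Phi x g)}"

lemma dfn_att: assumes "cf2 Phi" shows "dft T \<Longrightarrow> dft U \<Longrightarrow> dfn (\<lambda>s. att Phi (T s) (U s))"
  by (rule dfn_rel2[of "att Phi"]) (unfold att_def, intro dfi cf2D[OF assms])

lemma cf_rec: assumes "cf2 Phi" shows "cf (rec Phi)"
  unfolding rec_def by (intro dfi dfn_att[OF assms] cf2D[OF assms])

lemma att_unique: assumes Phi: "cf2 Phi" and g: "att Phi x g" "Ord x" and h: "att Phi u h" "Ord u"
  shows "E y x \<Longrightarrow> E y u \<Longrightarrow> app g y = app h y"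
proof -
  have "E y x \<longrightarrow> E y u \<longrightarrow> app g y = app h y"
  proof (rule mem_induct[of "\<lambda>y. E y x \<longrightarrow> E y u \<longrightarrow> app g y = app h y"])
    show "dfn (\<lambda>s. E (s 0) x \<longrightarrow> E (s 0) u \<longrightarrow> app g (s 0) = app h (s 0))"
      by (intro dfi)
    fix y assume IH: "\<And>z. E z y \<Longrightarrow> E z x \<longrightarrow> E z u \<longrightarrow> app g z = app h z"
    show "E y x \<longrightarrow> E y u \<longrightarrow> app g y = app h y"
    proof (intro impI)
      assume y: "E y x" "E y u"
      have "lam y (app g) = lam y (app h)"
        using IH y Ord_trans g(2) h(2) by (intro lam_cong) blast
      then show "app g y = app h y"
        using y g(1) h(1) unfolding att_def by simp
    qed
  qed
  then show "E y x \<Longrightarrow> E y u \<Longrightarrow> app g y = app h y" by blast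
qed

lemma cf_app: "cf (app g)"
  by (intro dfi)

lemma att_rec: assumes Phi: "cf2 Phi" and g: "att Phi x g" and x: "Ord x"
  shows "g = lam x (rec Phi)" "rec Phi x = Phi x (lam x (rec Phi))"
proof -
  have rec: "rec Phi x = Phi x g" if g: "att Phi x g" and x: "Ord x" for x g
  proof -
    have "h = g" if "att Phi x h" for h
      using lam_cong[of x "app h" "app g", OF att_unique[OF Phi that x g x]] that g
      unfolding att_def by simp
    then show ?thesis unfolding rec_def using g by (intro st_eq) blast
  qed
  have "app g y = rec Phi y" if y: "E y x" for y
  proof -
    have "app (lam y (app g)) z = app g z" if "E z y" for z
      using that by (simp add: cf_app)
    then have "att Phi y (lam y (app g))"
      unfolding att_def
      using g y Ord_trans[OF _ y x] by (auto simp: att_def intro!: lam_cong arg_cong2[of _ _ _ _ Phi] dest: Ord_trans[OF _ _ Ord_mem[OF y x]])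
    from rec[OF this Ord_mem[OF y x]] show ?thesis
      using g y unfolding att_def by simp
  qed
  from lam_cong[of x "app g" "rec Phi", OF this] show 1: "g = lam x (rec Phi)"
    using g unfolding att_def by simp
  show "rec Phi x = Phi x (lam x (rec Phi))"
    using rec[OF g x] unfolding 1[symmetric] .
qed

lemma rec_eq: assumes Phi: "cf2 Phi" and x: "Ord x"
  shows "rec Phi x = Phi x (lam x (rec Phi))"
proof -
  have "\<exists>g. att Phi x g"
  proof (rule Ord_induct[of "\<lambda>x. \<exists>g. att Phi x g", OF _ x])
    show "dfn (\<lambda>s. \<exists>g. att Phi (s 0) g)"
      by (intro dfi dfn_att[OF Phi])
    fix x assume x: "Ord x" and IH: "\<And>y. E y x \<Longrightarrow> \<exists>g. att Phi y g"
    have "att Phi x (lam x (rec Phi))"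
      unfolding att_def
    proof (intro conjI allI impI)
      show "lam x (rec Phi) = lam x (app (lam x (rec Phi)))"
        by (rule lam_cong) (simp add: cf_rec Phi)
      fix y assume y: "E y x"
      have "lam y (app (lam x (rec Phi))) = lam y (rec Phi)"
        using Ord_trans[OF _ y x] by (intro lam_cong) (simp add: cf_rec Phi)
      then show "app (lam x (rec Phi)) y = Phi y (lam y (app (lam x (rec Phi))))"
        using IH[OF y] att_rec(2)[OF Phi _ Ord_mem[OF y x]] y by (auto simp: cf_rec Phi)
    qed
    then show "\<exists>g. att Phi x g" by blast
  qed
  then show ?thesis using att_rec(2)[OF Phi _ x] by blast
qed

section \<open>The first limit ordinal\<close>

text \<open>An inductive set may contain sets that are not ordinals; the union of its ordinals is
  closed under successor.\<close>

lemma ex_Lim: "\<exists>x. Lim x"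
proof -
  obtain a where a: "\<exists>z. E z a \<and> (\<forall>w. \<not> E w z)"
    "\<And>x. E x a \<Longrightarrow> \<exists>y. E y a \<and> (\<forall>w. E w y \<longleftrightarrow> E w x \<or> w = x)"
    using infinity_set by blast
  have emp: "E emp a"
  proof -
    obtain z where "E z a" "\<forall>w. \<not> E w z" using a(1) by blast
    moreover from this have "z = emp" by (intro set_ext) simp
    ultimately show ?thesis by simp
  qed
  have succ: "E (succ x) a" if x: "E x a" for x
  proof -
    obtain y where "E y a" "\<forall>w. E w y \<longleftrightarrow> E w x \<or> w = x" using a(2)[OF x] by blast
    moreover from this have "y = succ x" by (intro set_ext) simp
    ultimately show ?thesis by simp
  qed
  define b where "b = st {x. E x a \<and> Ord x}"
  have b: "E x b \<longleftrightarrow> E x a \<and> Ord x" for x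
    unfolding b_def by (rule mem_sep) (intro dfi)
  have "Lim (un b)"
    unfolding Lim_def
  proof (intro conjI allI impI)
    show "Ord (un b)" by (rule Ord_un) (simp add: b)
    have "E (succ emp) b" using emp succ by (simp add: b)
    then have "E emp (un b)" by (auto intro!: exI[of _ "succ emp"])
    then show "\<exists>y. E y (un b)" by blast
    fix y assume "E y (un b)"
    then obtain x where x: "E y x" "E x b" by auto
    then have "E (succ y) (succ x)" by (intro succ_mem_succ) (simp_all add: b)
    moreover have "E (succ x) b" using x(2) succ by (simp add: b)
    ultimately show "E (succ y) (un b)" unfolding mem_un by blast
  qed
  then show ?thesis by blast
qed

definition "om = lst Lim"

lemma Lim_om: "Lim om" and om_least: "E y om \<Longrightarrow> \<not> Lim y"
proof -
  obtain x where x: "Lim x" using ex_Lim by blast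
  have "dfn (\<lambda>s. Lim (s 0))" by (intro dfi)
  from lst[of Lim, OF this LimD(1)[OF x] x] show "Lim om" "E y om \<Longrightarrow> \<not> Lim y"
    unfolding om_def by auto
qed

lemma om_induct: assumes P: "dfn (\<lambda>s. P (s 0))" and n: "E n om"
  and "P emp" and succ: "\<And>n. E n om \<Longrightarrow> P n \<Longrightarrow> P (succ n)" shows "P n"
proof -
  have "E n om \<longrightarrow> P n"
  proof (rule Ord_induct[of "\<lambda>n. E n om \<longrightarrow> P n"])
    show "dfn (\<lambda>s. E (s 0) om \<longrightarrow> P (s 0))" by (intro dfi P)
    show "Ord n" using n Lim_om LimD(1) Ord_mem by blast
    fix x assume x: "Ord x" and IH: "\<And>y. E y x \<Longrightarrow> E y om \<longrightarrow> P y"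
    show "E x om \<longrightarrow> P x"
    proof
      assume "E x om"
      with x show "P x"
      proof (cases rule: Ord_cases)
        case (2 y)
        then have y: "E y x" by simp
        then have "E y om" using \<open>E x om\<close> Lim_om LimD(1) Ord_trans by blast
        then show ?thesis using succ IH[OF y] 2 by blast
      qed (use assms om_least in auto)
    qed
  qed
  with n show ?thesis by blast
qed

section \<open>Ordinals that are images of a given set\<close>

text \<open>\<open>g\<close> may be partial on \<open>G\<close>, and pairs with second component
  outside \<open>b\<close> are disregarded. Thus one \<open>g\<close> serves all smaller ordinals,
  and the empty ordinal is an image of every set.\<close>

definition "img g G b \<longleftrightarrow> (\<forall>y. E y b \<longrightarrow> (\<exists>x. E x G \<and> E (pr x y) g)) \<and>
  (\<forall>x. E x G \<longrightarrow> (\<forall>y. E y b \<longrightarrow> (\<forall>z. E z b \<longrightarrow> E (pr x y) g \<longrightarrow> E (pr x z) g \<longrightarrow> y = z)))"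
definition "onto G b \<longleftrightarrow> (\<exists>g. img g G b)"
text \<open>With choice, \<open>H G\<close> is the successor cardinal of \<open>G\<close>.\<close>

definition "H G = st {b. Ord b \<and> onto G b}"

lemma dfn_img [dfi]: "dft T \<Longrightarrow> dft U \<Longrightarrow> dft W \<Longrightarrow> dfn (\<lambda>s. img (T s) (U s) (W s))"
  by (rule dfn_rel3[of img]) (unfold img_def, intro dfi)

lemma dfn_onto [dfi]: "dft T \<Longrightarrow> dft U \<Longrightarrow> dfn (\<lambda>s. onto (T s) (U s))"
  by (rule dfn_rel2[of onto]) (unfold onto_def, intro dfi)

lemma cf_H: "cf H"
  unfolding H_def by (intro dfi)
lemmas dft_H [dfi] = cfD[OF cf_H]

lemma img_restrict: assumes R: "dfn (\<lambda>s. R (s 0) (s 1))"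
  and ex: "\<And>y. E y b \<Longrightarrow> \<exists>x. E x G \<and> R x y"
  and fn: "\<And>x y z. E x G \<Longrightarrow> E y b \<Longrightarrow> E z b \<Longrightarrow> R x y \<Longrightarrow> R x z \<Longrightarrow> y = z"
  shows "\<exists>g. E g (pow (cart G b)) \<and> img g G b"
proof -
  define g where "g = st {p. E p (cart G b) \<and> (\<exists>x y. p = pr x y \<and> R x y)}"
  have "dfn (\<lambda>s. \<exists>x y. s 0 = pr x y \<and> R x y)"
    by (intro dfi dfn_rel2[OF R])
  then have g: "E p g \<longleftrightarrow> E p (cart G b) \<and> (\<exists>x y. p = pr x y \<and> R x y)" for p
    unfolding g_def by (rule mem_sep)
  have "E g (pow (cart G b))" by (simp add: g)
  moreover have "img g G b"
    unfolding img_def g using ex fn by simp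
  ultimately show ?thesis by blast
qed

lemma ontoI: assumes R: "dfn (\<lambda>s. R (s 0) (s 1))"
  and ex: "\<And>y. E y b \<Longrightarrow> \<exists>x. E x G \<and> R x y"
  and fn: "\<And>x y z. E x G \<Longrightarrow> E y b \<Longrightarrow> E z b \<Longrightarrow> R x y \<Longrightarrow> R x z \<Longrightarrow> y = z"
  shows "onto G b"
proof -
  have "\<exists>g. E g (pow (cart G b)) \<and> img g G b"
    by (rule img_restrict[of R]) (use assms in blast)+
  then show ?thesis unfolding onto_def by blast
qed

lemma onto_cartI: "onto G b \<Longrightarrow> \<exists>g. E g (pow (cart G b)) \<and> img g G b"
proof -
  assume "onto G b"
  then obtain g where g: "img g G b" unfolding onto_def by blast
  show ?thesis
    by (rule img_restrict[of "\<lambda>x y. E (pr x y) g"]) (intro dfi, use g in \<open>unfold img_def, blast+\<close>)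
qed

lemma onto_mono: assumes "onto G b" "\<And>x. E x G \<Longrightarrow> E x G'" shows "onto G' b"
proof -
  obtain g where g: "img g G b" using assms(1) unfolding onto_def by blast
  show ?thesis
  proof (rule ontoI[of "\<lambda>x y. E x G \<and> E (pr x y) g"])
    show "dfn (\<lambda>s. E (s 0) G \<and> E (pr (s 0) (s 1)) g)" by (intro dfi)
  qed (use g assms(2) in \<open>unfold img_def, blast+\<close>)
qed

lemma onto_subset: "(\<And>y. E y b \<Longrightarrow> E y G) \<Longrightarrow> onto G b"
  by (rule ontoI[of "\<lambda>x y. x = y"]) (intro dfi, auto)

text \<open>An image of \<open>G\<close> is determined by the prewellordering that it induces on a part of \<open>G\<close>;
  this makes \<open>H G\<close> a set by replacement.\<close>

definition "prewo G g b R \<longleftrightarrow> (\<forall>u v. E (pr u v) R \<longleftrightarrow> E u G \<and> E v G \<and>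
  (\<exists>y z. E y b \<and> E z b \<and> E (pr u y) g \<and> E (pr v z) g \<and> E y (succ z)))"

lemma dfn_prewo [dfi]: "dft T \<Longrightarrow> dft U \<Longrightarrow> dft W \<Longrightarrow> dft X \<Longrightarrow> dfn (\<lambda>s. prewo (T s) (U s) (W s) (X s))"
  by (rule dfn_rel4[of prewo]) (unfold prewo_def, intro dfi)

text \<open>\<open>R\<close> decides for any two elements of \<open>G\<close> how their values
  compare. If the values below \<open>y\<close> carry over from \<open>g\<close> to
  \<open>h\<close>, the value of \<open>u\<close> under \<open>h\<close> has the same predecessors
  as \<open>y\<close>, hence equals \<open>y\<close>.\<close>

lemma prewo_step: assumes b: "Ord b" "img g G b" "prewo G g b R"
  and c: "Ord c" "img h G c" "prewo G h c R"
  and IH: "\<And>z v. E z y \<Longrightarrow> E v G \<Longrightarrow> E z b \<Longrightarrow> E (pr v z) g \<Longrightarrow> E z c \<and> E (pr v z) h"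
  and u: "E u G" and y: "E y b" "E (pr u y) g"
  shows "E y c \<and> E (pr u y) h"
proof -
  have exg: "\<exists>x. E x G \<and> E (pr x z) g" if "E z b" for z
    using b(2) that unfolding img_def by blast
  have exh: "\<exists>x. E x G \<and> E (pr x z) h" if "E z c" for z
    using c(2) that unfolding img_def by blast
  have fg: "z = w" if "E x G" "E z b" "E w b" "E (pr x z) g" "E (pr x w) g" for x z w
    using b(2) that unfolding img_def by blast
  have fh: "z = w" if "E x G" "E z c" "E w c" "E (pr x z) h" "E (pr x w) h" for x z w
    using c(2) that unfolding img_def by blast
  have Rg: "E (pr x v) R \<longleftrightarrow> E z (succ w)"
    if "E x G" "E v G" "E z b" "E w b" "E (pr x z) g" "E (pr v w) g" for x v z w
    using b(3) fg that unfolding prewo_def by blast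
  have Rh: "E (pr x v) R \<longleftrightarrow> E z (succ w)"
    if "E x G" "E v G" "E z c" "E w c" "E (pr x z) h" "E (pr v w) h" for x v z w
    using c(3) fh that unfolding prewo_def by blast
  \<comment> \<open>Reflexivity of \<open>R\<close> at \<open>u\<close> shows that \<open>h\<close>
    has a value at \<open>u\<close> too.\<close>
  have "E (pr u u) R" using Rg[OF u u y(1) y(1) y(2) y(2)] by simp
  then obtain w where w: "E w c" "E (pr u w) h"
    using c(3) unfolding prewo_def by blast
  note ob = Ord_mem[OF _ b(1)] and oc = Ord_mem[OF _ c(1)]
  have "w = y"
  proof (rule set_ext)
    fix z
    show "E z w \<longleftrightarrow> E z y"
    proof
      assume z: "E z w"
      then have zc: "E z c" using w(1) c(1) Ord_trans by blast
      obtain v where v: "E v G" "E (pr v z) h" using exh[OF zc] by blast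
      have "E (pr v v) R" using Rh[OF v(1) v(1) zc zc v(2) v(2)] by simp
      then obtain z' where z': "E z' b" "E (pr v z') g"
        using b(3) unfolding prewo_def by blast
      have "\<not> E (pr u v) R"
        using Rh[OF u v(1) w(1) zc w(2) v(2)] Ord_not_mem[OF oc[OF zc] oc[OF w(1)]] z by blast
      then have "E z' y"
        using Rg[OF u v(1) y(1) z'(1) y(2) z'(2)] Ord_not_mem[OF ob[OF z'(1)] ob[OF y(1)]] by blast
      with IH[OF this v(1) z'] fh[OF v(1) zc _ v(2)] show "E z y" by metis
    next
      assume z: "E z y"
      then have zb: "E z b" using y(1) b(1) Ord_trans by blast
      obtain v where v: "E v G" "E (pr v z) g" using exg[OF zb] by blast
      have zc: "E z c" "E (pr v z) h" using IH[OF z v(1) zb v(2)] by auto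
      have "\<not> E (pr u v) R"
        using Rg[OF u v(1) y(1) zb y(2) v(2)] Ord_not_mem[OF ob[OF zb] ob[OF y(1)]] z by blast
      then show "E z w"
        using Rh[OF u v(1) w(1) zc(1) w(2) zc(2)] Ord_not_mem[OF oc[OF zc(1)] oc[OF w(1)]] by blast
    qed
  qed
  with w show ?thesis by simp
qed

lemma prewo_unique: assumes b: "Ord b" "img g G b" "prewo G g b R"
  and c: "Ord c" "img h G c" "prewo G h c R"
  shows "b = c"
proof -
  have "\<forall>u. E u G \<longrightarrow> (E y b \<and> E (pr u y) g \<longleftrightarrow> E y c \<and> E (pr u y) h)" for y
  proof (rule mem_induct[of "\<lambda>y. \<forall>u. E u G \<longrightarrow> (E y b \<and> E (pr u y) g \<longleftrightarrow> E y c \<and> E (pr u y) h)"])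
    show "dfn (\<lambda>s. \<forall>u. E u G \<longrightarrow> (E (s 0) b \<and> E (pr u (s 0)) g \<longleftrightarrow> E (s 0) c \<and> E (pr u (s 0)) h))"
      by (intro dfi)
    fix y assume IH: "\<And>z. E z y \<Longrightarrow> \<forall>u. E u G \<longrightarrow> (E z b \<and> E (pr u z) g \<longleftrightarrow> E z c \<and> E (pr u z) h)"
    show "\<forall>u. E u G \<longrightarrow> (E y b \<and> E (pr u y) g \<longleftrightarrow> E y c \<and> E (pr u y) h)"
      using prewo_step[OF b c, of y] prewo_step[OF c b, of y] IH by blast
  qed
  then show ?thesis
    using b(2) c(2) unfolding img_def by (intro set_ext) blast
qed

definition "coded G R b \<longleftrightarrow> Ord b \<and> (\<exists>g. img g G b \<and> prewo G g b R)"

lemma dfn_coded [dfi]: "dft T \<Longrightarrow> dft U \<Longrightarrow> dft W \<Longrightarrow> dfn (\<lambda>s. coded (T s) (U s) (W s))"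
  by (rule dfn_rel3[of coded]) (unfold coded_def, intro dfi)

lemma coded_unique: "coded G R b \<Longrightarrow> coded G R c \<Longrightarrow> b = c"
  unfolding coded_def using prewo_unique by blast

lemma ex_coded: assumes "Ord b" "onto G b" shows "\<exists>R. E R (pow (cart G G)) \<and> coded G R b"
proof -
  obtain g where g: "img g G b" using assms(2) unfolding onto_def by blast
  define R where "R = st {p. E p (cart G G) \<and> (\<exists>u v y z. p = pr u v \<and> E y b \<and> E z b \<and>
      E (pr u y) g \<and> E (pr v z) g \<and> E y (succ z))}"
  have "E p R \<longleftrightarrow> E p (cart G G) \<and> (\<exists>u v y z. p = pr u v \<and> E y b \<and> E z b \<and>
      E (pr u y) g \<and> E (pr v z) g \<and> E y (succ z))" for p
    unfolding R_def by (rule mem_sep) (intro dfi)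
  then have "E R (pow (cart G G))" "prewo G g b R"
    unfolding prewo_def by (auto simp del: mem_succ)
  then show ?thesis using assms(1) g unfolding coded_def by blast
qed

lemma mem_H: "E b (H G) \<longleftrightarrow> Ord b \<and> onto G b"
proof -
  have "small {b. \<exists>R. E R (pow (cart G G)) \<and> coded G R b}"
    by (rule replacement_rel) (intro dfi, blast intro: coded_unique)
  moreover have "(\<exists>R. E R (pow (cart G G)) \<and> coded G R b) \<longleftrightarrow> Ord b \<and> onto G b" for b
    using ex_coded unfolding coded_def onto_def by blast
  ultimately show ?thesis unfolding H_def by (subst st_mem) simp_all
qed

lemma Ord_H [simp]: "Ord (H G)"
proof (rule OrdI)
  fix y z assume y: "E y (H G)" and z: "E z y"
  then obtain g where g: "img g G y" and o: "Ord y" by (auto simp: mem_H onto_def)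
  have "img g G z"
    using g Ord_trans[OF _ z o] unfolding img_def by blast
  then show "E z (H G)"
    using Ord_mem[OF z o] by (auto simp: mem_H onto_def)
qed (simp add: mem_H)

lemma mem_H_subset: "Ord b \<Longrightarrow> (\<And>y. E y b \<Longrightarrow> E y G) \<Longrightarrow> E b (H G)"
  by (simp add: mem_H onto_subset)

section \<open>Bounds for families of ordinals below \<open>H G\<close>\<close>

definition "c1 = upair emp emp"

lemma c1_neq [simp]: "c1 \<noteq> emp" "emp \<noteq> c1"
proof -
  have "E emp c1" by (simp add: c1_def)
  then show "c1 \<noteq> emp" "emp \<noteq> c1" by auto
qed

text \<open>The tags \<open>emp\<close> and \<open>c1\<close> separate the two kinds of codes used
  in \<open>H_bounded\<close>.\<close>

definition "closed G \<longleftrightarrow> E emp G \<and> E c1 G \<and> (\<forall>x y. E x G \<longrightarrow> E y G \<longrightarrow> E (pr x y) G)"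

text \<open>A surjection onto \<open>b\<close> can be cut down to \<open>cart G b\<close>, so
  surjections for all \<open>b\<close> below \<open>H G\<close> are found in a single set, as
  bounded choice requires.\<close>

lemma H_choice: "\<exists>F. cf F \<and> (\<forall>b. E b (H G) \<longrightarrow> img (F b) G b)"
proof -
  have "\<exists>g. E g (pow (cart G (H G))) \<and> img g G b" if b: "E b (H G)" for b
  proof -
    obtain g where g: "E g (pow (cart G b))" "img g G b"
      using b onto_cartI[of G b] unfolding mem_H by blast
    have "E w (cart G (H G))" if "E w g" for w
    proof -
      have "E w (cart G b)" using g(1) that by simp
      from mem_cartE[OF this] obtain x y where "E x G" "E y b" "w = pr x y"
        by blast
      then show ?thesis using Ord_trans[OF _ b Ord_H] by simp
    qed
    then show ?thesis using g(2) by auto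
  qed
  moreover have "dfn (\<lambda>s. img (s 1) G (s 0))" by (intro dfi)
  ultimately obtain F where "cf F" "\<And>b. E b (H G) \<Longrightarrow> img (F b) G b"
    using bounded_choice[of "\<lambda>b g. img g G b" "H G" "pow (cart G (H G))"] by blast
  then show ?thesis by blast
qed

text \<open>The supremum of ordinals \<open>k u + 1\<close> is an image of \<open>G \<times> G + G\<close>, which is coded inside \<open>G\<close> by
  the pairs \<open>(u, (v, 0))\<close> and \<open>(u, (0, 1))\<close>.\<close>

theorem H_bounded: assumes G: "closed G" and k: "cf k" and kH: "\<And>u. E u G \<Longrightarrow> E (k u) (H G)"
  shows "\<exists>b. E b (H G) \<and> (\<forall>u. E u G \<longrightarrow> E (k u) b)"
proof -
  obtain F where F0: "cf F" and F: "\<And>u. E u G \<Longrightarrow> img (F (k u)) G (k u)"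
    using H_choice[of G] kH by blast
  have ck: "cf (\<lambda>u. succ (k u))" by (intro dfi cfD[OF k])
  define b where "b = bigun G (\<lambda>u. succ (k u))"
  have b: "E y b \<longleftrightarrow> (\<exists>u. E u G \<and> (E y (k u) \<or> y = k u))" for y
    unfolding b_def by (simp add: ck)
  have Ob: "Ord b"
    unfolding b_def by (rule Ord_bigun[OF ck]) (use kH mem_H in auto)
  define R where "R x y \<longleftrightarrow> (\<exists>u. E u G \<and> ((\<exists>v. E v G \<and> x = pr u (pr v emp) \<and> E y (k u) \<and> E (pr v y) (F (k u))) \<or>
      x = pr u (pr emp c1) \<and> y = k u))" for x y
  have "onto G b"
  proof (rule ontoI[of R])
    show "dfn (\<lambda>s. R (s 0) (s 1))"
      unfolding R_def by (intro dfi cfD[OF k] cfD[OF F0])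
    fix y assume "E y b"
    then obtain u where u: "E u G" "E y (k u) \<or> y = k u" by (auto simp: b)
    from u(2) show "\<exists>x. E x G \<and> R x y"
    proof
      assume y: "E y (k u)"
      then obtain v where v: "E v G" "E (pr v y) (F (k u))"
        using F[OF u(1)] unfolding img_def by blast
      then have "E (pr u (pr v emp)) G" "R (pr u (pr v emp)) y"
        using G u(1) y unfolding closed_def R_def by blast+
      then show ?thesis by blast
    next
      assume y: "y = k u"
      then have "E (pr u (pr emp c1)) G" "R (pr u (pr emp c1)) y"
        using G u(1) unfolding closed_def R_def by blast+
      then show ?thesis by blast
    qed
  next
    fix x y z assume xyz: "E x G" "E y b" "E z b" "R x y" "R x z"
    have "y = z" if "E u G" "E v G" "E y (k u)" "E z (k u)" "E (pr v y) (F (k u))" "E (pr v z) (F (k u))" for u v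
      using F[OF that(1)] that unfolding img_def by blast
    with xyz(4,5) show "y = z" unfolding R_def by auto
  qed
  with Ob have "E b (H G)" by (simp add: mem_H)
  then show ?thesis using b by blast
qed

lemma H_Lim: assumes "closed G" shows "Lim (H G)"
  unfolding Lim_def
proof (intro conjI allI impI)
  show "\<exists>y. E y (H G)" using mem_H_subset[of emp] by auto
  fix y assume y: "E y (H G)"
  have "cf (\<lambda>_. y)" by (intro dfi)
  from H_bounded[OF assms this y] obtain b where b: "E b (H G)" "E y b"
    using assms unfolding closed_def by blast
  then have "E (succ y) (succ b)" by (intro succ_mem_succ) (auto simp: mem_H)
  then show "E (succ y) (H G)" using b(1) by (rule Ord_le_trans) simp
qed simp

lemma H_bounded_Ord: assumes G: "closed G" and b: "E b (H G)" and k: "cf k"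
  and kH: "\<And>y. E y b \<Longrightarrow> E (k y) (H G)"
  shows "\<exists>c. E c (H G) \<and> (\<forall>y. E y b \<longrightarrow> E (k y) c)"
proof -
  obtain g where g: "img g G b" using b by (auto simp: mem_H onto_def)
  \<comment> \<open>\<open>k\<close> is carried to \<open>G\<close> along the surjection
    \<open>g\<close>, with default \<open>emp\<close> where \<open>g\<close> has no value in
    \<open>b\<close>.\<close>
  define k' where "k' x = st {z. \<exists>y. E y b \<and> E (pr x y) g \<and> E z (k y)}" for x
  have eq: "k' x = k y" if "E x G" "E y b" "E (pr x y) g" for x y
    unfolding k'_def using g that unfolding img_def by (intro st_eq) blast
  have emp: "k' x = emp" if "\<not> (\<exists>y. E y b \<and> E (pr x y) g)" for x
    unfolding k'_def using that by (intro st_eq) auto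
  have "cf k'"
    unfolding k'_def by (intro dfi cfD[OF k])
  moreover have "E (k' x) (H G)" if "E x G" for x
    using eq[OF that] emp[of x] kH mem_H_subset[of emp G] by (cases "\<exists>y. E y b \<and> E (pr x y) g") auto
  ultimately obtain c where "E c (H G)" "\<And>x. E x G \<Longrightarrow> E (k' x) c"
    using H_bounded[OF G] by blast
  moreover from this have "E (k y) c" if "E y b" for y
    using g eq that unfolding img_def by metis
  ultimately show ?thesis by blast
qed

section \<open>Iterated power sets\<close>

definition "Vh B = rec (\<lambda>i g. cup B (bigun i (\<lambda>y. pow (app g y))))"

lemma cf_Vh: "cf (Vh B)"
  unfolding Vh_def by (intro cf_rec dfi)
lemmas dft_Vh [dfi] = cfD[OF cf_Vh]

lemma mem_Vh: assumes "Ord i"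
  shows "E x (Vh B i) \<longleftrightarrow> E x B \<or> (\<exists>y. E y i \<and> (\<forall>z. E z x \<longrightarrow> E z (Vh B y)))"
proof -
  have 1: "cf2 (\<lambda>i g. cup B (bigun i (\<lambda>y. pow (app g y))))" by (intro dfi)
  have 2: "cf (\<lambda>y. pow (app (lam i (Vh B)) y))" by (intro dfi cf_Vh)
  have "Vh B i = cup B (bigun i (\<lambda>y. pow (app (lam i (Vh B)) y)))"
    using rec_eq[OF 1 assms] unfolding Vh_def .
  then have "E x (Vh B i) \<longleftrightarrow> E x B \<or> (\<exists>y. E y i \<and> E x (pow (app (lam i (Vh B)) y)))"
    by (simp add: 2 del: mem_pow)
  then show ?thesis using app_lam[OF cf_Vh] by auto
qed

lemma Vh_B: "Ord i \<Longrightarrow> E x B \<Longrightarrow> E x (Vh B i)"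
  by (simp add: mem_Vh)

lemma Vh_subset: "Ord i \<Longrightarrow> E y i \<Longrightarrow> (\<And>z. E z x \<Longrightarrow> E z (Vh B y)) \<Longrightarrow> E x (Vh B i)"
  by (auto simp: mem_Vh)

lemma Vh_mono: "Ord i \<Longrightarrow> E y (succ i) \<Longrightarrow> E x (Vh B y) \<Longrightarrow> E x (Vh B i)"
proof -
  assume i: "Ord i" and y: "E y (succ i)" and x: "E x (Vh B y)"
  have "Ord y" using i y Ord_mem by auto
  moreover have "E z i" if "E z y" for z using that y i Ord_trans by auto
  ultimately show "E x (Vh B i)" using x i unfolding mem_Vh[OF \<open>Ord y\<close>] mem_Vh[OF i] by blast
qed

lemma Vh_Lim: assumes "Lim i" "E x (Vh B i)" shows "\<exists>y. E y i \<and> E x (Vh B y)"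
proof -
  have i: "Ord i" using LimD(1)[OF assms(1)] .
  show ?thesis
  proof (cases "E x B")
    case True
    then show ?thesis using Vh_B[OF Ord_emp] LimD(2)[OF assms(1)] by blast
  next
    case False
    then obtain y where y: "E y i" "\<And>z. E z x \<Longrightarrow> E z (Vh B y)"
      using assms(2) by (auto simp: mem_Vh i)
    have "E x (Vh B (succ y))"
      by (rule Vh_subset[of "succ y" y]) (simp_all add: Ord_mem[OF y(1) i], rule y(2))
    then show ?thesis using LimD(3)[OF assms(1) y(1)] by blast
  qed
qed

lemma Vh_pr: assumes i: "Ord i" and "E x (Vh B i)" "E y (Vh B i)" shows "E (pr x y) (Vh B (succ (succ i)))"
proof -
  have "E (upair u v) (Vh B (succ k))" if "Ord k" "E u (Vh B k)" "E v (Vh B k)" for u v k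
    by (rule Vh_subset[of "succ k" k]) (use that in auto)
  with assms show ?thesis unfolding pr_def by simp
qed

lemma Vh_upair: assumes "Lim i" "E x (Vh B i)" "E y (Vh B i)" shows "E (upair x y) (Vh B i)"
proof -
  have i: "Ord i" using LimD(1)[OF assms(1)] .
  obtain u v where u: "E u i" "E x (Vh B u)" and v: "E v i" "E y (Vh B v)"
    using Vh_Lim assms by metis
  note o = Ord_mem[OF u(1) i] Ord_mem[OF v(1) i]
  have "E x (Vh B (cup u v))" "E y (Vh B (cup u v))"
    using u v Vh_mono[OF Ord_cup[OF o] le_cup(1)[OF o]] Vh_mono[OF Ord_cup[OF o] le_cup(2)[OF o]] by auto
  then show ?thesis
    using cup_mem[OF u(1) v(1) i] i by (intro Vh_subset[of i "cup u v"]) auto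
qed

lemma Vh_closed: assumes "Lim i" shows "closed (Vh B i)"
proof -
  have emp: "E emp (Vh B i)"
    using LimD[OF assms] by (intro Vh_subset[of i emp]) auto
  then show ?thesis
    unfolding closed_def c1_def pr_def using Vh_upair[OF assms] by blast
qed

lemma Ord_subset_Vh: assumes "Ord i" shows "E y i \<Longrightarrow> E y (Vh B i)"
proof -
  have "\<forall>y. E y i \<longrightarrow> E y (Vh B i)"
  proof (rule Ord_induct[of "\<lambda>i. \<forall>y. E y i \<longrightarrow> E y (Vh B i)", OF _ assms])
    show "dfn (\<lambda>s. \<forall>y. E y (s 0) \<longrightarrow> E y (Vh B (s 0)))" by (intro dfi)
    fix i assume i: "Ord i" and IH: "\<And>y. E y i \<Longrightarrow> \<forall>z. E z y \<longrightarrow> E z (Vh B y)"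
    show "\<forall>y. E y i \<longrightarrow> E y (Vh B i)"
      using IH i by (blast intro: Vh_subset)
  qed
  then show "E y i \<Longrightarrow> E y (Vh B i)" by blast
qed

text \<open>An ordinal below \<open>H (Vh B i)\<close> is coded by a prewellordering of part of
  \<open>Vh B i\<close>; this code is a subset of \<open>Vh B i\<close>, hence an element of
  \<open>Vh B k\<close>. Decoding maps \<open>Vh B k\<close> onto \<open>H (Vh B i)\<close>.\<close>

lemma H_Vh_mono: assumes i: "Lim i" and k: "Lim k" and ik: "E i k"
  shows "E (H (Vh B i)) (H (Vh B k))"
proof -
  let ?G = "Vh B i"
  note oi = LimD(1)[OF i] and ok = LimD(1)[OF k]
  have "onto (Vh B k) (H ?G)"
  proof (rule ontoI[of "coded ?G"])
    show "dfn (\<lambda>s. coded ?G (s 0) (s 1))" by (intro dfi)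
    fix y assume "E y (H ?G)"
    then obtain R where R: "E R (pow (cart ?G ?G))" "coded ?G R y"
      using ex_coded unfolding mem_H by blast
    have "E w ?G" if "E w R" for w
      using R(1) that mem_cartE[of w ?G ?G] Vh_closed[OF i] unfolding closed_def by auto
    then have "E R (Vh B k)" by (rule Vh_subset[OF ok ik])
    with R(2) show "\<exists>x. E x (Vh B k) \<and> coded ?G x y" by blast
  qed (rule coded_unique)
  then show ?thesis by (simp add: mem_H)
qed

section \<open>Transfer along elementary embeddings\<close>

named_theorems foi

definition "trs D \<longleftrightarrow> (\<forall>x\<in>D. \<forall>y. E y x \<longrightarrow> y \<in> D)"

text \<open>\<open>P D\<close> is the relativization to \<open>D\<close> of one formula; bounded quantifiers need none, as \<open>D\<close> is
  transitive.\<close>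

definition fo :: "('v set \<Rightarrow> (nat \<Rightarrow> 'v) \<Rightarrow> bool) \<Rightarrow> bool" where
  "fo P \<longleftrightarrow> (\<exists>p. set_fm p \<and> (\<forall>D s. trs D \<longrightarrow> range s \<subseteq> D \<longrightarrow> (set_sat D E p s \<longleftrightarrow> P D s)))"

lemma foI: "set_fm p \<Longrightarrow> (\<And>D s. trs D \<Longrightarrow> range s \<subseteq> D \<Longrightarrow> set_sat D E p s \<longleftrightarrow> P D s) \<Longrightarrow> fo P"
  unfolding fo_def by blast

lemma fo_cong: "fo P \<Longrightarrow> (\<And>D s. trs D \<Longrightarrow> (\<And>n. s n \<in> D) \<Longrightarrow> P D s \<longleftrightarrow> Q D s) \<Longrightarrow> fo Q"
  unfolding fo_def by (metis rangeI subset_eq)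

lemma fo_Mem [foi]: "fo (\<lambda>D s. E (s i) (s k))"
  by (rule foI[of "Mem i k"]) (simp_all add: set_sat_def)

lemma fo_Eq [foi]: "fo (\<lambda>D s. s i = s k)"
  by (rule foI[of "Eq i k"]) (simp_all add: set_sat_def)

lemma fo_not [foi]: assumes "fo P" shows "fo (\<lambda>D s. \<not> P D s)"
proof -
  obtain p where "set_fm p" "\<And>D s. trs D \<Longrightarrow> range s \<subseteq> D \<Longrightarrow> set_sat D E p s \<longleftrightarrow> P D s"
    using assms unfolding fo_def by blast
  then show ?thesis by (intro foI[of "Neg p"]) (simp_all add: set_sat_def)
qed

lemma fo_conj [foi]: assumes "fo P" "fo Q" shows "fo (\<lambda>D s. P D s \<and> Q D s)"
proof -
  obtain p where p: "set_fm p" "\<And>D s. trs D \<Longrightarrow> range s \<subseteq> D \<Longrightarrow> set_sat D E p s \<longleftrightarrow> P D s"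
    using assms(1) unfolding fo_def by blast
  obtain q where q: "set_fm q" "\<And>D s. trs D \<Longrightarrow> range s \<subseteq> D \<Longrightarrow> set_sat D E q s \<longleftrightarrow> Q D s"
    using assms(2) unfolding fo_def by blast
  show ?thesis
    using p q by (intro foI[of "And p q"]) (simp_all add: set_sat_def)
qed

lemma fo_all [foi]: assumes "fo (\<lambda>D t. P D (t 0) (\<lambda>n. t (Suc n)))" shows "fo (\<lambda>D s. \<forall>x\<in>D. P D x s)"
proof -
  obtain p where p: "set_fm p" "\<And>D s. trs D \<Longrightarrow> range s \<subseteq> D \<Longrightarrow>
      set_sat D E p s \<longleftrightarrow> P D (s 0) (\<lambda>n. s (Suc n))"
    using assms unfolding fo_def by blast
  obtain q where q: "set_fm q = set_fm p"
    "\<And>D E C s. sat D E C q s \<longleftrightarrow> (\<forall>x\<in>D. sat D E C p (x ## s :: nat \<Rightarrow> 'v))"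
    using quantifier_formula[of p, where 'v = 'v] by blast
  show ?thesis
  proof (rule foI[of q])
    show "set_fm q" using p q by simp
    fix D and s :: "nat \<Rightarrow> 'v" assume D: "trs D" "range s \<subseteq> D"
    have "set_sat D E p (x ## s) \<longleftrightarrow> P D x s" if "x \<in> D" for x
    proof -
      have "range (x ## s) \<subseteq> D"
        using D(2) that by (auto simp: cons_env_def split: nat.splits intro: subsetD[OF D(2) rangeI])
      from p(2)[OF D(1) this] show ?thesis by simp
    qed
    then show "set_sat D E q s \<longleftrightarrow> (\<forall>x\<in>D. P D x s)"
      using q(2) unfolding set_sat_def by simp
  qed
qed

lemma fo_disj [foi]: "fo P \<Longrightarrow> fo Q \<Longrightarrow> fo (\<lambda>D s. P D s \<or> Q D s)"
  using fo_not[OF fo_conj[OF fo_not fo_not], of P Q] by simp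

lemma fo_imp [foi]: "fo P \<Longrightarrow> fo Q \<Longrightarrow> fo (\<lambda>D s. P D s \<longrightarrow> Q D s)"
  unfolding imp_conv_disj by (intro foi)

lemma fo_iff [foi]: "fo P \<Longrightarrow> fo Q \<Longrightarrow> fo (\<lambda>D s. P D s \<longleftrightarrow> Q D s)"
  unfolding iff_conv_conj_imp by (intro foi)

lemma fo_ex [foi]: "fo (\<lambda>D t. P D (t 0) (\<lambda>n. t (Suc n))) \<Longrightarrow> fo (\<lambda>D s. \<exists>x\<in>D. P D x s)"
  using fo_not[OF fo_all[of "\<lambda>D x s. \<not> P D x s"], OF fo_not] by simp

lemma fo_ball [foi]: assumes "fo (\<lambda>D t. P D (t 0) (\<lambda>n. t (Suc n)))"
  shows "fo (\<lambda>D s. \<forall>x. E x (s i) \<longrightarrow> P D x s)"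
proof (rule fo_cong)
  show "fo (\<lambda>D s. \<forall>x\<in>D. E x (s i) \<longrightarrow> P D x s)" by (intro foi assms)
qed (auto simp: trs_def)

lemma fo_bex [foi]: assumes "fo (\<lambda>D t. P D (t 0) (\<lambda>n. t (Suc n)))"
  shows "fo (\<lambda>D s. \<exists>x. E x (s i) \<and> P D x s)"
proof (rule fo_cong)
  show "fo (\<lambda>D s. \<exists>x\<in>D. E x (s i) \<and> P D x s)" by (intro foi assms)
qed (auto simp: trs_def)

lemma fo_eq_upair [foi]: "fo (\<lambda>D s. s i = upair (s k) (s l))"
proof (rule fo_cong)
  show "fo (\<lambda>D s. E (s k) (s i) \<and> E (s l) (s i) \<and> (\<forall>w. E w (s i) \<longrightarrow> w = s k \<or> w = s l))"
    by (intro foi)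
  show "(E (s k) (s i) \<and> E (s l) (s i) \<and> (\<forall>w. E w (s i) \<longrightarrow> w = s k \<or> w = s l)) \<longleftrightarrow>
    s i = upair (s k) (s l)" for s :: "nat \<Rightarrow> 'v"
    using set_ext[of "s i" "upair (s k) (s l)"] by auto
qed

lemma fo_eq_succ [foi]: "fo (\<lambda>D s. s i = succ (s k))"
proof (rule fo_cong)
  show "fo (\<lambda>D s. E (s k) (s i) \<and> (\<forall>w. E w (s k) \<longrightarrow> E w (s i)) \<and> (\<forall>w. E w (s i) \<longrightarrow> E w (s k) \<or> w = s k))"
    by (intro foi)
  show "(E (s k) (s i) \<and> (\<forall>w. E w (s k) \<longrightarrow> E w (s i)) \<and> (\<forall>w. E w (s i) \<longrightarrow> E w (s k) \<or> w = s k)) \<longleftrightarrow>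
    s i = succ (s k)" for s :: "nat \<Rightarrow> 'v"
    using set_ext[of "s i" "succ (s k)"] by auto
qed

lemma fo_succ_mem [foi]: "fo (\<lambda>D s. E (succ (s i)) (s k))"
proof (rule fo_cong)
  show "fo (\<lambda>D s. \<exists>x. E x (s k) \<and> x = succ (s i))" by (intro foi)
qed auto

lemma fo_pr_mem [foi]: "fo (\<lambda>D s. E (pr (s i) (s k)) (s l))"
proof (rule fo_cong)
  show "fo (\<lambda>D s. \<exists>p. E p (s l) \<and> (\<exists>a. E a p \<and> (\<exists>b. E b p \<and> a = upair (s i) (s i) \<and>
      b = upair (s i) (s k) \<and> p = upair a b)))" by (intro foi)
qed (auto simp: pr_def)

lemma fo_Ord [foi]: "fo (\<lambda>D s. Ord (s i))"
  unfolding Ord_def trn_def by (intro foi)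

lemma fo_Lim [foi]: "fo (\<lambda>D s. Lim (s i))"
proof (rule fo_cong)
  show "fo (\<lambda>D s. Ord (s i) \<and> (\<exists>y. E y (s i) \<and> y = y) \<and> (\<forall>y. E y (s i) \<longrightarrow> E (succ y) (s i)))"
    by (intro foi)
qed (simp add: Lim_def)

lemma fo_img [foi]: "fo (\<lambda>D s. img (s i) (s k) (s l))"
  unfolding img_def by (intro foi)

text \<open>Elementarity is recorded in one direction; as \<open>fo\<close> is closed under
  negation, this includes the converse.\<close>

definition "emb M j \<longleftrightarrow> trs M \<and> cf j \<and> (\<forall>x. j x \<in> M) \<and>
  (\<forall>P s. fo P \<longrightarrow> P UNIV s \<longrightarrow> P M (j \<circ> s))"

lemma emb_elementary: assumes "inner_model E Cls M" "elementary_embedding E Cls M j" shows "emb M j"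
  unfolding emb_def
proof (intro conjI allI impI)
  show M: "trs M" using assms(1) unfolding inner_model_def trs_def by blast
  show "cf j" using assms(2) cf_class_function unfolding elementary_embedding_def by blast
  show j: "j x \<in> M" for x using assms(2) unfolding elementary_embedding_def by blast
  fix P s assume "fo P" and P: "P UNIV s"
  then obtain p where p: "set_fm p" "\<And>D s. trs D \<Longrightarrow> range s \<subseteq> D \<Longrightarrow> set_sat D E p s \<longleftrightarrow> P D s"
    unfolding fo_def by blast
  have "set_sat UNIV E p s" using p(2)[of UNIV s] P unfolding trs_def by simp
  then have "set_sat M E p (j \<circ> s)"
    using assms(2) p(1) unfolding elementary_embedding_def by blast
  then show "P M (j \<circ> s)" using p(2)[OF M, of "j \<circ> s"] j by auto
qed

section \<open>Basic values of an embedding\<close>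

context
  fixes M j
  assumes emb: "emb M j"
begin

lemma emb_trs: "trs M" and emb_cf: "cf j" and emb_M: "j x \<in> M"
  using emb unfolding emb_def by blast+

lemmas dft_emb = cfD[OF emb_cf]

lemma M_trans: "x \<in> M \<Longrightarrow> E y x \<Longrightarrow> y \<in> M"
  using emb_trs unfolding trs_def by blast

lemma emb_elem: "E y (j x) \<Longrightarrow> y \<in> M"
  using M_trans emb_M by blast

lemma transfer: "fo P \<Longrightarrow> P UNIV s \<Longrightarrow> P M (j \<circ> s)"
  using emb unfolding emb_def by blast

lemma transfer1: "fo (\<lambda>D s. P D (s 0)) \<Longrightarrow> P UNIV x \<Longrightarrow> P M (j x)"
  using transfer[of "\<lambda>D s. P D (s 0)" "\<lambda>_. x"] by simp

lemma transfer2: "fo (\<lambda>D s. P D (s 0) (s 1)) \<Longrightarrow> P UNIV x y \<Longrightarrow> P M (j x) (j y)"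
  using transfer[of "\<lambda>D s. P D (s 0) (s 1)" "x ## (\<lambda>_. y)"] by simp

lemma transfer3: "fo (\<lambda>D s. P D (s 0) (s 1) (s 2)) \<Longrightarrow> P UNIV x y z \<Longrightarrow> P M (j x) (j y) (j z)"
  using transfer[of "\<lambda>D s. P D (s 0) (s 1) (s 2)" "x ## y ## (\<lambda>_. z)"] by (simp add: numeral_2_eq_2)

lemma transfer4: "fo (\<lambda>D s. P D (s 0) (s 1) (s 2) (s 3)) \<Longrightarrow> P UNIV x y z w \<Longrightarrow> P M (j x) (j y) (j z) (j w)"
  using transfer[of "\<lambda>D s. P D (s 0) (s 1) (s 2) (s 3)" "x ## y ## z ## (\<lambda>_. w)"]
  by (simp add: numeral_2_eq_2 numeral_3_eq_3)

lemma j_mem [simp]: "E (j x) (j y) \<longleftrightarrow> E x y"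
  using transfer2[of "\<lambda>D. E" x y, OF fo_Mem]
    transfer2[of "\<lambda>D x y. \<not> E x y" x y, OF fo_not[OF fo_Mem]] by blast

lemma j_eq [simp]: "j x = j y \<longleftrightarrow> x = y"
  using transfer2[of "\<lambda>D x y. x \<noteq> y" x y, OF fo_not[OF fo_Eq]] by blast

lemma j_upair: "j (upair x y) = upair (j x) (j y)"
  using transfer3[of "\<lambda>D z x y. z = upair x y", OF fo_eq_upair] by blast

lemma j_pr: "j (pr x y) = pr (j x) (j y)"
  by (simp add: pr_def j_upair)

lemma j_succ: "j (succ x) = succ (j x)"
  using transfer2[of "\<lambda>D z x. z = succ x", OF fo_eq_succ] by blast

lemma j_emp: "j emp = emp"
proof (rule set_ext)
  have "fo (\<lambda>D s. \<forall>y. E y (s 0) \<longrightarrow> y \<noteq> y)" by (intro foi)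
  from transfer1[of "\<lambda>D x. \<forall>y. E y x \<longrightarrow> y \<noteq> y", OF this, of emp]
  show "E z (j emp) \<longleftrightarrow> E z emp" for z by simp
qed

lemma j_Ord: "Ord x \<Longrightarrow> Ord (j x)"
  using transfer1[of "\<lambda>D. Ord", OF fo_Ord] by blast

lemma j_Lim: "Lim x \<Longrightarrow> Lim (j x)"
  using transfer1[of "\<lambda>D. Lim", OF fo_Lim] by blast

lemma j_pr_mem: "E (pr x y) g \<Longrightarrow> E (pr (j x) (j y)) (j g)"
  using j_mem[of "pr x y" g] by (simp add: j_pr)

lemma j_ge: assumes "Ord x" shows "E x (succ (j x))"
proof (rule Ord_induct[of "\<lambda>x. E x (succ (j x))", OF _ assms])
  show "dfn (\<lambda>s. E (s 0) (succ (j (s 0))))" by (intro dfi dft_emb)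
  fix x assume x: "Ord x" and IH: "\<And>y. E y x \<Longrightarrow> E y (succ (j y))"
  show "E x (succ (j x))"
  proof (rule ccontr)
    assume "\<not> E x (succ (j x))"
    then have "E (j x) x" using Ord_not_mem[OF j_Ord[OF x] x] by blast
    with IH[OF this] show False using mem_asym[of "j x" "j (j x)"] by auto
  qed
qed

lemma j_om: "j om = om"
proof -
  have "Lim (j om)" by (rule j_Lim[OF Lim_om])
  then have 1: "\<not> E (j om) om" using om_least by blast
  have "fo (\<lambda>D s. \<forall>y. E y (s 0) \<longrightarrow> \<not> Lim y)" by (intro foi)
  from transfer1[of "\<lambda>D x. \<forall>y. E y x \<longrightarrow> \<not> Lim y", OF this, of om] om_least Lim_om
  have "\<not> E om (j om)" by blast
  with 1 show ?thesis using Ord_linear[of "j om" om] Lim_om j_Lim LimD(1) by blast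
qed

lemma j_nat: "E n om \<Longrightarrow> j n = n"
proof (rule om_induct[of "\<lambda>n. j n = n"])
  show "dfn (\<lambda>s. j (s 0) = s 0)" by (intro dfi dft_emb)
qed (simp_all add: j_emp j_succ)

end

section \<open>Relativized power sets, hierarchies and images\<close>

definition "isPow D x p \<longleftrightarrow> (\<forall>z\<in>D. E z p \<longleftrightarrow> (\<forall>u. E u z \<longrightarrow> E u x))"

lemma fo_isPow: "fo (\<lambda>D s. isPow D (s i) (s k))"
  unfolding isPow_def by (intro foi)

text \<open>In \<open>M\<close> the set \<open>j (pow x)\<close> is the power set of
  \<open>j x\<close>. If \<open>j\<close> fixes \<open>th\<close>, then \<open>j (pow th)\<close> is
  thus determined by \<open>th\<close> and \<open>M\<close> and is part of
  \<open>pow th\<close>.\<close>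

lemma j_pow: assumes "emb M j" shows "E z (j (pow x)) \<longleftrightarrow> z \<in> M \<and> (\<forall>u. E u z \<longrightarrow> E u (j x))"
proof -
  have "isPow UNIV x (pow x)" by (simp add: isPow_def)
  from transfer2[OF assms, of isPow, OF fo_isPow this] show ?thesis
    using emb_elem[OF assms] unfolding isPow_def by blast
qed

definition "isH D G t \<longleftrightarrow> (\<forall>b\<in>D. E b t \<longleftrightarrow> Ord b \<and> (\<exists>g\<in>D. img g G b))"

lemma fo_isH [foi]: "fo (\<lambda>D s. isH D (s i) (s k))"
  unfolding isH_def by (intro foi)

lemma isH_UNIV: "isH UNIV G t \<longleftrightarrow> t = H G"
  unfolding isH_def using set_ext[of t "H G"] by (auto simp: mem_H onto_def)

text \<open>The counterpart of \<open>att\<close> for \<open>Vh\<close>, written as a relation so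
  that its power sets and its witnesses are computed in \<open>D\<close>.\<close>

definition "hier D g B k \<longleftrightarrow>
  (\<forall>y. E y k \<longrightarrow> (\<exists>v\<in>D. E (pr y v) g)) \<and>
  (\<forall>y. E y k \<longrightarrow> (\<forall>v\<in>D. E (pr y v) g \<longrightarrow> (\<forall>x\<in>D. E x v \<longleftrightarrow> E x B \<or>
     (\<exists>z. E z y \<and> (\<exists>w\<in>D. E (pr z w) g \<and> (\<forall>u. E u x \<longrightarrow> E u w))))))"
definition "isVh D B i v \<longleftrightarrow> (\<exists>g\<in>D. \<exists>k\<in>D. Ord k \<and> E i k \<and> hier D g B k \<and> E (pr i v) g)"

lemma fo_isVh [foi]: "fo (\<lambda>D s. isVh D (s i) (s k) (s l))"
  unfolding isVh_def hier_def by (intro foi)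

lemma isVh_UNIV: assumes "Ord i" shows "isVh UNIV B i v \<longleftrightarrow> v = Vh B i"
proof
  assume v: "v = Vh B i"
  have "hier UNIV (lam (succ i) (Vh B)) B (succ i)"
    unfolding hier_def
  proof (intro conjI allI impI ballI)
    fix y assume y: "E y (succ i)"
    show "\<exists>v\<in>UNIV. E (pr y v) (lam (succ i) (Vh B))" using y by (simp add: cf_Vh)
    have oy: "Ord y" using y assms Ord_mem by auto
    have "E z (succ i)" if "E z y" for z using that y assms Ord_trans by auto
    moreover fix v x assume "E (pr y v) (lam (succ i) (Vh B))"
    then have "v = Vh B y" by (simp add: cf_Vh)
    ultimately show "E x v \<longleftrightarrow> E x B \<or> (\<exists>z. E z y \<and> (\<exists>w\<in>UNIV. E (pr z w) (lam (succ i) (Vh B)) \<and>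
        (\<forall>u. E u x \<longrightarrow> E u w)))"
      using mem_Vh[OF oy, of x B] by (auto simp: cf_Vh simp del: mem_succ)
  qed
  then show "isVh UNIV B i v"
    unfolding isVh_def v using assms
    by (intro bexI[of _ "lam (succ i) (Vh B)"] bexI[of _ "succ i"]) (simp_all add: cf_Vh)
next
  assume "isVh UNIV B i v"
  then obtain g k where k: "Ord k" "E i k" and g: "hier UNIV g B k" and v: "E (pr i v) g"
    unfolding isVh_def by blast
  have "E y k \<longrightarrow> (\<forall>v. E (pr y v) g \<longrightarrow> v = Vh B y)" if y: "Ord y" for y
  proof (rule Ord_induct[of "\<lambda>y. E y k \<longrightarrow> (\<forall>v. E (pr y v) g \<longrightarrow> v = Vh B y)", OF _ y])
    show "dfn (\<lambda>s. E (s 0) k \<longrightarrow> (\<forall>v. E (pr (s 0) v) g \<longrightarrow> v = Vh B (s 0)))" by (intro dfi)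
    fix y assume oy: "Ord y" and IH: "\<And>z. E z y \<Longrightarrow> E z k \<longrightarrow> (\<forall>v. E (pr z v) g \<longrightarrow> v = Vh B z)"
    show "E y k \<longrightarrow> (\<forall>v. E (pr y v) g \<longrightarrow> v = Vh B y)"
    proof (intro impI allI)
      fix v assume y: "E y k" and v: "E (pr y v) g"
      have zk: "E z k" if "E z y" for z using that y k Ord_trans by blast
      have ex: "\<exists>w. E (pr z w) g" if "E z k" for z using g that unfolding hier_def by blast
      show "v = Vh B y"
      proof (rule set_ext)
        fix x
        have "E x v \<longleftrightarrow> E x B \<or> (\<exists>z. E z y \<and> (\<exists>w. E (pr z w) g \<and> (\<forall>u. E u x \<longrightarrow> E u w)))"
          using g y v unfolding hier_def by blast
        also have "(\<exists>z. E z y \<and> (\<exists>w. E (pr z w) g \<and> (\<forall>u. E u x \<longrightarrow> E u w))) \<longleftrightarrow>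
            (\<exists>z. E z y \<and> (\<forall>u. E u x \<longrightarrow> E u (Vh B z)))"
          using IH zk ex by metis
        finally show "E x v \<longleftrightarrow> E x (Vh B y)" using mem_Vh[OF oy] by simp
      qed
    qed
  qed
  with assms k v show "v = Vh B i" by blast
qed

text \<open>The hierarchy computed in \<open>M\<close> has fewer subsets at its disposal at each
  stage, so by induction it stays inside the real one.\<close>

lemma isVh_subset: assumes i: "Ord i" and M: "trs M" and v: "isVh M B' i v" and B: "\<And>x. E x B' \<Longrightarrow> E x B"
  shows "E x v \<Longrightarrow> E x (Vh B i)"
proof -
  obtain g k where gM: "g \<in> M" and k: "Ord k" "E i k" and g: "hier M g B' k" and v: "E (pr i v) g"
    using v unfolding isVh_def by blast
  have "E y k \<longrightarrow> (\<forall>v. E (pr y v) g \<longrightarrow> (\<forall>x. E x v \<longrightarrow> E x (Vh B y)))" if y: "Ord y" for y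
  proof (rule Ord_induct[of "\<lambda>y. E y k \<longrightarrow> (\<forall>v. E (pr y v) g \<longrightarrow> (\<forall>x. E x v \<longrightarrow> E x (Vh B y)))", OF _ y])
    show "dfn (\<lambda>s. E (s 0) k \<longrightarrow> (\<forall>v. E (pr (s 0) v) g \<longrightarrow> (\<forall>x. E x v \<longrightarrow> E x (Vh B (s 0)))))" by (intro dfi)
    fix y assume oy: "Ord y" and IH: "\<And>z. E z y \<Longrightarrow> E z k \<longrightarrow> (\<forall>v. E (pr z v) g \<longrightarrow> (\<forall>x. E x v \<longrightarrow> E x (Vh B z)))"
    show "E y k \<longrightarrow> (\<forall>v. E (pr y v) g \<longrightarrow> (\<forall>x. E x v \<longrightarrow> E x (Vh B y)))"
    proof (intro impI allI)
      fix v x assume y: "E y k" and v: "E (pr y v) g" and x: "E x v"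
      have zk: "E z k" if "E z y" for z using that y k Ord_trans by blast
      have "E (upair y v) (pr y v)" by (simp add: pr_def)
      moreover have "E v (upair y v)" by simp
      ultimately have "v \<in> M" using M gM v unfolding trs_def by blast
      moreover from this have "x \<in> M" using M x unfolding trs_def by blast
      ultimately have "E x B' \<or> (\<exists>z. E z y \<and> (\<exists>w. E (pr z w) g \<and> (\<forall>u. E u x \<longrightarrow> E u w)))"
        using g y v x unfolding hier_def by blast
      then have "E x B \<or> (\<exists>z. E z y \<and> (\<forall>u. E u x \<longrightarrow> E u (Vh B z)))"
        using IH zk B by meson
      then show "E x (Vh B y)" using mem_Vh[OF oy] by simp
    qed
  qed
  with i k v show "E x v \<Longrightarrow> E x (Vh B i)" by blast
qed

text \<open>\<open>j\<close> sends \<open>H (Vh B i)\<close> to what \<open>M\<close> takes for it.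
  As \<open>M\<close> computes a smaller hierarchy and has fewer surjections, the ordinal cannot
  grow, and an embedding never lowers an ordinal.\<close>

lemma emb_H_fixed: assumes j: "emb M j" and i: "Ord i" "j i = i" and B: "\<And>x. E x (j B) \<Longrightarrow> E x B"
  shows "j (H (Vh B i)) = H (Vh B i)"
proof -
  let ?G = "Vh B i" and ?t = "H (Vh B i)"
  have "isVh UNIV B i ?G" using isVh_UNIV i by simp
  from transfer3[OF j, of isVh, OF fo_isVh this] have "isVh M (j B) i (j ?G)"
    unfolding i(2) .
  from isVh_subset[OF i(1) emb_trs[OF j] this B] have G: "E x (j ?G) \<Longrightarrow> E x ?G" for x by blast
  have "isH UNIV ?G ?t" by (simp add: isH_UNIV)
  from transfer2[OF j, of isH, OF fo_isH this] have t: "isH M (j ?G) (j ?t)" .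
  have "E b ?t" if b: "E b (j ?t)" for b
  proof -
    have "b \<in> M" using b emb_elem[OF j] by blast
    with b t have "Ord b" "onto (j ?G) b"
      unfolding isH_def onto_def by blast+
    then show ?thesis using onto_mono[OF _ G] by (simp add: mem_H)
  qed
  then have "E (j ?t) (succ ?t)"
    using j_Ord[OF j] by (intro Ord_leI) simp_all
  moreover have "E ?t (succ (j ?t))" by (rule j_ge[OF j]) simp
  ultimately show ?thesis using mem_asym[of ?t "j ?t"] by auto
qed

text \<open>\<open>isT UNIV B i t\<close> says that \<open>t = H V\<^sup>B\<^sub>i\<close>; distinct limits \<open>i\<close> have distinct \<open>t\<close>, and this
  is transferred to \<open>M\<close>.\<close>

definition "isT D B i t \<longleftrightarrow> Lim i \<and> (\<exists>v\<in>D. isVh D B i v \<and> isH D v t)"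

lemma fo_isT [foi]: "fo (\<lambda>D s. isT D (s i) (s k) (s l))"
  unfolding isT_def by (intro foi)

lemma isT_UNIV: "isT UNIV B i t \<longleftrightarrow> Lim i \<and> t = H (Vh B i)"
  unfolding isT_def isH_UNIV using isVh_UNIV LimD(1) by auto

text \<open>That \<open>i\<close> is determined by \<open>B\<close> and \<open>H (Vh B i)\<close> is
  transferred to \<open>M\<close>, where \<open>j i\<close> and \<open>k i\<close> solve the same
  equation.\<close>

lemma H_Vh_agree: assumes j: "emb M j" and k: "emb M k" and B: "j B = k B" and i: "Lim i"
  and t: "j (H (Vh B i)) = k (H (Vh B i))"
  shows "j i = k i"
proof -
  let ?t = "H (Vh B i)"
  have T: "isT M (l B) (l i) (l ?t)" if l: "emb M l" for l
    using transfer3[OF l, of isT B i ?t, OF fo_isT] i unfolding isT_UNIV by blast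
  have "i = i'" if "isT UNIV B i t" "isT UNIV B i' t" for i i' t
    using that H_Vh_mono[of i i' B] H_Vh_mono[of i' i B] Ord_linear[of i i'] LimD(1)
    unfolding isT_UNIV by (metis mem_irrefl)
  then have "\<forall>i\<in>UNIV. \<forall>i'\<in>UNIV. isT UNIV B i ?t \<longrightarrow> isT UNIV B i' ?t \<longrightarrow> i = i'" by blast
  moreover have "fo (\<lambda>D s. \<forall>i\<in>D. \<forall>i'\<in>D. isT D (s 0) i (s 1) \<longrightarrow> isT D (s 0) i' (s 1) \<longrightarrow> i = i')"
    by (intro foi)
  ultimately have "\<forall>i\<in>M. \<forall>i'\<in>M. isT M (j B) i (j ?t) \<longrightarrow> isT M (j B) i' (j ?t) \<longrightarrow> i = i'"
    using transfer2[OF j, of "\<lambda>D B t. \<forall>i\<in>D. \<forall>i'\<in>D. isT D B i t \<longrightarrow> isT D B i' t \<longrightarrow> i = i'"] by blast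
  with T[OF j] T[OF k] emb_M[OF j] emb_M[OF k] B t show ?thesis by metis
qed

section \<open>Regular ordinals and cofinality\<close>

definition "reg D t \<longleftrightarrow> Lim t \<and> (\<forall>b. E b t \<longrightarrow> (\<forall>f\<in>D.
  (\<forall>y. E y b \<longrightarrow> (\<forall>z. E z t \<longrightarrow> (\<forall>w. E w t \<longrightarrow> E (pr y z) f \<longrightarrow> E (pr y w) f \<longrightarrow> z = w))) \<longrightarrow>
  (\<exists>c. E c t \<and> (\<forall>y. E y b \<longrightarrow> (\<forall>z. E z t \<longrightarrow> E (pr y z) f \<longrightarrow> E z c)))))"
text \<open>A strictly increasing cofinal map, read off from the pairs of \<open>c\<close> with
  values in \<open>x\<close>. All quantifiers are bounded, so this is absolute, whereas
  \<open>reg\<close> depends on the functions in \<open>D\<close>.\<close>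

definition "cofmap c t x \<longleftrightarrow>
  (\<forall>y. E y t \<longrightarrow> (\<exists>z. E z x \<and> E (pr y z) c)) \<and>
  (\<forall>y. E y t \<longrightarrow> (\<forall>z. E z x \<longrightarrow> (\<forall>w. E w x \<longrightarrow> E (pr y z) c \<longrightarrow> E (pr y w) c \<longrightarrow> z = w))) \<and>
  (\<forall>y. E y t \<longrightarrow> (\<forall>y'. E y' t \<longrightarrow> (\<forall>z. E z x \<longrightarrow> (\<forall>w. E w x \<longrightarrow> E y y' \<longrightarrow> E (pr y z) c \<longrightarrow> E (pr y' w) c \<longrightarrow> E z w)))) \<and>
  (\<forall>w. E w x \<longrightarrow> (\<exists>y. E y t \<and> (\<exists>z. E z x \<and> E (pr y z) c \<and> E w z)))"

lemma cofmap_total: "cofmap c t x \<Longrightarrow> E y t \<Longrightarrow> \<exists>z. E z x \<and> E (pr y z) c"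
  unfolding cofmap_def by blast

lemma cofmap_fun: "cofmap c t x \<Longrightarrow> E y t \<Longrightarrow> E z x \<Longrightarrow> E w x \<Longrightarrow> E (pr y z) c \<Longrightarrow> E (pr y w) c \<Longrightarrow> z = w"
  unfolding cofmap_def by blast

lemma cofmap_mono: "cofmap c t x \<Longrightarrow> E y t \<Longrightarrow> E y' t \<Longrightarrow> E z x \<Longrightarrow> E w x \<Longrightarrow> E y y' \<Longrightarrow>
    E (pr y z) c \<Longrightarrow> E (pr y' w) c \<Longrightarrow> E z w"
  unfolding cofmap_def by blast

lemma cofmap_cof: "cofmap c t x \<Longrightarrow> E w x \<Longrightarrow> \<exists>y z. E y t \<and> E z x \<and> E (pr y z) c \<and> E w z"
  unfolding cofmap_def by blast

lemma fo_reg [foi]: "fo (\<lambda>D s. reg D (s i))"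
  unfolding reg_def by (intro foi)

lemma fo_cofmap [foi]: "fo (\<lambda>D s. cofmap (s i) (s k) (s l))"
  unfolding cofmap_def by (intro foi)

lemma reg_H: assumes "closed G" shows "reg UNIV (H G)"
  unfolding reg_def
proof (intro conjI allI impI ballI)
  show "Lim (H G)" by (rule H_Lim[OF assms])
  fix b f assume b: "E b (H G)"
    and f: "\<forall>y. E y b \<longrightarrow> (\<forall>z. E z (H G) \<longrightarrow> (\<forall>w. E w (H G) \<longrightarrow> E (pr y z) f \<longrightarrow> E (pr y w) f \<longrightarrow> z = w))"
  define k where "k y = st {u. \<exists>z. E z (H G) \<and> E (pr y z) f \<and> E u z}" for y
  have eq: "k y = z" if "E y b" "E z (H G)" "E (pr y z) f" for y z
    unfolding k_def using f that by (intro st_eq) blast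
  have emp: "k y = emp" if "\<not> (\<exists>z. E z (H G) \<and> E (pr y z) f)" for y
    unfolding k_def using that by (intro st_eq) auto
  have "cf k" unfolding k_def by (intro dfi)
  moreover have "E (k y) (H G)" if "E y b" for y
    using eq[OF that] emp[of y] mem_H_subset[of emp G] by (cases "\<exists>z. E z (H G) \<and> E (pr y z) f") auto
  ultimately obtain c where "E c (H G)" "\<forall>y. E y b \<longrightarrow> E (k y) c"
    using H_bounded_Ord[OF assms b] by blast
  then show "\<exists>c. E c (H G) \<and> (\<forall>y. E y b \<longrightarrow> (\<forall>z. E z (H G) \<longrightarrow> E (pr y z) f \<longrightarrow> E z c))"
    using eq by blast
qed

lemma reg_bounded: assumes t: "reg UNIV t" and b: "E b t" and k: "cf k" and kt: "\<And>y. E y b \<Longrightarrow> E (k y) t"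
  shows "\<exists>c. E c t \<and> (\<forall>y. E y b \<longrightarrow> E (k y) c)"
proof -
  have "\<forall>y. E y b \<longrightarrow> (\<forall>z. E z t \<longrightarrow> (\<forall>w. E w t \<longrightarrow> E (pr y z) (lam b k) \<longrightarrow> E (pr y w) (lam b k) \<longrightarrow> z = w))"
    by (simp add: k)
  with t b obtain c where c: "E c t" "\<forall>y. E y b \<longrightarrow> (\<forall>z. E z t \<longrightarrow> E (pr y z) (lam b k) \<longrightarrow> E z c)"
    unfolding reg_def by blast
  have "E (k y) c" if "E y b" for y
    using c(2) kt[OF that] that by (simp add: k)
  with c(1) show ?thesis by blast
qed

text \<open>Were \<open>t\<close> smaller than \<open>u\<close>, send \<open>y\<close> to the least
  \<open>v\<close> at which \<open>d\<close> exceeds the value of \<open>c\<close> at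
  \<open>y\<close>. Regularity of \<open>u\<close> bounds these \<open>v\<close> by some
  \<open>b\<close>, and the value of \<open>d\<close> at \<open>b\<close> then bounds the cofinal
  map \<open>c\<close>.\<close>

lemma cofmap_not_less: assumes t: "reg UNIV t" and u: "reg UNIV u" and c: "cofmap c t x" and d: "cofmap d u x"
    and x: "Ord x"
  shows "\<not> E t u"
proof
  assume tu: "E t u"
  have o: "Ord t" "Ord u" using t u LimD(1) unfolding reg_def by blast+

  define P where "P y v \<longleftrightarrow> E v u \<and> (\<exists>z w. E z x \<and> E w x \<and> E (pr y z) c \<and> E (pr v w) d \<and> E z w)" for y v
  have P: "dfn (\<lambda>s. P y (s 0))" for y unfolding P_def by (intro dfi)
  have ex: "\<exists>v. P y v" if "E y t" for y
    using cofmap_total[OF c that] cofmap_cof[OF d] unfolding P_def by blast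
  have l: "P y (lst (P y))" if y: "E y t" for y
  proof -
    obtain v where v: "P y v" using ex[OF y] by blast
    then have "Ord v" using o(2) Ord_mem unfolding P_def by blast
    from lst(2)[OF P this v] show ?thesis .
  qed
  have cl: "cf (\<lambda>y. lst (P y))" unfolding P_def by (intro dfi)
  obtain b where b: "E b u" "\<And>y. E y t \<Longrightarrow> E (lst (P y)) b"
    using reg_bounded[OF u tu cl] l unfolding P_def by blast
  obtain w where w: "E w x" "E (pr b w) d" using cofmap_total[OF d b(1)] by blast
  obtain y z where y: "E y t" "E z x" "E (pr y z) c" "E w z" using cofmap_cof[OF c w(1)] by blast
  obtain z' w' where zw: "E z' x" "E w' x" "E (pr y z') c" "E (pr (lst (P y)) w') d" "E z' w'" "E (lst (P y)) u"
    using l[OF y(1)] unfolding P_def by blast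
  have "z' = z" by (rule cofmap_fun[OF c y(1) zw(1) y(2) zw(3) y(3)])
  moreover have "E w' w"
    by (rule cofmap_mono[OF d zw(6) b(1) zw(2) w(1) b(2)[OF y(1)] zw(4) w(2)])
  ultimately have "E w' z" "E z w'"
    using zw(5) Ord_trans[OF _ y(4) Ord_mem[OF y(2) x]] by blast+
  then show False using mem_asym by blast
qed

text \<open>In \<open>M\<close>, both \<open>j t\<close> and \<open>k t\<close> are regular with
  cofinal maps into the ordinal \<open>j x = k x\<close>, and uniqueness of such an ordinal is
  transferred.\<close>

lemma cofinality_agree: assumes j: "emb M j" and k: "emb M k" and t: "reg UNIV t" and c: "cofmap c t x"
  and x: "Ord x" "j x = k x"
  shows "j t = k t"
proof -
  let ?S = "\<lambda>D x. Ord x \<longrightarrow> (\<forall>t\<in>D. \<forall>u\<in>D. \<forall>c\<in>D. \<forall>d\<in>D.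
      reg D t \<longrightarrow> reg D u \<longrightarrow> cofmap c t x \<longrightarrow> cofmap d u x \<longrightarrow> t = u)"
  have "t = u" if "Ord x" "reg UNIV t" "reg UNIV u" "cofmap c t x" "cofmap d u x" for t u c d
    using cofmap_not_less[OF that(2,3,4,5,1)] cofmap_not_less[OF that(3,2,5,4,1)]
      Ord_linear[of t u] that(2,3) LimD(1) unfolding reg_def by blast
  then have "?S UNIV x" by blast
  moreover have "fo (\<lambda>D s. ?S D (s 0))" by (intro foi)
  ultimately have S: "?S M (j x)" using transfer1[OF j, of ?S] by blast
  have "cofmap (l c) (l t) (l x)" "reg M (l t)" if l: "emb M l" for l
    using transfer3[OF l, of "\<lambda>D. cofmap", OF fo_cofmap c] transfer1[OF l, of reg, OF fo_reg t] .
  then show ?thesis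
    using S j_Ord[OF j x(1)] emb_M[OF j] emb_M[OF k] j k x(2) by metis
qed

section \<open>Stationary sets and domination\<close>

text \<open>Stationarity phrased by closure points of functions in place of closed unbounded sets.
  Class functions \<open>b\<close> are quantified, so \<open>stat\<close> itself never enters a
  comprehension.\<close>

definition "stat th Q \<longleftrightarrow> (\<forall>b. cf b \<longrightarrow> (\<forall>r. E r th \<longrightarrow> E (b r) th) \<longrightarrow>
  (\<exists>i. E i Q \<and> (\<forall>r. E r i \<longrightarrow> E (b r) i)))"

text \<open>If each value \<open>w\<close> occurred only boundedly often, the least bounds would be
  a family indexed by \<open>G\<close> and would have a common bound below
  \<open>H G\<close>.\<close>

lemma pigeonhole: assumes G: "closed G" and n: "cf n" "\<And>z. E z (H G) \<Longrightarrow> P z \<Longrightarrow> E (n z) G"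
  and P: "dfn (\<lambda>s. P (s 0))" "\<And>z. E z (H G) \<Longrightarrow> \<exists>y. E y (H G) \<and> E z y \<and> P y"
  shows "\<exists>w. E w G \<and> (\<forall>z. E z (H G) \<longrightarrow> (\<exists>y. E y (H G) \<and> E z y \<and> P y \<and> n y = w))"
proof (rule ccontr)
  assume neg: "\<not> ?thesis"
  define Bd where "Bd w z \<longleftrightarrow> E z (H G) \<and> (\<forall>y. E y (H G) \<longrightarrow> E z y \<longrightarrow> P y \<longrightarrow> n y \<noteq> w)" for w z
  have dBd: "dfn (\<lambda>s. Bd w (s 0))" for w
    unfolding Bd_def by (intro dfi dfn_rel1[OF P(1)] cfD[OF n(1)])
  have ex: "\<exists>z. Bd w z" if "E w G" for w
    using neg that unfolding Bd_def by blast
  have l: "Bd w (lst (Bd w))" if w: "E w G" for w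
  proof -
    obtain z where "Bd w z" using ex[OF w] by blast
    moreover from this have "Ord z" unfolding Bd_def by (simp add: mem_H)
    ultimately show ?thesis using lst(2)[OF dBd] by blast
  qed
  have "cf (\<lambda>w. lst (Bd w))"
    unfolding Bd_def by (intro dfi dfn_rel1[OF P(1)] cfD[OF n(1)])
  from H_bounded[OF G this] l obtain b where b: "E b (H G)" "\<And>w. E w G \<Longrightarrow> E (lst (Bd w)) b"
    unfolding Bd_def by blast
  obtain y where y: "E y (H G)" "E b y" "P y" using P(2)[OF b(1)] by blast
  have w: "E (n y) G" by (rule n(2)[OF y(1,3)])
  have "Ord y" using y(1) by (simp add: mem_H)
  then have "E (lst (Bd (n y))) y" using Ord_trans[OF b(2)[OF w] y(2)] by blast
  then show False using l[OF w] y unfolding Bd_def by blast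
qed

text \<open>A weak form: \<open>r\<close> is merely bounded, on an unbounded set. Otherwise every
  \<open>p\<close> has a point beyond which \<open>r\<close> exceeds \<open>p\<close>; at a closure
  point \<open>i\<close> of these choices, \<open>p = r i\<close> gives a contradiction.\<close>

lemma weak_Fodor: assumes th: "Ord th" and Q: "stat th Q" "\<And>i. E i Q \<Longrightarrow> E i th \<and> Lim i" and r: "cf r"
  and i0: "E i0 th" and reg: "\<And>i. E i Q \<Longrightarrow> E i0 i \<Longrightarrow> E (r i) i"
  shows "\<exists>p. E p th \<and> (\<forall>y. E y th \<longrightarrow> (\<exists>i. E i Q \<and> E y i \<and> E i0 i \<and> E (r i) (succ p)))"
proof (rule ccontr)
  assume neg: "\<not> ?thesis"
  define Bd where "Bd p y \<longleftrightarrow> E y th \<and> (\<forall>i. E i Q \<longrightarrow> E y i \<longrightarrow> E i0 i \<longrightarrow> \<not> E (r i) (succ p))" for p y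
  have dBd: "dfn (\<lambda>s. Bd p (s 0))" for p
    unfolding Bd_def by (intro dfi cfD[OF r])
  have l: "Bd p (lst (Bd p))" if p: "E p th" for p
  proof -
    obtain z where "Bd p z" using neg p unfolding Bd_def by blast
    moreover from this have "Ord z" using th Ord_mem unfolding Bd_def by blast
    ultimately show ?thesis using lst(2)[OF dBd] by blast
  qed
  \<comment> \<open>Joining \<open>i0\<close> forces the closure point above
    \<open>i0\<close>.\<close>
  define b where "b p = cup (lst (Bd p)) i0" for p
  have "cf b" unfolding b_def Bd_def by (intro dfi cfD[OF r])
  moreover have lth: "E (lst (Bd p)) th" if "E p th" for p using l[OF that] unfolding Bd_def by blast
  then have "E (b p) th" if "E p th" for p
    unfolding b_def using cup_mem[OF _ i0 th] that by blast
  ultimately obtain i where i: "E i Q" "\<And>p. E p i \<Longrightarrow> E (b p) i"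
    using Q(1) unfolding stat_def by blast
  have oi: "Ord i" "E emp i" "E i th" using Q(2)[OF i(1)] LimD by blast+
  have bb: "E (lst (Bd p)) (succ (b p))" "E i0 (succ (b p))" if "E p th" for p
    unfolding b_def using le_cup Ord_mem[OF lth[OF that] th] Ord_mem[OF i0 th] by blast+
  have ti: "E p th" if "E p i" for p using that oi(3) th Ord_trans by blast
  have "E i0 i" using Ord_le_trans[OF bb(2) i(2) oi(1)] ti oi(2) by blast
  moreover from this have ri: "E (r i) i" using reg i(1) by blast
  moreover have "E (lst (Bd (r i))) i" using Ord_le_trans[OF bb(1) i(2) oi(1)] ti ri by blast
  moreover have "E (r i) (succ (r i))" by simp
  ultimately show False using l[OF ti[OF ri]] i(1) unfolding Bd_def by blast
qed

text \<open>\<open>F z\<close> takes at \<open>i\<close> the strict supremum of those \<open>F y\<close>, \<open>y \<in> z\<close>, that a fixed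
  surjection of \<open>W\<close> to \<open>z\<close> enumerates already on \<open>V\<^sup>B\<^sub>i\<close>; each \<open>y\<close> is counted from some \<open>i\<close> on.\<close>

lemma scale: fixes th Q B
  defines "W \<equiv> Vh B th" and "T \<equiv> \<lambda>i. H (Vh B i)"
  assumes th: "Lim th" and Q: "\<And>i. E i Q \<Longrightarrow> E i th \<and> Lim i"
  shows "\<exists>F. cf F \<and> (\<forall>z i. E z (H W) \<longrightarrow> E i Q \<longrightarrow> E (app (F z) i) (T i)) \<and>
    (\<forall>z y. E z (H W) \<longrightarrow> E y z \<longrightarrow>
      (\<exists>i0. E i0 th \<and> (\<forall>i. E i Q \<longrightarrow> E i0 i \<longrightarrow> E (app (F y) i) (app (F z) i))))"
proof -
  obtain g where g0: "cf g" and g: "\<And>b. E b (H W) \<Longrightarrow> img (g b) W b"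
    using H_choice by blast
  \<comment> \<open>If \<open>u\<close> codes \<open>y\<close> via the surjection
    \<open>g z\<close>, it contributes the successor of the value of \<open>F y\<close> at
    \<open>i\<close>, where \<open>r\<close> holds the earlier functions. Elements that code nothing
    contribute \<open>emp\<close>.\<close>
  define k where "k z r i u = st {x. \<exists>y. (E y z \<and> E (pr u y) (g z)) \<and> E x (succ (app (app r y) i))}" for z r i u
  define F where "F = rec (\<lambda>z r. lam Q (\<lambda>i. bigun (Vh B i) (k z r i)))"
  have cPhi: "cf2 (\<lambda>z r. lam Q (\<lambda>i. bigun (Vh B i) (k z r i)))"
    unfolding k_def by (intro dfi cfD[OF g0])
  have cF: "cf F" unfolding F_def by (rule cf_rec[OF cPhi])
  have ck: "cf (k z r i)" for z r i unfolding k_def by (intro dfi cfD[OF g0])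
  have ck2: "cf (\<lambda>i. bigun (Vh B i) (k z r i))" for z r
    unfolding k_def by (intro dfi cfD[OF g0])
  have eq: "app (F z) i = bigun (Vh B i) (k z (lam z F) i)" if "Ord z" "E i Q" for z i
    using rec_eq[OF cPhi that(1), folded F_def] app_lam[OF ck2 that(2)] by simp
  have k1: "k z (lam z F) i u = succ (app (F y) i)"
    if "E z (H W)" "E u W" "E y z" "E (pr u y) (g z)" for z i u y
  proof -
    have u: "y' = y" if "E y' z" "E (pr u y') (g z)" for y'
      using g[OF \<open>E z (H W)\<close>] \<open>E u W\<close> \<open>E y z\<close> \<open>E (pr u y) (g z)\<close> that unfolding img_def by blast
    have "(\<exists>y'. (E y' z \<and> E (pr u y') (g z)) \<and> E x (succ (app (app (lam z F) y') i))) \<longleftrightarrow>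
        E x (succ (app (F y) i))" for x
      unfolding app_lam[OF cF that(3), symmetric] using u that(3,4) by blast
    then show ?thesis
      unfolding k_def by (intro st_eq) blast
  qed
  have k2: "k z r i u = emp" if "\<not> (\<exists>y. E y z \<and> E (pr u y) (g z))" for z r i u
    unfolding k_def using that by (intro st_eq) auto
  have GW: "E u W" if "E u (Vh B i)" "E i th" for u i
    unfolding W_def using that LimD(1)[OF th] by (auto intro: Vh_mono)
  have FT: "\<forall>i. E z (H W) \<longrightarrow> E i Q \<longrightarrow> E (app (F z) i) (T i)" if z: "Ord z" for z
  proof (rule Ord_induct[of "\<lambda>z. \<forall>i. E z (H W) \<longrightarrow> E i Q \<longrightarrow> E (app (F z) i) (T i)", OF _ z])
    show "dfn (\<lambda>s. \<forall>i. E (s 0) (H W) \<longrightarrow> E i Q \<longrightarrow> E (app (F (s 0)) i) (T i))"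
      unfolding T_def by (intro dfi cfD[OF cF])
    fix z assume oz: "Ord z" and IH: "\<And>y. E y z \<Longrightarrow> \<forall>i. E y (H W) \<longrightarrow> E i Q \<longrightarrow> E (app (F y) i) (T i)"
    show "\<forall>i. E z (H W) \<longrightarrow> E i Q \<longrightarrow> E (app (F z) i) (T i)"
    proof (intro allI impI)
      fix i assume z: "E z (H W)" and i: "E i Q"
      have i': "E i th" "Lim i" using Q[OF i] by auto
      note cl = Vh_closed[OF i'(2), of B]
      have kT: "E (k z (lam z F) i u) (T i)" if u: "E u (Vh B i)" for u
      proof (cases "\<exists>y. E y z \<and> E (pr u y) (g z)")
        case True
        then obtain y where y: "E y z" "E (pr u y) (g z)" by blast
        have "E (app (F y) i) (T i)" using IH[OF y(1)] i Ord_trans[OF y(1) z] by simp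
        then show ?thesis
          using k1[OF z GW[OF u i'(1)] y] LimD(3)[OF H_Lim[OF cl]] unfolding T_def by simp
      next
        case False
        then show ?thesis using k2 LimD(2)[OF H_Lim[OF cl]] unfolding T_def by simp
      qed
      \<comment> \<open>Only members of \<open>Vh B i\<close> contribute at \<open>i\<close>, so
        \<open>H_bounded\<close> keeps the supremum below \<open>T i\<close>.\<close>
      then obtain b where b: "E b (T i)" "\<And>u. E u (Vh B i) \<Longrightarrow> E (k z (lam z F) i u) b"
        using H_bounded[OF cl ck] unfolding T_def by blast
      have ob: "Ord b" using b(1) unfolding T_def by (simp add: mem_H)
      have "E (bigun (Vh B i) (k z (lam z F) i)) (succ b)"
      proof (rule Ord_leI[OF _ ob])
        show "Ord (bigun (Vh B i) (k z (lam z F) i))"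
          using b(2) ob Ord_mem by (intro Ord_bigun ck) blast
        show "E x (bigun (Vh B i) (k z (lam z F) i)) \<Longrightarrow> E x b" for x
          using b(2) Ord_trans[OF _ _ ob] by (auto simp: ck)
      qed
      then have "E (bigun (Vh B i) (k z (lam z F) i)) (T i)"
        using b(1) unfolding T_def by (rule Ord_le_trans) simp
      then show "E (app (F z) i) (T i)" using eq[OF oz i] by simp
    qed
  qed
  have inc: "\<exists>i0. E i0 th \<and> (\<forall>i. E i Q \<longrightarrow> E i0 i \<longrightarrow> E (app (F y) i) (app (F z) i))"
    if z: "E z (H W)" and y: "E y z" for z y
  proof -
    obtain u where u: "E u W" "E (pr u y) (g z)" using g[OF z] y unfolding img_def by blast
    obtain i0 where i0: "E i0 th" "E u (Vh B i0)" using Vh_Lim[OF th] u(1) unfolding W_def by blast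
    have "E (app (F y) i) (app (F z) i)" if i: "E i Q" "E i0 i" for i
    proof -
      have "Ord i" using Q[OF i(1)] LimD(1) by blast
      then have "E u (Vh B i)" using i0(2) i(2) by (auto intro: Vh_mono)
      moreover have "E (app (F y) i) (k z (lam z F) i u)" using k1[OF z u(1) y u(2)] by simp
      ultimately show ?thesis using eq[OF _ i(1), of z] z by (auto simp: ck mem_H)
    qed
    with i0(1) show ?thesis by blast
  qed
  show ?thesis
    using cF FT inc by (intro exI[of _ F]) (auto simp: mem_H)
qed

definition "below Q F h z = st {i. E i Q \<and> E (app (F z) i) (succ (h i))}"

lemma mem_below: assumes "cf F" "cf h" shows "E i (below Q F h z) \<longleftrightarrow> E i Q \<and> E (app (F z) i) (succ (h i))"
  unfolding below_def by (rule mem_sep) (intro dfi cfD[OF assms(1)] cfD[OF assms(2)])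

lemma cf_below: assumes "cf F" "cf h" shows "cf (below Q F h)"
  unfolding below_def by (intro dfi cfD[OF assms(1)] cfD[OF assms(2)])

text \<open>Call \<open>N \<subseteq> Q\<close> capped if one function bounds all \<open>F z\<close> on \<open>N\<close> up to a bounded set. There are few
  enough \<open>N\<close> for \<open>hs\<close> to bound the chosen caps of all of them simultaneously. The set where \<open>F z\<close> stays below
  a given \<open>h\<close> is eventually capped, hence almost contained in the set \<open>N\<close> that belongs to \<open>hs\<close>.\<close>

lemma domination: fixes th Q B F
  defines "B \<equiv> pow th"
  defines "W \<equiv> Vh B th" and "T \<equiv> \<lambda>i. H (Vh B i)"
  assumes th: "Lim th" and Q: "\<And>i. E i Q \<Longrightarrow> E i th \<and> Lim i"
  and F: "cf F" and FT: "\<And>z i. E z (H W) \<Longrightarrow> E i Q \<Longrightarrow> E (app (F z) i) (T i)"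
  and inc: "\<And>z y. E z (H W) \<Longrightarrow> E y z \<Longrightarrow>
      \<exists>i0. E i0 th \<and> (\<forall>i. E i Q \<longrightarrow> E i0 i \<longrightarrow> E (app (F y) i) (app (F z) i))"
  shows "\<exists>hs N. cf hs \<and> (\<forall>i. E i Q \<longrightarrow> E (hs i) (T i)) \<and>
    (\<forall>z. E z (H W) \<longrightarrow> (\<exists>y. E y (H W) \<and> E z y \<and> below Q F hs y = N)) \<and>
    (\<forall>h. cf h \<longrightarrow> (\<forall>i. E i Q \<longrightarrow> E (h i) (T i)) \<longrightarrow> (\<exists>z. E z (H W) \<and>
      (\<forall>y. E y (H W) \<longrightarrow> E z (succ y) \<longrightarrow> (\<exists>i0. E i0 th \<and>
        (\<forall>i. E i Q \<longrightarrow> \<not> E i N \<longrightarrow> E i0 i \<longrightarrow> E (h i) (app (F y) i))))))"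
proof -
  let ?D = "H W"
  have oth: "Ord th" by (rule LimD(1)[OF th])
  have clW: "closed W" unfolding W_def by (rule Vh_closed[OF th])
  have LD: "Lim ?D" by (rule H_Lim[OF clW])
  have oD: "Ord z" if "E z ?D" for z using that by (simp add: mem_H)
  have oT: "Ord x" if "E x (T i)" for x i using that unfolding T_def by (simp add: mem_H)
  have BW: "E N W" if "\<And>x. E x N \<Longrightarrow> E x Q" for N
    unfolding W_def B_def using that Q by (intro Vh_B[OF oth]) simp
  \<comment> \<open>Starting the hierarchy at \<open>pow th\<close> puts every subset of
    \<open>Q\<close> into each \<open>Vh B i\<close> with \<open>i\<close> in \<open>Q\<close>, so
    that \<open>hs i\<close> can bound the caps of all subsets at once.\<close>
  have BG: "E N (Vh B i)" if "\<forall>x. E x N \<longrightarrow> E x Q" "E i Q" for N i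
    unfolding B_def using that(1) Q Q[OF that(2)] LimD(1)[of i] by (intro Vh_B) simp_all
  have TD: "E x ?D" if "E i Q" "E x (T i)" for i x
    using that(2) H_Vh_mono[OF _ th, of i B] Q[OF that(1)] Ord_trans[OF _ _ Ord_H] unfolding T_def W_def by blast
  have cT: "cf T" unfolding T_def by (intro dfi)
  \<comment> \<open>The relation of capping: \<open>h\<close> is a cap of \<open>N\<close>.\<close>
  define D where "D N h \<longleftrightarrow> (\<forall>i. E i Q \<longrightarrow> E (app h i) (T i)) \<and> (\<forall>z. E z ?D \<longrightarrow>
    (\<exists>i0. E i0 th \<and> (\<forall>i. E i Q \<longrightarrow> E i N \<longrightarrow> E i0 i \<longrightarrow> E (app (F z) i) (succ (app h i)))))" for N h
  \<comment> \<open>The implication makes every \<open>N\<close> a legitimate argument of bounded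
    choice, and restricting a cap to \<open>Q\<close> confines it to a set.\<close>
  have exD: "\<exists>h. E h (pow (cart Q ?D)) \<and> ((\<exists>h. D N h) \<longrightarrow> D N h)" for N
  proof (cases "\<exists>h. D N h")
    case True
    then obtain h where h: "D N h" by blast
    let ?h = "lam Q (app h)"
    have "app ?h i = app h i" if "E i Q" for i using that by (simp add: cf_app)
    then have "D N ?h" using h unfolding D_def by simp
    moreover have "E ?h (pow (cart Q ?D))"
      using h TD unfolding D_def by (auto simp: mem_lam cf_app)
    ultimately show ?thesis by blast
  qed (auto intro: exI[of _ emp])
  have dD2: "dfn (\<lambda>s. (\<exists>h. D (s 0) h) \<longrightarrow> D (s 0) (s 1))"
    unfolding D_def by (intro dfi cfD[OF F] cfD[OF cT])
  obtain Hc where Hc0: "cf Hc" and Hc1: "\<And>N. E N B \<Longrightarrow> (\<exists>h. D N h) \<longrightarrow> D N (Hc N)"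
    by (rule bounded_choice[of "\<lambda>N h. (\<exists>h. D N h) \<longrightarrow> D N h" B, OF dD2 exD]) (rule that; assumption)
  have Hc: "D N (Hc N)" if "E N B" "\<exists>h. D N h" for N
    using Hc1 that by blast
  define k where "k i N = st {x. (E N B \<and> (\<exists>h. D N h)) \<and> E x (app (Hc N) i)}" for i N
  have k1: "k i N = app (Hc N) i" if "E N B" "\<exists>h. D N h" for i N
    unfolding k_def using that by (intro st_eq) blast
  have k2: "k i N = emp" if "\<not> (E N B \<and> (\<exists>h. D N h))" for i N
    unfolding k_def using that by (intro st_eq) auto
  have ck: "cf (k i)" for i unfolding k_def D_def by (intro dfi cfD[OF F] cfD[OF cT] cfD[OF Hc0])
  define Bd where "Bd i b \<longleftrightarrow> E b (T i) \<and> (\<forall>N. E N (Vh B i) \<longrightarrow> E (k i N) b)" for i b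
  have dBd: "dfn (\<lambda>s. Bd i (s 0))" for i unfolding Bd_def by (intro dfi cfD[OF cT] cfD[OF ck])
  have l: "Bd i (lst (Bd i))" if i: "E i Q" for i
  proof -
    note cl = Vh_closed[OF conjunct2[OF Q[OF i]], of B]
    have "E (k i N) (H (Vh B i))" for N
    proof (cases "E N B \<and> (\<exists>h. D N h)")
      case True
      then show ?thesis using k1 Hc[of N] i unfolding D_def T_def by simp
    next
      case False
      then show ?thesis using k2 LimD(2)[OF H_Lim[OF cl]] by simp
    qed
    from H_bounded[OF cl ck this] obtain b where "Bd i b" unfolding Bd_def T_def by blast
    moreover from this have "Ord b" using oT unfolding Bd_def by blast
    ultimately show ?thesis using lst(2)[OF dBd] by blast
  qed
  define hs where "hs i = lst (Bd i)" for i
  have chs: "cf hs" unfolding hs_def Bd_def k_def D_def by (intro dfi cfD[OF F] cfD[OF cT] cfD[OF Hc0])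
  have hsT: "E (hs i) (T i)" if "E i Q" for i using l[OF that] unfolding hs_def Bd_def by blast
  have hsb: "E (app (Hc N) i) (hs i)" if "E i Q" "\<forall>x. E x N \<longrightarrow> E x Q" "\<exists>h. D N h" for i N
  proof -
    have "E N B" using that(2) Q unfolding B_def by simp
    then show ?thesis using l[OF that(1)] BG[OF that(2,1)] k1[OF _ that(3), of i] unfolding hs_def Bd_def by metis
  qed
  have PH: "\<exists>w. E w W \<and> (\<forall>z. E z ?D \<longrightarrow> (\<exists>y. E y ?D \<and> E z y \<and> below Q F h y = w))" if h: "cf h" for h
  proof -
    have 1: "E (below Q F h z) W" for z
      by (rule BW) (simp only: mem_below[OF F h])
    have 2: "\<exists>y. E y ?D \<and> E z y" if "E z ?D" for z
      using LimD(3)[OF LD that] by (intro exI[of _ "succ z"]) simp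
    show ?thesis
      using pigeonhole[OF clW cf_below[OF F h], of "\<lambda>_. True" Q] 1 2 by (simp add: dfn_const)
  qed
  \<comment> \<open>By pigeonhole a single subset \<open>N\<close> of \<open>Q\<close> is the place
    where \<open>F y\<close> stays below \<open>hs\<close>, for unboundedly many
    \<open>y\<close>.\<close>
  obtain N where N: "\<And>z. E z ?D \<Longrightarrow> \<exists>y. E y ?D \<and> E z y \<and> below Q F hs y = N"
    using PH[OF chs] by blast
  have "\<exists>z. E z ?D \<and> (\<forall>y. E y ?D \<longrightarrow> E z (succ y) \<longrightarrow> (\<exists>i0. E i0 th \<and>
        (\<forall>i. E i Q \<longrightarrow> \<not> E i N \<longrightarrow> E i0 i \<longrightarrow> E (h i) (app (F y) i))))"
    if h: "cf h" and hT: "\<And>i. E i Q \<Longrightarrow> E (h i) (T i)" for h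
  proof -
    obtain N' where N': "\<And>z. E z ?D \<Longrightarrow> \<exists>y. E y ?D \<and> E z y \<and> below Q F h y = N'"
      using PH[OF h] by blast
    obtain z where z: "E z ?D" "below Q F h z = N'" using N'[OF LimD(2)[OF LD]] by blast
      have N'Q: "\<forall>x. E x N' \<longrightarrow> E x Q" using z(2) mem_below[OF F h] by blast
    \<comment> \<open>\<open>h\<close> itself caps \<open>N'\<close>: beyond any \<open>x\<close>
      there is a \<open>y\<close> such that \<open>F y\<close> is at most \<open>h\<close> exactly
      on \<open>N'\<close>, and \<open>F x\<close> is eventually below \<open>F y\<close>.\<close>
    have "D N' (lam Q h)"
      unfolding D_def
    proof (intro conjI allI impI)
      show "E (app (lam Q h) i) (T i)" if "E i Q" for i using hT that by (simp add: h)
      fix x assume x: "E x ?D"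
      obtain y where y: "E y ?D" "E x y" "below Q F h y = N'" using N'[OF x] by blast
      obtain i0 where i0: "E i0 th" "\<And>i. E i Q \<Longrightarrow> E i0 i \<Longrightarrow> E (app (F x) i) (app (F y) i)"
        using inc[OF y(1,2)] by blast
      have "E (app (F x) i) (succ (app (lam Q h) i))" if i: "E i Q" "E i N'" "E i0 i" for i
      proof -
        have "E (app (F y) i) (succ (h i))" using i(2) y(3) mem_below[OF F h] by blast
        then have "E (app (F x) i) (h i)"
          using Ord_leD[OF _ oT[OF hT[OF i(1)]] i0(2)[OF i(1,3)]] by blast
        then show ?thesis using i(1) by (simp add: h)
      qed
      with i0(1) show "\<exists>i0. E i0 th \<and> (\<forall>i. E i Q \<longrightarrow> E i N' \<longrightarrow> E i0 i \<longrightarrow> E (app (F x) i) (succ (app (lam Q h) i)))"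
        by blast
    qed
    then have ok: "\<exists>h. D N' h" by blast
    have N'B: "E N' B" using N'Q Q unfolding B_def by simp
    note DHc = Hc[OF N'B ok]
    obtain x where x: "E x ?D" "below Q F hs x = N" using N[OF LimD(2)[OF LD]] by blast
    obtain i1 where i1: "E i1 th" "\<And>i. E i Q \<Longrightarrow> E i N' \<Longrightarrow> E i1 i \<Longrightarrow> E (app (F x) i) (succ (app (Hc N') i))"
      using DHc x(1) unfolding D_def by blast
    \<comment> \<open>On \<open>N'\<close> the function \<open>F x\<close> is eventually at most the
      chosen cap, which is below \<open>hs\<close>; by the choice of \<open>x\<close> such points
      belong to \<open>N\<close>.\<close>
    have N'N: "E i N" if i: "E i N'" "E i1 i" for i
    proof -
      have iQ: "E i Q" using N'Q i(1) by blast
      have "E (app (F x) i) (hs i)"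
        by (rule Ord_le_trans[OF i1(2)[OF iQ i] hsb[OF iQ N'Q ok] oT[OF hsT[OF iQ]]])
      then show ?thesis using iQ x(2) mem_below[OF F chs, of i Q x] by simp
    qed
    have "\<exists>i0. E i0 th \<and> (\<forall>i. E i Q \<longrightarrow> \<not> E i N \<longrightarrow> E i0 i \<longrightarrow> E (h i) (app (F y) i))"
      if y: "E y ?D" "E z (succ y)" for y
    proof -
      obtain i2 where i2: "E i2 th" "\<And>i. E i Q \<Longrightarrow> E i2 i \<Longrightarrow> E (app (F z) i) (succ (app (F y) i))"
      proof (cases "z = y")
        case True
        then show thesis using that[of emp] LimD(2)[OF th] by simp
      next
        case False
        then have "E z y" using y(2) by simp
        from inc[OF y(1) this] that show thesis by auto
      qed
      have "E (h i) (app (F y) i)" if i: "E i Q" "\<not> E i N" "E (cup i1 i2) i" for i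
      proof -
        have oi: "Ord i" using Q[OF i(1)] LimD(1) by blast
        have o: "Ord i1" "Ord i2" using i1(1) i2(1) oth Ord_mem by blast+
        have c: "E i1 i" "E i2 i"
          using Ord_le_trans[OF le_cup(1)[OF o] i(3) oi] Ord_le_trans[OF le_cup(2)[OF o] i(3) oi] by auto
        have "\<not> E i N'" using N'N i(2) c(1) by blast
        then have "\<not> E (app (F z) i) (succ (h i))" using z(2) i(1) mem_below[OF F h] by blast
        then have "E (h i) (app (F z) i)"
          using Ord_not_mem[OF oT[OF hT[OF i(1)]] oT[OF FT[OF z(1) i(1)]]] by blast
        then show ?thesis
          using Ord_leD[OF i2(2)[OF i(1) c(2)] oT[OF FT[OF y(1) i(1)]]] by blast
      qed
      then show ?thesis using cup_mem[OF i1(1) i2(1) oth] by blast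
    qed
    with z(1) show ?thesis by blast
  qed
  with chs hsT N show ?thesis by blast
qed

lemma dfn_cofmap: "dft T \<Longrightarrow> dft U \<Longrightarrow> dft V \<Longrightarrow> dfn (\<lambda>s. cofmap (T s) (U s) (V s))"
  by (rule dfn_rel3[of cofmap]) (unfold cofmap_def, intro dfi)

text \<open>Otherwise \<open>F z\<close> is almost below \<open>hs\<close> for unboundedly many \<open>z\<close>. Injecting \<open>hs i + 1\<close> into
  \<open>V\<^sup>B\<^sub>i\<close> makes such \<open>F z\<close> regressive, so by Fodor an unbounded part of it is coded by an element of \<open>W\<close>;
  two of these codes coincide, although the \<open>F z\<close> increase modulo bounded sets.\<close>

lemma unbounded_complement: fixes th Q B F
  defines "B \<equiv> pow th"
  defines "W \<equiv> Vh B th" and "T \<equiv> \<lambda>i. H (Vh B i)"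
  assumes th: "Lim th" and st: "stat th Q" and Q: "\<And>i. E i Q \<Longrightarrow> E i th \<and> Lim i"
  and F: "cf F" and inc: "\<And>z y. E z (H W) \<Longrightarrow> E y z \<Longrightarrow>
      \<exists>i0. E i0 th \<and> (\<forall>i. E i Q \<longrightarrow> E i0 i \<longrightarrow> E (app (F y) i) (app (F z) i))"
  and hs: "cf hs" "\<And>i. E i Q \<Longrightarrow> E (hs i) (T i)"
  and N: "\<And>z. E z (H W) \<Longrightarrow> \<exists>y. E y (H W) \<and> E z y \<and> below Q F hs y = N"
  and i0: "E i0 th"
  shows "\<exists>i. E i Q \<and> \<not> E i N \<and> E i0 i"
proof (rule ccontr)
  assume "\<not> ?thesis"
  then have QN: "E i N" if "E i Q" "E i0 i" for i using that by blast
  let ?D = "H W"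
  have oth: "Ord th" by (rule LimD(1)[OF th])
  have clW: "closed W" unfolding W_def by (rule Vh_closed[OF th])
  have GW: "E u W" if "E u (Vh B i)" "E i Q" for u i
    unfolding W_def by (rule Vh_mono[OF oth _ that(1)]) (use Q[OF that(2)] in simp)
  have hsT: "E (succ (hs i)) (T i)" if "E i Q" for i
    using hs(2)[OF that] LimD(3)[OF H_Lim[OF Vh_closed]] Q[OF that] unfolding T_def by blast
  have TD: "E x ?D" if "E i Q" "E x (T i)" for i x
    using that(2) H_Vh_mono[OF _ th, of i B] Q[OF that(1)] Ord_trans[OF _ _ Ord_H] unfolding T_def W_def by blast
  have exP: "\<exists>g. E g (pow (cart W ?D)) \<and> img g (Vh B i) (succ (hs i))" if i: "E i Q" for i
  proof -
    have "onto (Vh B i) (succ (hs i))" using hsT[OF i] unfolding T_def by (simp add: mem_H)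
    then obtain g where g: "E g (pow (cart (Vh B i) (succ (hs i))))" "img g (Vh B i) (succ (hs i))"
      using onto_cartI by blast
    have "E w (cart W ?D)" if w: "E w g" for w
    proof -
      have "E w (cart (Vh B i) (succ (hs i)))" using g(1) w by simp
      from mem_cartE[OF this] obtain u x where "E u (Vh B i)" "E x (succ (hs i))" "w = pr u x" by blast
      then show ?thesis
        using GW[OF _ i] Ord_trans[OF _ TD[OF i hsT[OF i]] Ord_H] by simp
    qed
    with g(2) show ?thesis by auto
  qed
  have dP: "dfn (\<lambda>s. img (s 1) (Vh B (s 0)) (succ (hs (s 0))))" by (intro dfi cfD[OF hs(1)])
  obtain P where P0: "cf P" and P: "\<And>i. E i Q \<Longrightarrow> img (P i) (Vh B i) (succ (hs i))"
    by (rule bounded_choice[of "\<lambda>i g. img g (Vh B i) (succ (hs i))" Q, OF dP exP], assumption) (rule that; assumption)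
  \<comment> \<open>Outside the pairs of interest \<open>R\<close> holds vacuously, so that bounded
    choice applies on the whole product.\<close>
  define R where "R x u \<longleftrightarrow> (\<forall>i b. x = pr i b \<longrightarrow> E i Q \<longrightarrow> E b (succ (hs i)) \<longrightarrow>
      E u (Vh B i) \<and> E (pr u b) (P i))" for x u
  have dR: "dfn (\<lambda>s. R (s 0) (s 1))" unfolding R_def by (intro dfi cfD[OF hs(1)] cfD[OF P0])
  have exR: "\<exists>u. E u W \<and> R x u" for x
  proof (cases "\<exists>i b. x = pr i b \<and> E i Q \<and> E b (succ (hs i))")
    case True
    then obtain i b where x: "x = pr i b" "E i Q" "E b (succ (hs i))" by blast
    then obtain u where "E u (Vh B i)" "E (pr u b) (P i)" using P[OF x(2)] unfolding img_def by blast
    then show ?thesis using GW[OF _ x(2)] x(1) unfolding R_def by auto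
  next
    case False
    then show ?thesis using clW unfolding R_def closed_def by blast
  qed
  obtain q where q0: "cf q" and q1: "\<And>x. E x (cart Q ?D) \<Longrightarrow> R x (q x)"
    by (rule bounded_choice[of R "cart Q ?D", OF dR exR]) (rule that; assumption)
  have q: "E (q (pr i b)) (Vh B i)" "E (pr (q (pr i b)) b) (P i)" if "E i Q" "E b (succ (hs i))" for i b
  proof -
    have "E b ?D" using Ord_trans[OF that(2) TD[OF that(1) hsT[OF that(1)]] Ord_H] .
    with q1[of "pr i b"] that show "E (q (pr i b)) (Vh B i)" "E (pr (q (pr i b)) b) (P i)"
      unfolding R_def by auto
  qed
  have q_inj: "b = c" if "E i Q" "E b (succ (hs i))" "E c (succ (hs i))" "q (pr i b) = q (pr i c)" for i b c
    using P[OF that(1)] q[OF that(1,2)] q[OF that(1,3)] that unfolding img_def by metis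
  \<comment> \<open>The code of the value of \<open>F z\<close> at \<open>i\<close>, an element of
    \<open>Vh B i\<close> whenever that value is at most \<open>hs i\<close>.\<close>
  define e where "e z i = q (pr i (app (F z) i))" for z i
  have ce: "cf2 e" unfolding e_def by (intro dfi cfD[OF q0] cfD[OF F])
  have ez: "cf (e z)" for z unfolding e_def by (intro dfi cfD[OF q0] cfD[OF F])
  define Ok where "Ok z \<longleftrightarrow> below Q F hs z = N" for z
  have dOk: "dfn (\<lambda>s. Ok (s 0))" unfolding Ok_def by (intro dfi cfD[OF cf_below[OF F hs(1)]])
  have Fle: "E (app (F z) i) (succ (hs i))" if "Ok z" "E i Q" "E i0 i" for z i
    using QN[OF that(2,3)] that(1) mem_below[OF F hs(1)] unfolding Ok_def by blast
  define rho where "rho z p \<longleftrightarrow> E p th \<and> (\<forall>y. E y th \<longrightarrow> (\<exists>i. E i Q \<and> E y i \<and> E i0 i \<and> E (e z i) (Vh B p)))" for z p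
  have drho: "dfn (\<lambda>s. rho z (s 0))" for z unfolding rho_def by (intro dfi cfD[OF ez])
  have exrho: "\<exists>p. rho z p" if z: "Ok z" for z
  proof -
    \<comment> \<open>Since \<open>i\<close> is a limit, the code appears before stage
      \<open>i\<close>; its first stage is a regressive function of \<open>i\<close>.\<close>
    define r where "r i = lst (\<lambda>y. E y i \<and> E (e z i) (Vh B y))" for i
    have cr: "cf r" unfolding r_def by (intro dfi cfD[OF ez])
    have r: "E (r i) i \<and> E (e z i) (Vh B (r i))" if i: "E i Q" "E i0 i" for i
    proof -
      have "E (e z i) (Vh B i)" unfolding e_def by (rule q(1)[OF i(1) Fle[OF z i]])
      then obtain y where y: "E y i" "E (e z i) (Vh B y)" using Vh_Lim Q[OF i(1)] by blast
      have "dfn (\<lambda>s. E (s 0) i \<and> E (e z i) (Vh B (s 0)))" by (intro dfi)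
      from lst(2)[of "\<lambda>y. E y i \<and> E (e z i) (Vh B y)", OF this] y Ord_mem[OF y(1)] LimD(1)[of i] Q[OF i(1)]
      show ?thesis unfolding r_def by blast
    qed
    then obtain p where p: "E p th" "\<And>y. E y th \<Longrightarrow> \<exists>i. E i Q \<and> E y i \<and> E i0 i \<and> E (r i) (succ p)"
      using weak_Fodor[OF oth st Q cr i0] by blast
    have "E (e z i) (Vh B p)" if "E i Q" "E i0 i" "E (r i) (succ p)" for i
      using Vh_mono[OF Ord_mem[OF p(1) oth] that(3)] r[OF that(1,2)] by blast
    with p have "rho z p" unfolding rho_def by blast
    then show ?thesis by blast
  qed
  define rh where "rh z = lst (rho z)" for z
  have rh: "rho z (rh z)" if "Ok z" for z
  proof -
    obtain p where p: "rho z p" using exrho[OF \<open>Ok z\<close>] by blast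
    then have "Ord p" using oth Ord_mem unfolding rho_def by blast
    from lst(2)[OF drho this p] show ?thesis unfolding rh_def .
  qed
  have crh: "cf rh" unfolding rh_def rho_def by (intro dfi cf2D[OF ce])
  \<comment> \<open>The part of \<open>e z\<close> whose codes appear by stage \<open>rh z\<close>.
    This bound on the stages makes it an element of \<open>W\<close>.\<close>
  define t where "t z = st {x. E x (cart Q W) \<and> (\<exists>i. (x = pr i (e z i) \<and> E i0 i) \<and> E (e z i) (Vh B (rh z)))}" for z
  have t: "E x (t z) \<longleftrightarrow> E x (cart Q W) \<and> (\<exists>i. (x = pr i (e z i) \<and> E i0 i) \<and> E (e z i) (Vh B (rh z)))" for x z
    unfolding t_def by (rule mem_sep) (intro dfi cf2D[OF ce])
  have ct: "cf t" unfolding t_def by (intro dfi cf2D[OF ce] cfD[OF crh])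
  have tW: "E (t z) W" if z: "Ok z" for z
  proof -
    have p: "E (rh z) th" using rh[OF z] unfolding rho_def by blast
    have op: "Ord (rh z)" using p oth Ord_mem by blast
    have "E x (Vh B (succ (succ (rh z))))" if x: "E x (t z)" for x
    proof -
      obtain i where i: "x = pr i (e z i)" "E (e z i) (Vh B (rh z))" "E x (cart Q W)"
        using x t by blast
      have "E i Q" using i(1,3) by simp
      then have "E i th" using Q by blast
      then have "E i B" unfolding B_def using Ord_trans[OF _ _ oth] by simp
      then have "E i (Vh B (rh z))" by (rule Vh_B[OF op])
      then show ?thesis unfolding i(1) by (rule Vh_pr[OF op _ i(2)])
    qed
    moreover have "E (succ (succ (rh z))) th" using p LimD(3)[OF th] by blast
    ultimately show ?thesis unfolding W_def using Vh_subset[OF oth] by blast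
  qed
  \<comment> \<open>By pigeonhole two functions \<open>F y\<close> and \<open>F z\<close> share the
    same \<open>t\<close>. It has arguments beyond \<open>i1\<close>, at which the decoded values
    would be equal as well as different.\<close>
  obtain w where w: "\<And>z. E z ?D \<Longrightarrow> \<exists>y. E y ?D \<and> E z y \<and> Ok y \<and> t y = w"
    using pigeonhole[OF clW ct, of Ok] tW dOk N unfolding Ok_def by blast
  obtain y where y: "E y ?D" "Ok y" "t y = w" using w[OF LimD(2)[OF H_Lim[OF clW]]] by blast
  obtain z where z: "E z ?D" "E y z" "Ok z" "t z = w" using w[OF y(1)] by blast
  obtain i1 where i1: "E i1 th" "\<And>i. E i Q \<Longrightarrow> E i1 i \<Longrightarrow> E (app (F y) i) (app (F z) i)"
    using inc[OF z(1,2)] by blast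
  obtain i where i: "E i Q" "E i1 i" "E i0 i" "E (e y i) (Vh B (rh y))"
    using rh[OF y(2)] i1(1) unfolding rho_def by blast
  have "E (e y i) (Vh B i)" unfolding e_def by (rule q(1)[OF i(1) Fle[OF y(2) i(1,3)]])
  then have "E (pr i (e y i)) (t y)" using t i GW by simp
  then have "E (pr i (e y i)) (t z)" using y(3) z(4) by simp
  then have "e y i = e z i" using t by auto
  then have "app (F y) i = app (F z) i"
    unfolding e_def using q_inj[OF i(1) Fle[OF y(2) i(1,3)] Fle[OF z(3) i(1,3)]] by simp
  then show False using i1(2)[OF i(1,2)] by simp
qed

text \<open>Iterating a step \<open>s\<close> that passes \<open>b\<close> gives an increasing
  sequence of length \<open>t\<close>; its supremum is closed under \<open>b\<close> and, by
  regularity of \<open>th\<close>, lies below \<open>th\<close>.\<close>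

lemma stat_cofinality: assumes th: "reg UNIV th" and t: "Lim t" "E t th"
  shows "stat th (st {i. E i th \<and> (Lim i \<and> (\<exists>c. cofmap c t i))})"
  unfolding stat_def
proof (intro allI impI)
  fix b assume b: "cf b" and bth: "\<forall>r. E r th \<longrightarrow> E (b r) th"
  have oth: "Ord th" and Lth: "Lim th" using th LimD(1) unfolding reg_def by blast+
  \<comment> \<open>The union includes the index \<open>x\<close> itself, so that \<open>s x\<close>
    exceeds \<open>b r\<close> for all \<open>r\<close> up to \<open>x\<close>.\<close>
  define s where "s x = succ (cup x (bigun (succ x) b))" for x
  have s: "cf s" unfolding s_def by (intro dfi cfD[OF b])
  have cPhi: "cf2 (\<lambda>x r. bigun x (\<lambda>y. s (app r y)))" by (intro dfi cfD[OF s])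
  define F where "F = rec (\<lambda>x r. bigun x (\<lambda>y. s (app r y)))"
  have cF: "cf F" unfolding F_def by (rule cf_rec[OF cPhi])
  have csF: "cf (\<lambda>y. s (F y))" by (intro dfi cfD[OF s] cfD[OF cF])
  have F: "F x = bigun x (\<lambda>y. s (F y))" if "Ord x" for x
    using rec_eq[OF cPhi that, folded F_def] bigun_cong[of x "\<lambda>y. s (app (lam x F) y)" "\<lambda>y. s (F y)"]
    by (simp add: cF)
  have sup: "E (bigun a f) th" if a: "E a th" and f: "cf f" "\<And>y. E y a \<Longrightarrow> E (f y) th" for a f
  proof -
    obtain c where c: "E c th" "\<And>y. E y a \<Longrightarrow> E (f y) c" using reg_bounded[OF th a f] by blast
    have oc: "Ord c" using c(1) oth Ord_mem by blast
    have "E (bigun a f) (succ c)"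
    proof (rule Ord_leI[OF _ oc])
      show "Ord (bigun a f)" using c(2) oc Ord_mem by (intro Ord_bigun f(1)) blast
      show "E x (bigun a f) \<Longrightarrow> E x c" for x using c(2) Ord_trans[OF _ _ oc] by (auto simp: f(1))
    qed
    then show ?thesis using c(1) oth by (rule Ord_le_trans)
  qed
  have sth: "E (s x) th" if x: "E x th" for x
  proof -
    have "E (succ x) th" by (rule LimD(3)[OF Lth x])
    then have "E (bigun (succ x) b) th" using bth Ord_trans[OF _ _ oth] by (intro sup b) blast+
    then show ?thesis unfolding s_def by (intro LimD(3)[OF Lth] cup_mem x oth)
  qed
  have Fth: "E x th \<longrightarrow> E (F x) th" if "Ord x" for x
  proof (rule Ord_induct[of "\<lambda>x. E x th \<longrightarrow> E (F x) th", OF _ that])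
    show "dfn (\<lambda>s. E (s 0) th \<longrightarrow> E (F (s 0)) th)" by (intro dfi cfD[OF cF])
    fix x assume ox: "Ord x" and IH: "\<And>y. E y x \<Longrightarrow> E y th \<longrightarrow> E (F y) th"
    show "E x th \<longrightarrow> E (F x) th"
      unfolding F[OF ox] using IH sth Ord_trans[OF _ _ oth] by (blast intro: sup[OF _ csF])
  qed
  have ot: "Ord t" by (rule LimD(1)[OF t(1)])
  let ?i = "F t"
  have yth: "E (F y) th" if "E y t" for y
    using Fth Ord_trans[OF that t(2) oth] Ord_mem[OF that ot] by blast
  have ith: "E ?i th" using Fth[OF ot] t(2) by blast
  have oi: "Ord ?i" using ith oth Ord_mem by blast
  have mem_i: "E x ?i \<longleftrightarrow> (\<exists>y. E y t \<and> E x (s (F y)))" for x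
    unfolding F[OF ot] by (simp add: csF)
  have oF: "Ord (F y)" if "E y (succ t)" for y
    using that yth ith Ord_mem[OF _ oth] by auto
  have os: "Ord (s (F y))" if "E y t" for y
    using sth[OF yth[OF that]] oth Ord_mem by blast
  have s_sub: "E x (F z)" if "E y z" "E z (succ t)" "E x (s (F y))" for x y z
  proof -
    have "Ord z" using that(2) ot Ord_mem by auto
    then show ?thesis unfolding F[OF \<open>Ord z\<close>] using that by (auto simp: csF)
  qed
  have s_self: "E (F y) (s (F y))" if y: "E y t" for y
  proof -
    have c: "Ord (cup (F y) (bigun (succ (F y)) b))" using os[OF y] unfolding s_def by simp
    then have "E (F y) (succ (cup (F y) (bigun (succ (F y)) b)))"
      using oF y by (intro Ord_leI) simp_all
    then show ?thesis unfolding s_def .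
  qed
  have F_inc: "E (F y) (F z)" if "E y z" "E z t" for y z
    using s_sub[OF that(1)] s_self Ord_trans[OF that ot] that(2) by simp
  have s_mem: "E (s (F y)) ?i" if y: "E y t" for y
  proof -
    have sy: "E (succ y) t" by (rule LimD(3)[OF t(1) y])
    have "E (s (F y)) (succ (F (succ y)))"
      using s_sub[of y "succ y"] sy by (intro Ord_leI[OF os[OF y] oF[of "succ y"]]) (simp_all del: mem_succ add: mem_succ[of _ t] mem_succ[of y y])
    then have "E (s (F y)) (s (F (succ y)))"
      using s_self[OF sy] os[OF sy] by (rule Ord_le_trans)
    then show ?thesis using mem_i sy by blast
  qed
  have "Lim ?i"
    unfolding Lim_def
  proof (intro conjI allI impI oi)
    show "\<exists>y. E y ?i" using s_mem[OF LimD(2)[OF t(1)]] by blast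
    fix x assume "E x ?i"
    then obtain y where y: "E y t" "E x (s (F y))" using mem_i by blast
    have "E (succ x) (succ (s (F y)))" by (rule succ_mem_succ[OF os[OF y(1)] y(2)])
    then show "E (succ x) ?i" using s_mem[OF y(1)] oi by (rule Ord_le_trans)
  qed
  moreover have "cofmap (lam t F) t ?i"
    unfolding cofmap_def
  proof (intro conjI allI impI)
    show "\<exists>z. E z ?i \<and> E (pr y z) (lam t F)" if "E y t" for y
      using that s_mem[OF that] s_self[OF that] Ord_trans[OF _ _ oi] by (auto simp: cF)
    show "\<exists>y. E y t \<and> (\<exists>z. E z ?i \<and> E (pr y z) (lam t F) \<and> E w z)" if w: "E w ?i" for w
    proof -
      obtain y where y: "E y t" "E w (s (F y))" using mem_i w by blast
      have sy: "E (succ y) t" by (rule LimD(3)[OF t(1) y(1)])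
      have "E w (F (succ y))" using s_sub[of y "succ y"] sy y(2) by simp
      moreover have "E (F (succ y)) ?i" using s_mem[OF sy] s_self[OF sy] Ord_trans[OF _ _ oi] by blast
      ultimately show ?thesis using sy by (auto simp: cF)
    qed
  qed (simp_all add: cF F_inc)
  moreover have "E (b r) ?i" if r: "E r ?i" for r
  proof -
    obtain y where y: "E y t" "E r (s (F y))" using mem_i r by blast
    have sy: "E (succ y) t" by (rule LimD(3)[OF t(1) y(1)])
    have ry: "E r (F (succ y))" using s_sub[of y "succ y"] sy y(2) by simp
    let ?c = "cup (F (succ y)) (bigun (succ (F (succ y))) b)"
    have "E r th" using r ith oth Ord_trans by blast
    then have "Ord (b r)" using bth oth Ord_mem by blast
    moreover have "Ord ?c" using os[OF sy] unfolding s_def by simp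
    ultimately have "E (b r) (succ ?c)"
      using ry by (intro Ord_leI) (auto simp: b)
    then have "E (b r) (s (F (succ y)))" unfolding s_def .
    then show ?thesis using mem_i sy by blast
  qed
  moreover have "E i (st {i. E i th \<and> (Lim i \<and> (\<exists>c. cofmap c t i))}) \<longleftrightarrow> E i th \<and> (Lim i \<and> (\<exists>c. cofmap c t i))" for i
    by (rule mem_sep) (intro dfi dfn_cofmap)
  ultimately show "\<exists>i. E i (st {i. E i th \<and> (Lim i \<and> (\<exists>c. cofmap c t i))}) \<and> (\<forall>r. E r i \<longrightarrow> E (b r) i)"
    using ith by blast
qed

text \<open>An iteration of length \<open>om\<close> passes both images at each step. As
  \<open>om\<close> and its elements are fixed, both embeddings are continuous at the supremum and
  fix it. The last clause makes common fixed points unbounded below such a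
  \<open>th\<close>.\<close>

lemma ex_common_fixed: assumes j: "emb M j" and k: "emb M k" and b: "Ord b"
  shows "\<exists>x. Lim x \<and> E b x \<and> j x = x \<and> k x = x \<and>
    (\<forall>th. reg UNIV th \<longrightarrow> E om th \<longrightarrow> j th = th \<longrightarrow> k th = th \<longrightarrow> E b th \<longrightarrow> E x th)"
proof -
  define s where "s x = cup (succ (j x)) (succ (k x))" for x
  have s: "cf s" unfolding s_def by (intro dfi dft_emb[OF j] dft_emb[OF k])
  define F where "F = rec (\<lambda>x r. cup (succ b) (bigun x (\<lambda>y. s (app r y))))"
  have cPhi: "cf2 (\<lambda>x r. cup (succ b) (bigun x (\<lambda>y. s (app r y))))" by (intro dfi cfD[OF s])
  have cF: "cf F" unfolding F_def by (rule cf_rec[OF cPhi])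
  have csF: "cf (\<lambda>y. s (F y))" by (intro dfi cfD[OF s] cfD[OF cF])
  have F: "F x = cup (succ b) (bigun x (\<lambda>y. s (F y)))" if "Ord x" for x
    using rec_eq[OF cPhi that, folded F_def] bigun_cong[of x "\<lambda>y. s (app (lam x F) y)" "\<lambda>y. s (F y)"]
    by (simp add: cF)
  have memF: "E z (F x) \<longleftrightarrow> E z (succ b) \<or> (\<exists>y. E y x \<and> E z (s (F y)))" if "Ord x" for x z
    unfolding F[OF that] by (simp add: csF)
  have Os: "Ord (s x)" if "Ord x" for x
    unfolding s_def using j_Ord[OF j that] j_Ord[OF k that] by (simp add: Ord_cup)
  have OF: "Ord (F x)" if "Ord x" for x
  proof (rule Ord_induct[of "\<lambda>x. Ord (F x)", OF _ that])
    show "dfn (\<lambda>s. Ord (F (s 0)))" by (intro dfi cfD[OF cF])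
    show "Ord (F x)" if "Ord x" "\<And>y. E y x \<Longrightarrow> Ord (F y)" for x
      unfolding F[OF that(1)] using that(2) Os b by (intro Ord_cup Ord_bigun csF) simp_all
  qed
  have Lom: "Ord om" by (rule LimD(1)[OF Lim_om])
  have on: "Ord n" if "E n om" for n using that Lom Ord_mem by blast
  let ?x = "F om"
  have step: "E z ?x" if n: "E n om" and z: "E z (s (F n))" for n z
    using memF[OF Lom] n z by blast
  have js: "E (l (F n)) (s (F n))" if "l = j \<or> l = k" for n l
    using that unfolding s_def by auto
  have below: "\<exists>n. E n om \<and> E z (F n)" if z: "E z ?x" for z
  proof -
    consider "E z (succ b)" | n where "E n om" "E z (s (F n))" using z memF[OF Lom] by blast
    then show ?thesis
    proof cases
      case 1
      then show ?thesis using memF[OF Ord_emp] LimD(2)[OF Lim_om] by blast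
    next
      case 2
      have "E z (F (succ n))" using memF[of "succ n" z] on[OF 2(1)] 2(2) by auto
      then show ?thesis using LimD(3)[OF Lim_om 2(1)] by blast
    qed
  qed
  have Fmem: "E (F n) ?x" "E (j (F n)) ?x" "E (k (F n)) ?x" if n: "E n om" for n
  proof -
    show 1: "E (j (F n)) ?x" "E (k (F n)) ?x" using step[OF n js] by auto
    have "E (F n) (succ (j (F n)))" by (rule j_ge[OF j OF[OF on[OF n]]])
    then show "E (F n) ?x" using 1(1) OF[OF Lom] by (rule Ord_le_trans)
  qed
  have inc: "E (F m) (F n)" if "E m n" "E n om" for m n
  proof -
    have m: "E m om" using that Ord_trans Lom by blast
    have "E (j (F m)) (F n)" using memF[OF on[OF that(2)]] that(1) js[of j m] by blast
    with j_ge[OF j OF[OF on[OF m]]] show ?thesis using OF[OF on[OF that(2)]] by (rule Ord_le_trans)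
  qed
  have bx: "E b ?x" using memF[OF Lom, of b] by simp
  have Lx: "Lim ?x"
    unfolding Lim_def
  proof (intro conjI allI impI)
    show "Ord ?x" by (rule OF[OF Lom])
    show "\<exists>y. E y ?x" using bx by blast
    fix y assume "E y ?x"
    then obtain n where n: "E n om" "E y (F n)" using below by blast
    have "E (succ y) (succ (F n))" by (rule succ_mem_succ[OF OF[OF on[OF n(1)]] n(2)])
    then show "E (succ y) ?x" using Fmem(1)[OF n(1)] OF[OF Lom] by (rule Ord_le_trans)
  qed
  let ?c = "lam om F"
  have cof: "cofmap ?c om ?x"
    unfolding cofmap_def
  proof (intro conjI allI impI)
    show "\<exists>y. E y om \<and> (\<exists>z. E z ?x \<and> E (pr y z) ?c \<and> E w z)" if "E w ?x" for w
      using below[OF that] Fmem(1) by (auto simp: cF)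
  qed (use Fmem(1) inc in \<open>simp_all add: cF\<close>)
  have fixed: "l ?x = ?x" if l: "emb M l" "l = j \<or> l = k" for l
  proof -
    have cl: "cofmap (l ?c) om (l ?x)"
      using transfer3[OF l(1), of "\<lambda>D. cofmap", OF fo_cofmap cof] j_om[OF l(1)] by simp
    have "E w ?x" if w: "E w (l ?x)" for w
    proof -
      obtain n z where n: "E n om" "E z (l ?x)" "E (pr n z) (l ?c)" "E w z"
        using cofmap_cof[OF cl w] by blast
      have "E (pr n (F n)) ?c" using n(1) by (simp add: cF)
      from j_pr_mem[OF l(1) this] have "E (pr n (l (F n))) (l ?c)"
        using j_nat[OF l(1) n(1)] by simp
      moreover have "E (l (F n)) (l ?x)" using Fmem(1)[OF n(1)] j_mem[OF l(1)] by blast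
      ultimately have "z = l (F n)" using cofmap_fun[OF cl n(1,2) _ n(3)] by blast
      then have "E z ?x" using Fmem(2,3)[OF n(1)] l(2) by auto
      with n(4) show ?thesis using OF[OF Lom] Ord_trans by blast
    qed
    then have "E (l ?x) (succ ?x)" by (intro Ord_leI j_Ord[OF l(1)] OF Lom)
    with j_ge[OF l(1) OF[OF Lom]] show ?thesis using mem_asym[of ?x "l ?x"] by auto
  qed
  have "E ?x th" if th: "reg UNIV th" "E om th" "j th = th" "k th = th" "E b th" for th
  proof -
    have Lth: "Lim th" using th(1) unfolding reg_def by blast
    have oth: "Ord th" by (rule LimD(1)[OF Lth])
    have sth: "E (s x) th" if "E x th" for x
    proof -
      have "E (j x) th" "E (k x) th" using that j_mem[OF j, of x th] j_mem[OF k, of x th] th(3,4) by auto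
      then show ?thesis unfolding s_def by (intro cup_mem LimD(3)[OF Lth] oth)
    qed
    have "E x th \<longrightarrow> E (F x) th" if "Ord x" for x
    proof (rule Ord_induct[of "\<lambda>x. E x th \<longrightarrow> E (F x) th", OF _ that])
      show "dfn (\<lambda>s. E (s 0) th \<longrightarrow> E (F (s 0)) th)" by (intro dfi cfD[OF cF])
      fix x assume ox: "Ord x" and IH: "\<And>y. E y x \<Longrightarrow> E y th \<longrightarrow> E (F y) th"
      show "E x th \<longrightarrow> E (F x) th"
      proof
        assume x: "E x th"
        have "E (s (F y)) th" if "E y x" for y using IH[OF that] Ord_trans[OF that x oth] sth by blast
        then obtain c where c: "E c th" "\<And>y. E y x \<Longrightarrow> E (s (F y)) c"
          using reg_bounded[OF th(1) x csF] by blast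
        have oc: "Ord c" using c(1) oth Ord_mem by blast
        have "E (F x) (succ (cup (succ b) c))"
        proof (rule Ord_leI)
          show "Ord (F x)" by (rule OF[OF ox])
          show "Ord (cup (succ b) c)" using b oc by (simp add: Ord_cup)
          show "E z (F x) \<Longrightarrow> E z (cup (succ b) c)" for z
            using memF[OF ox, of z] c(2) Ord_trans[OF _ _ oc] by auto
        qed
        then show "E (F x) th"
          by (rule Ord_le_trans) (intro cup_mem LimD(3)[OF Lth] th c oth)+
      qed
    qed
    then show ?thesis using th(2) Lom by blast
  qed
  with Lx bx fixed j k show ?thesis by blast
qed

section \<open>Agreement of embeddings\<close>

text \<open>All functions are sets here, so that the statement can be transferred. \<open>h\<close>
  is compared with \<open>X\<close> only at the argument at hand, because later the image of
  \<open>X\<close> under \<open>j\<close> is known to be below that under \<open>k\<close> only at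
  arguments \<open>j x = k x\<close>.\<close>

definition "dominated D d th X F \<longleftrightarrow> (\<forall>h\<in>D.
  (\<forall>x. E x th \<longrightarrow> (\<forall>y\<in>D. \<forall>z\<in>D. E (pr x y) h \<longrightarrow> E (pr x z) h \<longrightarrow> y = z)) \<longrightarrow>
  (\<exists>z. E z d \<and> (\<forall>z'. E z' d \<longrightarrow> E z z' \<longrightarrow> (\<exists>x0. E x0 th \<and> (\<forall>x. E x th \<longrightarrow> E x0 x \<longrightarrow>
    (\<forall>y\<in>D. \<forall>u\<in>D. \<forall>g\<in>D. \<forall>w\<in>D. E (pr x y) h \<longrightarrow> E (pr x u) X \<longrightarrow> E y u \<longrightarrow>
      E (pr z' g) F \<longrightarrow> E (pr x w) g \<longrightarrow> E y w))))))"

lemma fo_dominated: "fo (\<lambda>D s. dominated D (s i) (s k) (s l) (s m))"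
  unfolding dominated_def by (intro foi)

definition "sv D th h \<longleftrightarrow>
  (\<forall>x. E x th \<longrightarrow> (\<forall>y\<in>D. \<forall>z\<in>D. E (pr x y) h \<longrightarrow> E (pr x z) h \<longrightarrow> y = z))"

lemma fo_sv: "fo (\<lambda>D s. sv D (s i) (s k))"
  unfolding sv_def by (intro foi)

text \<open>Refutes a disagreement in one fixed direction on a stationary set; the opposite
  direction is the same lemma with \<open>j\<close> and \<open>k\<close> exchanged.\<close>

lemma stationary_agreement: fixes th Q B
  defines "B \<equiv> pow th"
  defines "W \<equiv> Vh B th" and "T \<equiv> \<lambda>i. H (Vh B i)"
  assumes j: "emb M j" and k: "emb M k"
    and th: "reg UNIV th" "j th = th" "k th = th" and kD: "k (H W) = H W"
    and unb: "\<And>b. E b th \<Longrightarrow> \<exists>x. E x th \<and> E b x \<and> j x = k x"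
    and a: "cf a" "\<And>x. Ord x \<Longrightarrow> Ord (a x)" "\<And>x y. Ord x \<Longrightarrow> E y x \<Longrightarrow> E (a y) (a x)"
      "\<And>x. Ord x \<Longrightarrow> j (a x) = k (a x)"
    and Q: "stat th Q" "\<And>i. E i Q \<Longrightarrow> E i th \<and> Lim i"
  shows "\<exists>i. E i Q \<and> \<not> E (j (bigun (T i) a)) (k (bigun (T i) a))"
proof (rule ccontr)
  define X where "X i = bigun (T i) a" for i
  assume "\<not> ?thesis"
  then have drop: "E (j (X i)) (k (X i))" if "E i Q" for i using that unfolding X_def by blast
  let ?D = "H W"
  have Lth: "Lim th" using th(1) unfolding reg_def by blast
  have oth: "Ord th" by (rule LimD(1)[OF Lth])
  have clW: "closed W" unfolding W_def by (rule Vh_closed[OF Lth])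
  have LD: "Lim ?D" by (rule H_Lim[OF clW])
  have cT: "cf T" unfolding T_def by (intro dfi)
  have oT: "Ord x" if "E x (T i)" for x i using that unfolding T_def by (simp add: mem_H)
  have clG: "closed (Vh B i)" if "E i Q" for i using Vh_closed Q(2)[OF that] by blast
  have X: "E x (X i) \<longleftrightarrow> (\<exists>y. E y (T i) \<and> E x (a y))" for x i
    unfolding X_def by (simp add: a(1))
  have cX: "cf X" unfolding X_def by (intro dfi cfD[OF cT] cfD[OF a(1)])
  have aX: "E (a y) (X i)" if "E y (T i)" "E i Q" for y i
  proof -
    have "E (succ y) (T i)" using LimD(3)[OF H_Lim[OF clG[OF that(2)]]] that(1) unfolding T_def by blast
    moreover have "E (a y) (a (succ y))" using oT[OF that(1)] by (intro a(3)) simp_all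
    ultimately show ?thesis using X by blast
  qed
  obtain F where F: "cf F" "\<And>z i. E z ?D \<Longrightarrow> E i Q \<Longrightarrow> E (app (F z) i) (T i)"
    "\<And>z y. E z ?D \<Longrightarrow> E y z \<Longrightarrow>
      \<exists>i0. E i0 th \<and> (\<forall>i. E i Q \<longrightarrow> E i0 i \<longrightarrow> E (app (F y) i) (app (F z) i))"
    using scale[OF Lth Q(2), of Q B] unfolding W_def T_def by blast
  obtain hs N where hs: "cf hs" "\<And>i. E i Q \<Longrightarrow> E (hs i) (T i)"
    and N: "\<And>z. E z ?D \<Longrightarrow> \<exists>y. E y ?D \<and> E z y \<and> below Q F hs y = N"
    and dom: "\<And>h. cf h \<Longrightarrow> (\<And>i. E i Q \<Longrightarrow> E (h i) (T i)) \<Longrightarrow> \<exists>z. E z ?D \<and>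
      (\<forall>y. E y ?D \<longrightarrow> E z (succ y) \<longrightarrow> (\<exists>i0. E i0 th \<and>
        (\<forall>i. E i Q \<longrightarrow> \<not> E i N \<longrightarrow> E i0 i \<longrightarrow> E (h i) (app (F y) i))))"
    using domination[OF Lth Q(2), of Q F] F unfolding W_def T_def B_def by blast
  have unbS: "\<exists>i. E i Q \<and> \<not> E i N \<and> E x i" if "E x th" for x
    by (rule unbounded_complement[OF Lth Q F(1) _ hs(1) _ _ that])
      (use F(3) hs(2) N in \<open>unfold W_def T_def B_def, blast+\<close>)
  \<comment> \<open>The members of \<open>Q\<close> outside \<open>N\<close> are reindexed by
    \<open>th\<close>, which both embeddings fix: \<open>s x\<close> is the least of them above
    \<open>x\<close>.\<close>
  define P where "P x i \<longleftrightarrow> E i Q \<and> \<not> E i N \<and> E x i" for x i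
  define s where "s x = lst (P x)" for x
  have s: "E (s x) Q" "\<not> E (s x) N" "E x (s x)" if x: "E x th" for x
  proof -
    obtain i where i: "P x i" using unbS[OF x] unfolding P_def by blast
    then have "Ord i" using Q(2) LimD(1) unfolding P_def by blast
    moreover have "dfn (\<lambda>s. P x (s 0))" unfolding P_def by (intro dfi)
    ultimately have "P x (s x)" using lst(2) i unfolding s_def by blast
    then show "E (s x) Q" "\<not> E (s x) N" "E x (s x)" unfolding P_def by auto
  qed
  have cs: "cf s" unfolding s_def P_def by (intro dfi)
  have cXs: "cf (\<lambda>x. X (s x))" by (intro dfi cfD[OF cX] cfD[OF cs])
  have cFs: "cf (\<lambda>x. a (app (F z) (s x)))" for z by (intro dfi cfD[OF a(1)] cfD[OF F(1)] cfD[OF cs])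
  have cFF: "cf (\<lambda>z. lam th (\<lambda>x. a (app (F z) (s x))))" by (intro dfi cfD[OF a(1)] cfD[OF F(1)] cfD[OF cs])
  define XX where "XX = lam th (\<lambda>x. X (s x))"
  define FF where "FF = lam ?D (\<lambda>z. lam th (\<lambda>x. a (app (F z) (s x))))"
  have "dominated UNIV ?D th XX FF"
    unfolding dominated_def
  proof (intro ballI impI)
    fix h assume sv: "\<forall>x. E x th \<longrightarrow> (\<forall>y\<in>UNIV. \<forall>z\<in>UNIV. E (pr x y) h \<longrightarrow> E (pr x z) h \<longrightarrow> y = z)"
    \<comment> \<open>The value of \<open>h\<close> at \<open>x\<close> is replaced by the least
      index \<open>e\<close> for which it lies below \<open>a e\<close>.\<close>
    define R where "R x e \<longleftrightarrow> E e (T (s x)) \<and> (\<exists>y. E (pr x y) h \<and> E y (a e))" for x e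
    have dR: "dfn (\<lambda>s. R x (s 0))" for x unfolding R_def by (intro dfi cfD[OF a(1)])
    define e where "e x = lst (R x)" for x
    have ce: "cf e" unfolding e_def R_def by (intro dfi cfD[OF a(1)] cfD[OF cT] cfD[OF cs])
    have e: "R x (e x)" if "\<exists>c. R x c" for x
    proof -
      obtain c where c: "R x c" using \<open>\<exists>c. R x c\<close> by blast
      then have "Ord c" using oT unfolding R_def by blast
      then show ?thesis using lst(2)[OF dR] c unfolding e_def by blast
    qed
    \<comment> \<open>Several \<open>u\<close> may have the same \<open>s u = i\<close>; all of them
      lie in \<open>i\<close> and hence in \<open>Vh B i\<close>, so one value \<open>h' i\<close>
      can bound all their indices.\<close>
    define q where "q i u = st {z. (E u i \<and> s u = i \<and> (\<exists>c. R u c)) \<and> E z (e u)}" for i u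
    have cq: "cf (q i)" for i
      unfolding q_def R_def by (intro dfi cfD[OF a(1)] cfD[OF cT] cfD[OF cs] cfD[OF ce])
    have q1: "q i u = e u" if "E u i" "s u = i" "\<exists>c. R u c" for i u
      unfolding q_def using that by (intro st_eq) blast
    have q2: "q i u = emp" if "\<not> (E u i \<and> s u = i \<and> (\<exists>c. R u c))" for i u
      unfolding q_def using that by (intro st_eq) auto
    define Bd where "Bd i b \<longleftrightarrow> E b (T i) \<and> (\<forall>u. E u (Vh B i) \<longrightarrow> E (q i u) b)" for i b
    have dBd: "dfn (\<lambda>s. Bd i (s 0))" for i unfolding Bd_def by (intro dfi cfD[OF cq])
    define h' where "h' i = lst (Bd i)" for i
    have ch': "cf h'"
      unfolding h'_def Bd_def q_def R_def by (intro dfi cfD[OF a(1)] cfD[OF cT] cfD[OF cs] cfD[OF ce])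
    have h': "Bd i (h' i)" if i: "E i Q" for i
    proof -
      have "E (q i u) (H (Vh B i))" for u
      proof (cases "E u i \<and> s u = i \<and> (\<exists>c. R u c)")
        case True
        then have "q i u = e u" "R u (e u)" "s u = i" using q1 e by blast+
        then show ?thesis unfolding R_def T_def by simp
      next
        case False
        then show ?thesis using q2 LimD(2)[OF H_Lim[OF clG[OF i]]] by simp
      qed
      from H_bounded[OF clG[OF i] cq this] obtain b where "Bd i b" unfolding Bd_def T_def by blast
      moreover from this have "Ord b" using oT unfolding Bd_def by blast
      ultimately show ?thesis using lst(2)[OF dBd] unfolding h'_def by blast
    qed
    then have "E (h' i) (T i)" if "E i Q" for i using that unfolding Bd_def by blast
    from dom[OF ch' this] obtain z where z: "E z ?D" "\<And>y. E y ?D \<Longrightarrow> E z (succ y) \<Longrightarrow> \<exists>i0. E i0 th \<and>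
        (\<forall>i. E i Q \<longrightarrow> \<not> E i N \<longrightarrow> E i0 i \<longrightarrow> E (h' i) (app (F y) i))" by blast
    have main: "\<exists>x0. E x0 th \<and> (\<forall>x. E x th \<longrightarrow> E x0 x \<longrightarrow>
      (\<forall>y\<in>UNIV. \<forall>u\<in>UNIV. \<forall>g\<in>UNIV. \<forall>w\<in>UNIV. E (pr x y) h \<longrightarrow> E (pr x u) XX \<longrightarrow> E y u \<longrightarrow>
        E (pr z' g) FF \<longrightarrow> E (pr x w) g \<longrightarrow> E y w))" if z': "E z' ?D" "E z z'" for z'
    proof -
      have "E z (succ z')" using z'(2) by simp
      from z(2)[OF z'(1) this] obtain i0 where i0: "E i0 th"
        "\<And>i. E i Q \<Longrightarrow> \<not> E i N \<Longrightarrow> E i0 i \<Longrightarrow> E (h' i) (app (F z') i)" by blast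
      have "E y w" if x: "E x th" "E i0 x" and y: "E (pr x y) h" "E (pr x u) XX" "E y u"
        "E (pr z' g) FF" "E (pr x w) g" for x y u g w
      proof -
        note sx = s[OF x(1)]
        have os: "Ord (s x)" using Q(2)[OF sx(1)] LimD(1) by blast
        have u: "u = X (s x)" using y(2) unfolding XX_def by (simp add: cXs)
        have g: "g = lam th (\<lambda>x. a (app (F z') (s x)))" using y(4) unfolding FF_def by (simp add: cFF)
        have w: "w = a (app (F z') (s x))" using y(5) unfolding g by (simp add: cFs)
        have ex: "\<exists>c. R x c" using y(1,3) X unfolding u R_def by blast
        have ye: "E y (a (e x))" using e[OF ex] sv x(1) y(1) unfolding R_def by blast
        have "E x (Vh B (s x))" by (rule Ord_subset_Vh[OF os sx(3)])
        then have 1: "E (e x) (h' (s x))"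
          using h'[OF sx(1)] q1[OF sx(3) _ ex] unfolding Bd_def by force
        have oi: "E i0 (s x)" by (rule Ord_trans[OF x(2) sx(3) os])
        have 2: "E (h' (s x)) (app (F z') (s x))" by (rule i0(2)[OF sx(1,2) oi])
        have oF: "Ord (app (F z') (s x))" by (rule oT[OF F(2)[OF z'(1) sx(1)]])
        have "E (a (e x)) w" unfolding w by (rule a(3)[OF oF Ord_trans[OF 1 2 oF]])
        then show ?thesis using ye a(2)[OF oF] Ord_trans unfolding w by blast
      qed
      with i0(1) show ?thesis by blast
    qed
    with z(1) show "\<exists>z. E z ?D \<and> (\<forall>z'. E z' ?D \<longrightarrow> E z z' \<longrightarrow> (\<exists>x0. E x0 th \<and> (\<forall>x. E x th \<longrightarrow> E x0 x \<longrightarrow>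
      (\<forall>y\<in>UNIV. \<forall>u\<in>UNIV. \<forall>g\<in>UNIV. \<forall>w\<in>UNIV. E (pr x y) h \<longrightarrow> E (pr x u) XX \<longrightarrow> E y u \<longrightarrow>
        E (pr z' g) FF \<longrightarrow> E (pr x w) g \<longrightarrow> E y w))))" by blast
  qed
  from transfer4[OF k, of dominated, OF fo_dominated this]
  have Dk: "dominated M ?D th (k XX) (k FF)" unfolding kD th(3) .
  have "sv UNIV th XX" unfolding sv_def XX_def by (simp add: cXs)
  from transfer2[OF j, of sv, OF fo_sv this] have svj: "sv M th (j XX)" unfolding th(2) .
  \<comment> \<open>In \<open>M\<close> the functions in \<open>k FF\<close> dominate everything
    below \<open>k XX\<close>; this is applied to \<open>j XX\<close>, a single-valued element of
    \<open>M\<close>.\<close>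
  obtain z where z: "E z ?D" "\<And>z'. E z' ?D \<Longrightarrow> E z z' \<Longrightarrow> \<exists>x0. E x0 th \<and> (\<forall>x. E x th \<longrightarrow> E x0 x \<longrightarrow>
    (\<forall>y\<in>M. \<forall>u\<in>M. \<forall>g\<in>M. \<forall>w\<in>M. E (pr x y) (j XX) \<longrightarrow> E (pr x u) (k XX) \<longrightarrow> E y u \<longrightarrow>
      E (pr z' g) (k FF) \<longrightarrow> E (pr x w) g \<longrightarrow> E y w))"
    using bspec[OF Dk[unfolded dominated_def] emb_M[OF j, of XX]] svj[unfolded sv_def] by blast
  \<comment> \<open>As \<open>k y\<close> is at least \<open>y\<close>, it lies above
    \<open>z\<close>. The function of index \<open>k y\<close> in \<open>k FF\<close> is the image
    under \<open>k\<close> of the one of index \<open>y\<close> in \<open>FF\<close>.\<close>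
  define y where "y = succ z"
  have y: "E y ?D" unfolding y_def by (rule LimD(3)[OF LD z(1)])
  have oy: "Ord y" using y by (simp add: mem_H)
  have ky: "E (k y) ?D" using j_mem[OF k, of y ?D] y kD by simp
  have "E z (succ z)" by simp
  then have zk: "E z (k y)"
    using j_ge[OF k oy] Ord_leD j_Ord[OF k oy] unfolding y_def by blast
  obtain x0 where x0: "E x0 th" "\<And>x y' u g w. E x th \<Longrightarrow> E x0 x \<Longrightarrow> y' \<in> M \<Longrightarrow> u \<in> M \<Longrightarrow> g \<in> M \<Longrightarrow> w \<in> M \<Longrightarrow>
    E (pr x y') (j XX) \<Longrightarrow> E (pr x u) (k XX) \<Longrightarrow> E y' u \<Longrightarrow> E (pr (k y) g) (k FF) \<Longrightarrow> E (pr x w) g \<Longrightarrow> E y' w"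
    using z(2)[OF ky zk] by blast
  obtain x where x: "E x th" "E x0 x" "j x = k x" using unb[OF x0(1)] by blast
  have jx: "E (j x) th" using j_mem[OF j, of x th] x(1) th(2) by simp
  have x0j: "E x0 (j x)"
    using Ord_leD[OF j_ge[OF j] _ x(2)] j_Ord[OF j] Ord_mem[OF x(1) oth] by blast
  have pX: "E (pr x (X (s x))) XX" unfolding XX_def using x(1) by (simp add: cXs)
  have pF: "E (pr y (lam th (\<lambda>x. a (app (F y) (s x))))) FF" unfolding FF_def using y by (simp add: cFF)
  have pa: "E (pr x (a (app (F y) (s x)))) (lam th (\<lambda>x. a (app (F y) (s x))))" using x(1) by (simp add: cFs)
  note sx = s[OF x(1)]
  have "E (pr (j x) (k (X (s x)))) (k XX)"
    "E (pr (j x) (k (a (app (F y) (s x))))) (k (lam th (\<lambda>x. a (app (F y) (s x)))))"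
    unfolding x(3) by (rule j_pr_mem[OF k pX], rule j_pr_mem[OF k pa])
  \<comment> \<open>At the common argument \<open>j x = k x\<close> the value of \<open>j XX\<close>
    is below that of \<open>k XX\<close>, so domination applies.\<close>
  then have "E (j (X (s x))) (k (a (app (F y) (s x))))"
    using x0(2)[of "j x" "j (X (s x))" "k (X (s x))" "k (lam th (\<lambda>x. a (app (F y) (s x))))"
        "k (a (app (F y) (s x)))"] jx x0j emb_M[OF j] emb_M[OF k] j_pr_mem[OF j pX] drop[OF sx(1)]
      j_pr_mem[OF k pF] by blast
  moreover have Fy: "E (app (F y) (s x)) (T (s x))" by (rule F(2)[OF y sx(1)])
  moreover have "E (j (a (app (F y) (s x)))) (j (X (s x)))"
    using aX[OF Fy sx(1)] j_mem[OF j] by blast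
  ultimately show False
    using a(4)[OF oT[OF Fy]] mem_asym by metis
qed

lemma not_statE: assumes "\<not> stat th Q"
  obtains b where "cf b" "\<And>r. E r th \<Longrightarrow> E (b r) th" "\<And>i. E i Q \<Longrightarrow> \<exists>r. E r i \<and> \<not> E (b r) i"
proof -
  obtain b where "\<not> (cf b \<longrightarrow> (\<forall>r. E r th \<longrightarrow> E (b r) th) \<longrightarrow> (\<exists>i. E i Q \<and> (\<forall>r. E r i \<longrightarrow> E (b r) i)))"
    using assms unfolding stat_def not_all by (rule exE)
  with that show thesis by blast
qed

text \<open>If both parts fail, two functions witness this; closure under their pointwise union
  implies closure under each.\<close>

lemma stat_split: assumes Q: "stat th Q" and th: "Ord th" and Q12: "\<And>i. E i Q \<Longrightarrow> Lim i \<and> E i th \<and> (E i Q1 \<or> E i Q2)"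
  shows "stat th Q1 \<or> stat th Q2"
proof (rule ccontr)
  assume "\<not> ?thesis"
  then have n: "\<not> stat th Q1" "\<not> stat th Q2" by simp_all
  obtain b where b: "cf b" "\<And>r. E r th \<Longrightarrow> E (b r) th" "\<And>i. E i Q1 \<Longrightarrow> \<exists>r. E r i \<and> \<not> E (b r) i"
    by (rule not_statE[OF n(1)]) (rule that; assumption)
  obtain c where c: "cf c" "\<And>r. E r th \<Longrightarrow> E (c r) th" "\<And>i. E i Q2 \<Longrightarrow> \<exists>r. E r i \<and> \<not> E (c r) i"
    by (rule not_statE[OF n(2)]) (rule that; assumption)
  have "cf (\<lambda>r. cup (b r) (c r))" by (intro dfi cfD[OF b(1)] cfD[OF c(1)])
  moreover have "E (cup (b r) (c r)) th" if "E r th" for r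
    using cup_mem[OF b(2)[OF that] c(2)[OF that] th] .
  ultimately obtain i where i: "E i Q" "\<And>r. E r i \<Longrightarrow> E (cup (b r) (c r)) i"
    using spec[OF Q[unfolded stat_def], of "\<lambda>r. cup (b r) (c r)"] by blast
  have "E (b r) i \<and> E (c r) i" if r: "E r i" for r
  proof -
    have "E r th" using r Q12[OF i(1)] th Ord_trans by blast
    then have o: "Ord (b r)" "Ord (c r)" using b(2) c(2) th Ord_mem by blast+
    have oi: "Ord i" using Q12[OF i(1)] LimD(1) by blast
    show ?thesis
      using Ord_le_trans[OF le_cup(1)[OF o] i(2)[OF r] oi] Ord_le_trans[OF le_cup(2)[OF o] i(2)[OF r] oi] by blast
  qed
  then show False using Q12[OF i(1)] b(3) c(3) by blast
qed

theorem embeddings_agree: assumes j: "emb M j" and k: "emb M k" and "Ord x"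
  shows "j x = k x"
proof (rule ccontr)
  assume "j x \<noteq> k x"
  moreover have "dfn (\<lambda>s. j (s 0) \<noteq> k (s 0))" by (intro dfi dft_emb[OF j] dft_emb[OF k])
  ultimately obtain al where al: "Ord al" "j al \<noteq> k al" "\<And>y. E y al \<Longrightarrow> j y = k y"
    using Ord_least[of "\<lambda>x. j x \<noteq> k x"] \<open>Ord x\<close> by blast
  have Lal: "Lim al"
    using al(1)
  proof (cases rule: Ord_cases)
    case (2 y)
    then have "j y = k y" by (intro al(3)) simp
    then show ?thesis using al(2) 2 j_succ[OF j] j_succ[OF k] by simp
  qed (use al(2) j_emp[OF j] j_emp[OF k] in auto)
  define t where "t = H (Vh emp al)"
  have clt: "closed (Vh emp al)" by (rule Vh_closed[OF Lal])
  have rt: "reg UNIV t" unfolding t_def by (rule reg_H[OF clt])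
  have tA: "j t \<noteq> k t"
    using H_Vh_agree[OF j k _ Lal, of emp] al(2) j_emp[OF j] j_emp[OF k] unfolding t_def by auto
  obtain ga where ga: "Lim ga" "E al ga" "j ga = ga" "k ga = ga"
    using ex_common_fixed[OF j k al(1)] by blast
  have oga: "Ord ga" by (rule LimD(1)[OF ga(1)])
  define th where "th = H (Vh emp ga)"
  have thr: "reg UNIV th" unfolding th_def by (rule reg_H[OF Vh_closed[OF ga(1)]])
  have Lth: "Lim th" using thr unfolding reg_def by blast
  have oth: "Ord th" by (rule LimD(1)[OF Lth])
  have jth: "j th = th" "k th = th"
    unfolding th_def
    using emb_H_fixed[OF j oga ga(3), of emp] emb_H_fixed[OF k oga ga(4), of emp] j_emp[OF j] j_emp[OF k] by auto
  have tth: "E t th" unfolding t_def th_def by (rule H_Vh_mono[OF Lal ga(1,2)])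
  have oom: "Ord om" by (rule LimD(1)[OF Lim_om])
  have omth: "E om th"
  proof -
    have "E om (succ ga)" using om_least ga(1) Ord_not_mem[OF oga oom] by blast
    then have "E y (Vh emp ga)" if "E y om" for y
      using Ord_leD[OF _ oga that] Ord_subset_Vh[OF oga] by blast
    then show ?thesis unfolding th_def by (intro mem_H_subset oom)
  qed
  have unbA: "\<exists>x. Ord x \<and> E b x \<and> j x = k x \<and> (E b th \<longrightarrow> E x th)" if b: "Ord b" for b
    using ex_common_fixed[OF j k b] thr omth jth LimD(1) by metis
  \<comment> \<open>\<open>A r y x\<close> makes \<open>x\<close> a candidate for the
    \<open>y\<close>-th point of agreement, with \<open>r\<close> holding the earlier ones.\<close>
  define A where "A r y x \<longleftrightarrow> j x = k x \<and> (\<forall>z. E z y \<longrightarrow> E (app r z) x)" for r y x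
  have cA: "cf2 (\<lambda>y r. lst (A r y))" unfolding A_def by (intro dfi dft_emb[OF j] dft_emb[OF k])
  define a where "a = rec (\<lambda>y r. lst (A r y))"
  have ca: "cf a" unfolding a_def by (rule cf_rec[OF cA])
  have aeq: "a y = lst (A (lam y a) y)" if "Ord y" for y
    using rec_eq[OF cA that] unfolding a_def .
  have step: "Ord (a y) \<and> A (lam y a) y (a y)" if y: "Ord y" and IH: "\<And>z. E z y \<Longrightarrow> Ord (a z)" for y
  proof -
    have ob: "Ord (bigun y a)" using IH by (intro Ord_bigun ca)
    obtain x where x: "Ord x" "E (bigun y a) x" "j x = k x" using unbA[OF ob] by blast
    have "E (app (lam y a) z) x" if z: "E z y" for z
    proof -
      have "E (a z) (succ (bigun y a))"
        using z by (intro Ord_leI[OF IH[OF z] ob]) (auto simp: ca)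
      then show ?thesis using Ord_le_trans[OF _ x(2,1)] z by (simp add: ca)
    qed
    then have "A (lam y a) y x" using x(3) unfolding A_def by blast
    moreover have "dfn (\<lambda>s. A (lam y a) y (s 0))"
      unfolding A_def by (intro dfi dft_emb[OF j] dft_emb[OF k])
    ultimately show ?thesis using lst(1,2)[of "A (lam y a) y"] x(1) aeq[OF y] by simp
  qed
  have a0: "Ord (a y)" if y: "Ord y" for y
  proof (rule Ord_induct[of "\<lambda>y. Ord (a y)", OF _ y])
    show "dfn (\<lambda>s. Ord (a (s 0)))" by (intro dfi cfD[OF ca])
  qed (use step in blast)
  have a1: "A (lam y a) y (a y)" if y: "Ord y" for y
    using step[OF y] a0 Ord_mem[OF _ y] by blast
  have aA: "j (a y) = k (a y)" if "Ord y" for y using a1[OF that] unfolding A_def by blast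
  have ainc: "E (a z) (a y)" if "Ord y" "E z y" for y z
    using a1[OF that(1)] that(2) app_lam[OF ca that(2)] unfolding A_def by auto
  define B where "B = pow th"
  define T where "T i = H (Vh B i)" for i
  define X where "X i = bigun (T i) a" for i
  have cX: "cf X" unfolding X_def T_def by (intro dfi cfD[OF ca])
  have jB: "E z B" if "E z (l B)" "emb M l" "l th = th" for z l
    using j_pow[OF that(2), of z th] that(1,3) unfolding B_def by simp
  \<comment> \<open>Both sides are the power set of \<open>th\<close> in the sense of
    \<open>M\<close>.\<close>
  have BA: "j B = k B"
    unfolding B_def using j_pow[OF j, of _ th] j_pow[OF k, of _ th] jth by (intro set_ext) simp
  have kD: "l (H (Vh B th)) = H (Vh B th)" if "emb M l" "l th = th" for l
    using emb_H_fixed[OF that(1) oth that(2)] jB that by blast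
  have XA: "j (X i) \<noteq> k (X i) \<and> Ord (X i)" if i: "Lim i" "cofmap c t i" for i c
  proof -
    have LT: "Lim (T i)" unfolding T_def by (rule H_Lim[OF Vh_closed[OF i(1)]])
    have oT: "Ord y" if "E y (T i)" for y using that LimD(1)[OF LT] Ord_mem by blast
    have X: "E x (X i) \<longleftrightarrow> (\<exists>y. E y (T i) \<and> E x (a y))" for x
      unfolding X_def by (simp add: ca)
    have aX: "E (a y) (X i)" if "E y (T i)" for y
      using X ainc[of "succ y" y] LimD(3)[OF LT that] oT[OF that] by auto
    have oX: "Ord (X i)" unfolding X_def using a0 oT by (intro Ord_bigun ca) blast
    \<comment> \<open>Agreement at \<open>X i\<close> would pass down to its cofinality
      \<open>T i\<close>, from there to \<open>i\<close>, and on to the cofinality \<open>t\<close>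
      of \<open>i\<close>.\<close>
    have "cofmap (lam (T i) a) (T i) (X i)"
      unfolding cofmap_def
    proof (intro conjI allI impI)
      show "\<exists>y. E y (T i) \<and> (\<exists>z. E z (X i) \<and> E (pr y z) (lam (T i) a) \<and> E w z)" if w: "E w (X i)" for w
        using w X aX by (auto simp: ca)
    qed (use aX ainc oT in \<open>simp_all add: ca\<close>)
    from cofinality_agree[OF j k _ this oX] have "j (T i) = k (T i)" if "j (X i) = k (X i)"
      using reg_H[OF Vh_closed[OF i(1)]] that unfolding T_def by blast
    then have "j i = k i" if "j (X i) = k (X i)"
      using H_Vh_agree[OF j k BA i(1)] that unfolding T_def by blast
    then have "j t = k t" if "j (X i) = k (X i)"
      using cofinality_agree[OF j k rt i(2) LimD(1)[OF i(1)]] that by blast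
    with tA oX show ?thesis by blast
  qed
  define Q where "Q = st {i. E i th \<and> (Lim i \<and> (\<exists>c. cofmap c t i))}"
  have Q: "E i Q \<longleftrightarrow> E i th \<and> (Lim i \<and> (\<exists>c. cofmap c t i))" for i
    unfolding Q_def by (rule mem_sep) (intro dfi dfn_cofmap)
  have Lt: "Lim t" using rt unfolding reg_def by blast
  have Qs: "stat th Q" unfolding Q_def by (rule stat_cofinality[OF thr Lt tth])
  define Q1 where "Q1 = st {i. E i Q \<and> E (j (X i)) (k (X i))}"
  define Q2 where "Q2 = st {i. E i Q \<and> E (k (X i)) (j (X i))}"
  have Q1: "E i Q1 \<longleftrightarrow> E i Q \<and> E (j (X i)) (k (X i))" for i
    unfolding Q1_def by (rule mem_sep) (intro dfi dft_emb[OF j] dft_emb[OF k] cfD[OF cX])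
  have Q2: "E i Q2 \<longleftrightarrow> E i Q \<and> E (k (X i)) (j (X i))" for i
    unfolding Q2_def by (rule mem_sep) (intro dfi dft_emb[OF j] dft_emb[OF k] cfD[OF cX])
  have "E i Q1 \<or> E i Q2" if "E i Q" for i
    using XA Ord_linear[OF j_Ord[OF j] j_Ord[OF k]] that unfolding Q Q1 Q2 by blast
  then have "stat th Q1 \<or> stat th Q2"
    using stat_split[OF Qs oth] Q by blast
  moreover have unb: "\<exists>x. E x th \<and> E b x \<and> j x = k x" if "E b th" for b
    using unbA[of b] that oth Ord_mem by blast
  moreover have "\<not> stat th Q1"
    using stationary_agreement[OF j k thr jth kD[OF k jth(2), unfolded B_def] unb ca a0 ainc aA, of Q1] Q Q1
    unfolding X_def T_def B_def by blast
  moreover have "\<not> stat th Q2"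
    using stationary_agreement[OF k j thr jth(2,1) kD[OF j jth(1), unfolded B_def] _ ca a0 ainc aA[symmetric], of Q2]
      unb Q Q2
    unfolding X_def T_def B_def by metis
  ultimately show False by blast
qed

end

theorem theorem3p5:
  fixes E :: "'v \<Rightarrow> 'v \<Rightarrow> bool" and Cls :: "'v set set"
    and M :: "'v set" and j\<^sub>0 j\<^sub>1 :: "'v \<Rightarrow> 'v"
  assumes "NBG_AC E Cls"
    and "inner_model E Cls M"
    and "elementary_embedding E Cls M j\<^sub>0"
    and "elementary_embedding E Cls M j\<^sub>1"
  shows "\<forall>\<alpha>. ordinal E \<alpha> \<longrightarrow> j\<^sub>0 \<alpha> = j\<^sub>1 \<alpha>"
proof -
  interpret NBG_AC E Cls by (rule assms(1))
  show ?thesis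
    using embeddings_agree[OF emb_elementary[OF assms(2,3)] emb_elementary[OF assms(2,4)] ordinal_Ord]
    by blast
qed

end
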